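(* Let $\alpha,\beta\in[0,1]$ and let $\mathcal{H}$ and $\mathbb{B}:\mathfrak{D}(\mathbb{B})\subset\mathcal{H}\to\mathcal{H}$ be the phase space and operator of the double-walled carbon nanotube system defined in the context. Given $U_0\in\mathcal{H}$, there exists a unique weak solution $U$ of the problem $$\frac{d}{dt}U(t)=\mathbb{B}U(t),\qquad U(0)=U_0,$$ satisfying $U\in C([0,+\infty),\mathcal{H})$. Furthermore, if $U_0\in\mathfrak{D}(\mathbb{B}^k)$ with $k\in\mathbb{N}$, then the solution $U$ satisfies $$U\in\bigcap_{j=0}^{k}C^{k-j}\big([0,+\infty),\mathfrak{D}(\mathbb{B}^j)\big).$$
   Context: Fix $l>0$ and real constants $m,b_1,b_2,\kappa_1,\kappa_2,\rho_1,\rho_2,\rho_3,\rho_4,\gamma_1,\gamma_2,\gamma_3,\gamma_4>0$. All function spaces are over $\mathbb{C}$; $\langle\cdot,\cdot\rangle$ and $\|\cdot\|$ are the inner product and norm of $L^2(0,l)$. Let $L^2_*(0,l)=\{u\in L^2(0,l):\int_0^l u\,dx=0\}$. Let $A=-\partial_{xx}$ on $L^2(0,l)$ with domain $D(A)=H^2(0,l)\cap H^1_0(0,l)$, and $A_*=-\partial_{xx}$ on $L^2_*(0,l)$ with domain $D(A_* )=\{v\in H^2(0,l)\cap L^2_*(0,l): v_x(0)=v_x(l)=0\}$. Both are positive self-adjoint with compact inverse, so $A^\sigma,A_*^\sigma$ are defined for all $\sigma\in\mathbb{R}$; $D(A^0)=L^2(0,l)$, $D(A_*^0)=L^2_*(0,l)$,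 $D(A^{1/2})=H^1_0(0,l)$, $D(A_*^{1/2})=H^1(0,l)\cap L^2_*(0,l)$. The phase space is $\mathcal{H}=[D(A^{1/2})\times D(A^0)\times D(A_*^{1/2})\times D(A_*^0)]^2$, with elements $U=(u,\tilde u,v,\tilde v,y,\tilde y,z,\tilde z)^T$, a Hilbert space with the norm (and corresponding inner product) $$\|U\|_{\mathcal{H}}^2=\rho_1\|\tilde u\|^2+\rho_2\|\tilde v\|^2+\rho_3\|\tilde y\|^2+\rho_4\|\tilde z\|^2+\kappa_1\|u_x-v\|^2+\kappa_2\|y_x-z\|^2+m\|y-u\|^2+b_1\|A_*^{1/2}v\|^2+b_2\|A_*^{1/2}z\|^2.$$ The operator $\mathbb{B}$ is $\mathbb{B}U=(\tilde u,B_2,\tilde v,B_4,\tilde y,B_6,\tilde z,B_8)^T$ with $$\begin{aligned}\rho_1B_2&=-A(\kappa_1u+\gamma_1\tilde u)-\kappa_1v_x-\gamma_1\tilde v_x+m(y-u),\\ \rho_2B_4&=-A_*(b_1v+\gamma_2A_*^{\alpha-1}\tilde v)+\kappa_1(u_x-v)+\gamma_1(\tilde u_x-\tilde v),\\ \rho_3B_6&=-A(\kappa_2y+\gamma_3\tilde y)-\kappa_2z_x-\gamma_3\tilde z_x-m(y-u),\\ \rho_4B_8&=-A_*(b_2z+\gamma_4A_*^{\beta-1}\tilde z)+\kappa_2(y_x-z)+\gamma_3(\tilde y_x-\tilde z),\end{aligned}$$ and domain $$\mathfrak{D}(\mathbb{B})=\{U\in\mathcal{H}:(\tilde u,\tilde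 v,\tilde y,\tilde z)\in[D(A^{1/2})\times D(A_*^{1/2})]^2,\ \kappa_1u+\gamma_1\tilde u,\ \kappa_2y+\gamma_3\tilde y\in D(A),\ b_1v+\gamma_2A_*^{\alpha-1}\tilde v,\ b_2z+\gamma_4A_*^{\beta-1}\tilde z\in D(A_* )\}.$$ The equation $U_t=\mathbb{B}U$ (with $\tilde u=u_t$, etc.) is the abstract form of the system $$\begin{aligned}&\rho_1u_{tt}-\kappa_1(u_x-v)_x-m(y-u)-\gamma_1(u_x-v)_{xt}=0,\\&\rho_2v_{tt}-b_1v_{xx}-\kappa_1(u_x-v)-\gamma_1(u_x-v)_t+\gamma_2(-\partial_{xx})^\alpha v_t=0,\\&\rho_3y_{tt}-\kappa_2(y_x-z)_x+m(y-u)-\gamma_3(y_x-z)_{xt}=0,\\&\rho_4z_{tt}-b_2z_{xx}-\kappa_2(y_x-z)-\gamma_3(y_x-z)_t+\gamma_4(-\partial_{xx})^\beta z_t=0\end{aligned}$$ on $(0,l)\times(0,\infty)$ with $u=y=0$ and $v_x=z_x=0$ at $x=0,l$. Here $\mathfrak{D}(\mathbb{B}^0)=\mathcal{H}$, $\mathfrak{D}(\mathbb{B}^j)$ carries the graph norm, and "weak solution" is meant in the usual semigroup sense (mild solution). *)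

theory Defs
  imports "HOL-Analysis.Analysis"
begin

definition sq_int :: "(real \<Rightarrow> complex) \<Rightarrow> bool" where
  "sq_int f \<longleftrightarrow> f \<in> borel_measurable lborel \<and> integrable lborel (\<lambda>x. (cmod (f x))\<^sup>2)"

lemma sq_int_zero: "sq_int (\<lambda>_. 0)"
  by (simp add: sq_int_def)

lemma sq_int_add:
  assumes "sq_int f" "sq_int g" shows "sq_int (\<lambda>x. f x + g x)"
proof -
  have [measurable]: "f \<in> borel_measurable lborel" "g \<in> borel_measurable lborel"
    using assms by (auto simp: sq_int_def)
  have "integrable lborel (\<lambda>x. 2 * (cmod (f x))\<^sup>2 + 2 * (cmod (g x))\<^sup>2)"
    using assms by (auto simp: sq_int_def)
  then have "integrable lborel (\<lambda>x. (cmod (f x + g x))\<^sup>2)"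
  proof (rule Bochner_Integration.integrable_bound)
    show "AE x in lborel. norm ((cmod (f x + g x))\<^sup>2)
        \<le> norm (2 * (cmod (f x))\<^sup>2 + 2 * (cmod (g x))\<^sup>2)"
    proof (rule AE_I2)
      fix x
      have "(cmod (f x + g x))\<^sup>2 \<le> (cmod (f x) + cmod (g x))\<^sup>2"
        by (intro power_mono norm_triangle_ineq norm_ge_zero)
      also have "\<dots> \<le> 2 * (cmod (f x))\<^sup>2 + 2 * (cmod (g x))\<^sup>2"
        using sum_squares_bound[of "cmod (f x)" "cmod (g x)"] by (simp add: power2_sum)
      finally show "norm ((cmod (f x + g x))\<^sup>2)
          \<le> norm (2 * (cmod (f x))\<^sup>2 + 2 * (cmod (g x))\<^sup>2)" by simp
    qed
  qed measurable
  then show ?thesis by (simp add: sq_int_def)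
qed

lemma sq_int_cmult:
  assumes "sq_int f" shows "sq_int (\<lambda>x. c * f x)"
  using assms by (auto simp: sq_int_def norm_mult power_mult_distrib)

lemma sq_int_scaleR:
  assumes "sq_int f" shows "sq_int (\<lambda>x. r *\<^sub>R f x)"
  using sq_int_cmult[OF assms, of "of_real r"] by (simp add: scaleR_conv_of_real)

lemma sq_int_uminus:
  assumes "sq_int f" shows "sq_int (\<lambda>x. - f x)"
  using sq_int_cmult[OF assms, of "-1"] by simp

lemma sq_int_diff:
  assumes "sq_int f" "sq_int g" shows "sq_int (\<lambda>x. f x - g x)"
  using sq_int_add[OF assms(1) sq_int_uminus[OF assms(2)]] by simp

lemma sq_int_mult_integrable:
  assumes "sq_int f" "sq_int g" shows "integrable lborel (\<lambda>x. f x * cnj (g x))"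
proof -
  have [measurable]: "f \<in> borel_measurable lborel" "g \<in> borel_measurable lborel"
    using assms by (auto simp: sq_int_def)
  have "cnj \<in> borel_measurable borel"
    by (intro borel_measurable_continuous_onI continuous_intros)
  then have [measurable]: "(\<lambda>x. cnj (g x)) \<in> borel_measurable lborel"
    by (rule measurable_compose[rotated]) measurable
  have "integrable lborel (\<lambda>x. (cmod (f x))\<^sup>2 + (cmod (g x))\<^sup>2)"
    using assms by (auto simp: sq_int_def)
  then show ?thesis
  proof (rule Bochner_Integration.integrable_bound)
    show "AE x in lborel. norm (f x * cnj (g x)) \<le> norm ((cmod (f x))\<^sup>2 + (cmod (g x))\<^sup>2)"
    proof (rule AE_I2)
      fix x
      have "2 * (cmod (f x) * cmod (g x)) \<le> (cmod (f x))\<^sup>2 + (cmod (g x))\<^sup>2"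
        using sum_squares_bound[of "cmod (f x)" "cmod (g x)"] by simp
      moreover have "0 \<le> cmod (f x) * cmod (g x)" by simp
      ultimately have "cmod (f x) * cmod (g x) \<le> (cmod (f x))\<^sup>2 + (cmod (g x))\<^sup>2"
        by linarith
      then show "norm (f x * cnj (g x)) \<le> norm ((cmod (f x))\<^sup>2 + (cmod (g x))\<^sup>2)"
        by (simp add: norm_mult)
    qed
  qed measurable
qed

definition ae_eq :: "(real \<Rightarrow> complex) \<Rightarrow> (real \<Rightarrow> complex) \<Rightarrow> bool" where
  "ae_eq f g \<longleftrightarrow> sq_int f \<and> sq_int g \<and> (AE x in lborel. f x = g x)"

quotient_type L2 = "real \<Rightarrow> complex" / partial: ae_eq
proof (rule part_equivpI)
  show "\<exists>f. ae_eq f f"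
    by (rule exI[of _ "\<lambda>_. 0"]) (simp add: ae_eq_def sq_int_zero)
  show "symp ae_eq"
    by (rule sympI) (auto simp: ae_eq_def elim: AE_mp)
  show "transp ae_eq"
    by (rule transpI) (auto simp: ae_eq_def elim: AE_mp)
qed

lift_definition cinner :: "L2 \<Rightarrow> L2 \<Rightarrow> complex"
  is "\<lambda>f g. LINT x|lborel. f x * cnj (g x)"
proof -
  fix f f' g g' assume a: "ae_eq f f'" "ae_eq g g'"
  then have int: "integrable lborel (\<lambda>x. f x * cnj (g x))"
      "integrable lborel (\<lambda>x. f' x * cnj (g' x))"
    by (simp_all add: ae_eq_def sq_int_mult_integrable)
  have "AE x in lborel. f x * cnj (g x) = f' x * cnj (g' x)"
    using a by (auto simp: ae_eq_def elim: AE_mp)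
  then show "(LINT x|lborel. f x * cnj (g x)) = (LINT x|lborel. f' x * cnj (g' x))"
    using int by (intro integral_cong_AE) (auto dest: borel_measurable_integrable)
qed

instantiation L2 :: real_inner
begin

lift_definition zero_L2 :: L2 is "\<lambda>_. 0"
  by (simp add: ae_eq_def sq_int_zero)

lift_definition plus_L2 :: "L2 \<Rightarrow> L2 \<Rightarrow> L2" is "\<lambda>f g x. f x + g x"
  by (auto simp: ae_eq_def sq_int_add elim: AE_mp)

lift_definition minus_L2 :: "L2 \<Rightarrow> L2 \<Rightarrow> L2" is "\<lambda>f g x. f x - g x"
  by (auto simp: ae_eq_def sq_int_diff elim: AE_mp)

lift_definition uminus_L2 :: "L2 \<Rightarrow> L2" is "\<lambda>f x. - f x"
  by (auto simp: ae_eq_def sq_int_uminus elim: AE_mp)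

lift_definition scaleR_L2 :: "real \<Rightarrow> L2 \<Rightarrow> L2" is "\<lambda>r f x. r *\<^sub>R f x"
  by (auto simp: ae_eq_def sq_int_scaleR elim: AE_mp)

definition inner_L2 :: "L2 \<Rightarrow> L2 \<Rightarrow> real" where "inner_L2 f g = Re (cinner f g)"

definition norm_L2 :: "L2 \<Rightarrow> real" where "norm_L2 f = sqrt (inner f f)"

definition sgn_L2 :: "L2 \<Rightarrow> L2" where "sgn_L2 f = inverse (norm f) *\<^sub>R f"

definition dist_L2 :: "L2 \<Rightarrow> L2 \<Rightarrow> real" where "dist_L2 f g = norm (f - g)"

definition uniformity_L2 :: "(L2 \<times> L2) filter" where
  "uniformity_L2 = (INF e\<in>{0<..}. principal {(x, y). dist x y < e})"

definition open_L2 :: "L2 set \<Rightarrow> bool" where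
  "open_L2 U \<longleftrightarrow> (\<forall>x\<in>U. \<forall>\<^sub>F (x', y) in uniformity. x' = x \<longrightarrow> y \<in> U)"

lemma cinner_self_Re:
  assumes "sq_int f"
  shows "Re (LINT x|lborel. f x * cnj (f x)) = (LINT x|lborel. (cmod (f x))\<^sup>2)"
proof -
  have "(LINT x|lborel. f x * cnj (f x)) = (LINT x|lborel. complex_of_real ((cmod (f x))\<^sup>2))"
    by (simp only: complex_norm_square)
  also have "\<dots> = complex_of_real (LINT x|lborel. (cmod (f x))\<^sup>2)"
    by (rule integral_complex_of_real)
  finally show ?thesis by simp
qed

instance
proof
  fix f g h :: L2 and a b r s :: real
  show "f + g + h = f + (g + h)"
    by transfer (auto simp: ae_eq_def add.assoc intro!: sq_int_add)
  show "f + g = g + f"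
    by transfer (auto simp: ae_eq_def add.commute intro!: sq_int_add)
  show "0 + f = f"
    by transfer (auto simp: ae_eq_def)
  show "- f + f = 0"
    by transfer (auto simp: ae_eq_def sq_int_zero)
  show "f - g = f + - g"
    by transfer (auto simp: ae_eq_def intro!: sq_int_diff)
  show "a *\<^sub>R (f + g) = a *\<^sub>R f + a *\<^sub>R g"
    by transfer (auto simp: ae_eq_def scaleR_right_distrib
        intro!: sq_int_add sq_int_scaleR)
  show "(a + b) *\<^sub>R f = a *\<^sub>R f + b *\<^sub>R f"
    by transfer (auto simp: ae_eq_def scaleR_left_distrib intro!: sq_int_add sq_int_scaleR)
  show "a *\<^sub>R b *\<^sub>R f = (a * b) *\<^sub>R f"
    by transfer (auto simp: ae_eq_def intro!: sq_int_scaleR)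
  show "1 *\<^sub>R f = f"
    by transfer (auto simp: ae_eq_def)
  show "dist f g = norm (f - g)" by (rule dist_L2_def)
  show "sgn f = inverse (norm f) *\<^sub>R f" by (rule sgn_L2_def)
  show "uniformity = (INF e\<in>{0<..}. principal {(x::L2, y). dist x y < e})"
    by (rule uniformity_L2_def)
  show "open U \<longleftrightarrow> (\<forall>x\<in>U. \<forall>\<^sub>F (x', y) in uniformity. x' = x \<longrightarrow> y \<in> U)" for U :: "L2 set"
    by (rule open_L2_def)
  show "inner f g = inner g f"
    unfolding inner_L2_def
  proof transfer
    fix f g assume "ae_eq f f" "ae_eq g g"
    have "(LINT x|lborel. g x * cnj (f x)) = (LINT x|lborel. cnj (f x * cnj (g x)))"
      by (simp add: mult.commute)
    then show "Re (LINT x|lborel. f x * cnj (g x)) = Re (LINT x|lborel. g x * cnj (f x))"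
      by (simp del: complex_cnj_mult)
  qed
  show "inner (f + g) h = inner f h + inner g h"
    unfolding inner_L2_def
  proof transfer
    fix f g h assume "ae_eq f f" "ae_eq g g" "ae_eq h h"
    then show "Re (LINT x|lborel. (f x + g x) * cnj (h x))
        = Re (LINT x|lborel. f x * cnj (h x)) + Re (LINT x|lborel. g x * cnj (h x))"
      by (simp add: ae_eq_def distrib_right Bochner_Integration.integral_add sq_int_mult_integrable)
  qed
  show "inner (r *\<^sub>R f) g = r * inner f g"
    unfolding inner_L2_def by transfer (simp add: scaleR_conv_of_real mult.assoc)
  show "0 \<le> inner f f"
    unfolding inner_L2_def by transfer (simp add: ae_eq_def cinner_self_Re)
  show "inner f f = 0 \<longleftrightarrow> f = 0"
    unfolding inner_L2_def
  proof transfer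
    fix f assume "ae_eq f f"
    then have f: "sq_int f" by (simp add: ae_eq_def)
    then have "integrable lborel (\<lambda>x. (cmod (f x))\<^sup>2)" by (simp add: sq_int_def)
    then have "(LINT x|lborel. (cmod (f x))\<^sup>2) = 0 \<longleftrightarrow> (AE x in lborel. (cmod (f x))\<^sup>2 = 0)"
      by (rule integral_nonneg_eq_0_iff_AE) simp
    then show "Re (LINT x|lborel. f x * cnj (f x)) = 0 \<longleftrightarrow> ae_eq f (\<lambda>_. 0)"
      using f by (simp add: cinner_self_Re ae_eq_def sq_int_zero)
  qed
  show "norm f = sqrt (inner f f)" by (rule norm_L2_def)
qed

end

text \<open>The space \<open>L\<^sup>2(0,l)\<close> is identified, isometrically via extension by zero, with the classes of
  functions on the line that vanish almost everywhere outside \<open>(0,l)\<close>; this keeps \<open>l\<close> a variable.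
  All predicates on representatives below are invariant under equality almost everywhere.\<close>

definition L2_on :: "real \<Rightarrow> L2 set" where
  "L2_on l = {u. AE x in lborel. x \<notin> {0<..<l} \<longrightarrow> rep_L2 u x = 0}"

definition L2_mean0 :: "real \<Rightarrow> L2 set" where
  "L2_mean0 l = {u \<in> L2_on l. (LINT x:{0<..<l}|lborel. rep_L2 u x) = 0}"

definition vderiv :: "(real \<Rightarrow> complex) \<Rightarrow> real \<Rightarrow> complex" where
  "vderiv \<phi> = (\<lambda>x. vector_derivative \<phi> (at x))"

definition test_fun :: "real \<Rightarrow> (real \<Rightarrow> complex) set" where
  "test_fun l = {\<phi>. (\<forall>n x. (vderiv ^^ n) \<phi> differentiable (at x)) \<and>
                    (\<exists>a b. 0 < a \<and> b < l \<and> (\<forall>x. x \<notin> {a..b} \<longrightarrow> \<phi> x = 0))}"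

definition is_wderiv :: "real \<Rightarrow> L2 \<Rightarrow> L2 \<Rightarrow> bool" where
  "is_wderiv l u g \<longleftrightarrow> u \<in> L2_on l \<and> g \<in> L2_on l \<and>
     (\<forall>\<phi>\<in>test_fun l. (LINT x:{0<..<l}|lborel. rep_L2 u x * vderiv \<phi> x)
                    = - (LINT x:{0<..<l}|lborel. rep_L2 g x * \<phi> x))"

definition wderiv :: "real \<Rightarrow> L2 \<Rightarrow> L2" where
  "wderiv l u = (THE g. is_wderiv l u g)"

definition H1 :: "real \<Rightarrow> L2 set" where
  "H1 l = {u. \<exists>g. is_wderiv l u g}"

definition H2 :: "real \<Rightarrow> L2 set" where
  "H2 l = {u \<in> H1 l. wderiv l u \<in> H1 l}"

definition H10 :: "real \<Rightarrow> L2 set" where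
  "H10 l = {u \<in> H1 l. \<forall>\<epsilon>>0. \<exists>\<phi>\<in>test_fun l.
      norm (u - abs_L2 \<phi>) < \<epsilon> \<and> norm (wderiv l u - abs_L2 (vderiv \<phi>)) < \<epsilon>}"

text \<open>Boundary values are those of the continuous representative on \<open>[0,l]\<close>.\<close>

definition zero_trace :: "real \<Rightarrow> L2 \<Rightarrow> bool" where
  "zero_trace l w \<longleftrightarrow> (\<exists>f. continuous_on {0..l} f \<and>
     (AE x in lborel. x \<in> {0<..<l} \<longrightarrow> rep_L2 w x = f x) \<and> f 0 = 0 \<and> f l = 0)"

definition neg_dxx :: "real \<Rightarrow> L2 \<Rightarrow> L2" where
  "neg_dxx l u = - wderiv l (wderiv l u)"

definition dom_A :: "real \<Rightarrow> L2 set" where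
  "dom_A l = H2 l \<inter> H10 l"

definition dom_As :: "real \<Rightarrow> L2 set" where
  "dom_As l = {v \<in> H2 l \<inter> L2_mean0 l. zero_trace l (wderiv l v)}"

definition eigenspace :: "L2 set \<Rightarrow> (L2 \<Rightarrow> L2) \<Rightarrow> real \<Rightarrow> L2 set" where
  "eigenspace D T \<mu> = {x \<in> D. T x = \<mu> *\<^sub>R x}"

definition eigenvalues :: "L2 set \<Rightarrow> (L2 \<Rightarrow> L2) \<Rightarrow> real set" where
  "eigenvalues D T = {\<mu>. \<exists>x \<in> eigenspace D T \<mu>. x \<noteq> 0}"

definition eigenproj :: "L2 set \<Rightarrow> (L2 \<Rightarrow> L2) \<Rightarrow> real \<Rightarrow> L2 \<Rightarrow> L2" where
  "eigenproj D T \<mu> x = (THE p. p \<in> eigenspace D T \<mu> \<and>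
      (\<forall>q \<in> eigenspace D T \<mu>. cinner (x - p) q = 0))"

text \<open>For a positive self-adjoint operator \<open>T\<close> with domain \<open>D\<close> and compact inverse on a Hilbert
  space \<open>X\<close>, the spectral theorem gives \<open>T\<^sup>\<sigma> x = \<Sum>\<^sub>\<mu> \<mu>\<^sup>\<sigma> P\<^sub>\<mu> x\<close>, the sum ranging over the (real,
  positive) eigenvalues and \<open>P\<^sub>\<mu>\<close> being the orthogonal eigenprojections; the domain consists of
  those \<open>x\<close> for which this orthogonal series converges.\<close>

definition pow_dom :: "L2 set \<Rightarrow> L2 set \<Rightarrow> (L2 \<Rightarrow> L2) \<Rightarrow> real \<Rightarrow> L2 set" where
  "pow_dom X D T \<sigma> =
     {x \<in> X. (\<lambda>\<mu>. (\<mu> powr \<sigma>) *\<^sub>R eigenproj D T \<mu> x) summable_on eigenvalues D T}"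

definition pow_op :: "L2 set \<Rightarrow> (L2 \<Rightarrow> L2) \<Rightarrow> real \<Rightarrow> L2 \<Rightarrow> L2" where
  "pow_op D T \<sigma> x = (\<Sum>\<^sub>\<infinity>\<mu>\<in>eigenvalues D T. (\<mu> powr \<sigma>) *\<^sub>R eigenproj D T \<mu> x)"

definition dom_A_pow :: "real \<Rightarrow> real \<Rightarrow> L2 set" where
  "dom_A_pow l \<sigma> = pow_dom (L2_on l) (dom_A l) (neg_dxx l) \<sigma>"

definition dom_As_pow :: "real \<Rightarrow> real \<Rightarrow> L2 set" where
  "dom_As_pow l \<sigma> = pow_dom (L2_mean0 l) (dom_As l) (neg_dxx l) \<sigma>"

definition As_pow :: "real \<Rightarrow> real \<Rightarrow> L2 \<Rightarrow> L2" where
  "As_pow l \<sigma> v = pow_op (dom_As l) (neg_dxx l) \<sigma> v"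

record nanotube =
  len :: real
  m0 :: real
  b1 :: real
  b2 :: real
  \<kappa>1 :: real
  \<kappa>2 :: real
  \<rho>1 :: real
  \<rho>2 :: real
  \<rho>3 :: real
  \<rho>4 :: real
  \<gamma>1 :: real
  \<gamma>2 :: real
  \<gamma>3 :: real
  \<gamma>4 :: real
  alpha :: real
  beta :: real

type_synonym state = "L2 \<times> L2 \<times> L2 \<times> L2 \<times> L2 \<times> L2 \<times> L2 \<times> L2"

definition phase :: "nanotube \<Rightarrow> state set" where
  "phase P = {(u, u', v, v', y, y', z, z').
      u \<in> dom_A_pow (len P) (1/2) \<and> u' \<in> dom_A_pow (len P) 0 \<and>
      v \<in> dom_As_pow (len P) (1/2) \<and> v' \<in> dom_As_pow (len P) 0 \<and>
      y \<in> dom_A_pow (len P) (1/2) \<and> y' \<in> dom_A_pow (len P) 0 \<and>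
      z \<in> dom_As_pow (len P) (1/2) \<and> z' \<in> dom_As_pow (len P) 0}"

definition normH :: "nanotube \<Rightarrow> state \<Rightarrow> real" where
  "normH P = (\<lambda>(u, u', v, v', y, y', z, z').
     let D = wderiv (len P); S = As_pow (len P) (1/2) in
     sqrt (\<rho>1 P * (norm u')\<^sup>2 + \<rho>2 P * (norm v')\<^sup>2 + \<rho>3 P * (norm y')\<^sup>2 + \<rho>4 P * (norm z')\<^sup>2
         + \<kappa>1 P * (norm (D u - v))\<^sup>2 + \<kappa>2 P * (norm (D y - z))\<^sup>2 + m0 P * (norm (y - u))\<^sup>2
         + b1 P * (norm (S v))\<^sup>2 + b2 P * (norm (S z))\<^sup>2))"

definition opB :: "nanotube \<Rightarrow> state \<Rightarrow> state" where
  "opB P = (\<lambda>(u, u', v, v', y, y', z, z').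
     let D = wderiv (len P); A = neg_dxx (len P); As = neg_dxx (len P) in
     (u',
      (1 / \<rho>1 P) *\<^sub>R (- A (\<kappa>1 P *\<^sub>R u + \<gamma>1 P *\<^sub>R u') - \<kappa>1 P *\<^sub>R D v - \<gamma>1 P *\<^sub>R D v'
                     + m0 P *\<^sub>R (y - u)),
      v',
      (1 / \<rho>2 P) *\<^sub>R (- As (b1 P *\<^sub>R v + \<gamma>2 P *\<^sub>R As_pow (len P) (alpha P - 1) v')
                     + \<kappa>1 P *\<^sub>R (D u - v) + \<gamma>1 P *\<^sub>R (D u' - v')),
      y',
      (1 / \<rho>3 P) *\<^sub>R (- A (\<kappa>2 P *\<^sub>R y + \<gamma>3 P *\<^sub>R y') - \<kappa>2 P *\<^sub>R D z - \<gamma>3 P *\<^sub>R D z'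
                     - m0 P *\<^sub>R (y - u)),
      z',
      (1 / \<rho>4 P) *\<^sub>R (- As (b2 P *\<^sub>R z + \<gamma>4 P *\<^sub>R As_pow (len P) (beta P - 1) z')
                     + \<kappa>2 P *\<^sub>R (D y - z) + \<gamma>3 P *\<^sub>R (D y' - z'))))"

definition domB :: "nanotube \<Rightarrow> state set" where
  "domB P = {U \<in> phase P. case U of (u, u', v, v', y, y', z, z') \<Rightarrow>
      u' \<in> dom_A_pow (len P) (1/2) \<and> v' \<in> dom_As_pow (len P) (1/2) \<and>
      y' \<in> dom_A_pow (len P) (1/2) \<and> z' \<in> dom_As_pow (len P) (1/2) \<and>
      \<kappa>1 P *\<^sub>R u + \<gamma>1 P *\<^sub>R u' \<in> dom_A (len P) \<and>
      \<kappa>2 P *\<^sub>R y + \<gamma>3 P *\<^sub>R y' \<in> dom_A (len P) \<and>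
      b1 P *\<^sub>R v + \<gamma>2 P *\<^sub>R As_pow (len P) (alpha P - 1) v' \<in> dom_As (len P) \<and>
      b2 P *\<^sub>R z + \<gamma>4 P *\<^sub>R As_pow (len P) (beta P - 1) z' \<in> dom_As (len P)}"

primrec domB_pow :: "nanotube \<Rightarrow> nat \<Rightarrow> state set" where
  "domB_pow P 0 = phase P"
| "domB_pow P (Suc j) = {U \<in> domB P. opB P U \<in> domB_pow P j}"

text \<open>The graph norm of \<open>B\<^sup>j\<close>; \<open>D(B\<^sup>0)\<close> is the phase space with its own norm.\<close>

definition graph_norm :: "nanotube \<Rightarrow> nat \<Rightarrow> state \<Rightarrow> real" where
  "graph_norm P j U = (if j = 0 then normH P U else normH P U + normH P ((opB P ^^ j) U))"

text \<open>The type \<^typ>\<open>state\<close> carries the product \<open>L\<^sup>2\<close> topology, which is not that of the spaces in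
  question. Continuity and differentiability are therefore taken with respect to an explicit norm
  \<open>N\<close> on a linear subspace \<open>X\<close>; derivatives at \<open>0\<close> are one-sided.\<close>

definition C_in :: "state set \<Rightarrow> (state \<Rightarrow> real) \<Rightarrow> (real \<Rightarrow> state) \<Rightarrow> bool" where
  "C_in X N U \<longleftrightarrow> (\<forall>t\<ge>0. U t \<in> X) \<and>
     (\<forall>t\<ge>0. ((\<lambda>s. N (U s - U t)) \<longlongrightarrow> 0) (at t within {0..}))"

definition has_deriv_in ::
    "state set \<Rightarrow> (state \<Rightarrow> real) \<Rightarrow> (real \<Rightarrow> state) \<Rightarrow> (real \<Rightarrow> state) \<Rightarrow> bool" where
  "has_deriv_in X N U V \<longleftrightarrow> (\<forall>t\<ge>0. U t \<in> X \<and> V t \<in> X) \<and>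
     (\<forall>t\<ge>0. ((\<lambda>s. N ((1 / (s - t)) *\<^sub>R (U s - U t) - V t)) \<longlongrightarrow> 0) (at t within {0..}))"

primrec Ck_in :: "nat \<Rightarrow> state set \<Rightarrow> (state \<Rightarrow> real) \<Rightarrow> (real \<Rightarrow> state) \<Rightarrow> bool" where
  "Ck_in 0 X N U \<longleftrightarrow> C_in X N U"
| "Ck_in (Suc n) X N U \<longleftrightarrow> (\<exists>V. has_deriv_in X N U V \<and> Ck_in n X N V)"

text \<open>\<open>U(t) = U\<^sub>0 + B \<integral>\<^sub>0\<^sup>t U(s) ds\<close>. As the phase space is continuously embedded in the ambient
  product \<open>L\<^sup>2\<close> space, the integral of a continuous phase-space valued function may be
  computed in the latter.\<close>

definition mild_solution :: "nanotube \<Rightarrow> state \<Rightarrow> (real \<Rightarrow> state) \<Rightarrow> bool" where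
  "mild_solution P U0 U \<longleftrightarrow> C_in (phase P) (normH P) U \<and>
     (\<forall>t\<ge>0. U integrable_on {0..t} \<and> integral {0..t} U \<in> domB P \<and>
             U t = U0 + opB P (integral {0..t} U))"

end

theory Submission
  imports Defs
begin

text \<open>The normalised functions \<open>sin (n \<pi> x / l)\<close> and \<open>cos (n \<pi> x / l)\<close>, \<open>n \<ge> 1\<close>, are orthonormal
  bases of \<open>L\<^sup>2(0,l)\<close> and \<open>L\<^sup>2\<^sub>*(0,l)\<close>, diagonalise \<open>A\<close> and \<open>A\<^sub>*\<close>, and are exchanged by
  \<open>\<partial>\<^sub>x\<close>. In these bases the generator is block diagonal, with one \<open>8 \<times> 8\<close> block per frequency,
  and each block is dissipative for the corresponding part of the energy. The solution is therefore
  the series of the matrix flows of the blocks: dissipativity bounds each mode of the solution, and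
  of its difference quotients, by the data, so that continuity and differentiability of the series
  follow by dominated convergence. The domains of the powers of the generator become summability
  conditions on the Fourier coefficients.\<close>

subsection \<open>The Hilbert space \<open>L\<^sup>2\<close>\<close>

text \<open>The domain of the generator constrains only combinations such as
  \<open>\<kappa>1 P *\<^sub>R u + \<gamma>1 P *\<^sub>R u'\<close>, never displacement and velocity
  separately. Mode by mode this difficulty disappears: the domain turns out to be maximal,
  consisting of the states of finite energy whose image under the blocks has finite energy, so no
  range condition has to be solved. The price is paid earlier. Weak derivatives, \<open>H10\<close>,
  boundary values and fractional powers are defined without reference to a basis, and each must be
  translated into weights on coefficients. Boundary conditions decide which basis sees a derivative
  correctly: sines may be tested against any weak derivative, since they vanish at the end points,
  while cosines require the differentiated function to vanish there. Uniformity in the frequency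
  comes from the lowest wave number being positive, which lets the energy of a block control its
  eight components with one constant. The estimates in time use the energy only, since the norms of
  the blocks grow with the frequency.\<close>

lemma sq_int_rep: "sq_int (rep_L2 u)"
  using Quotient3_rel_rep[OF Quotient3_L2, of u u] by (simp add: ae_eq_def)

lemma ae_eq_refl: "sq_int f \<Longrightarrow> ae_eq f f"
  by (simp add: ae_eq_def)

lemma abs_rep_L2 [simp]: "abs_L2 (rep_L2 u) = u"
  by (rule Quotient3_abs_rep[OF Quotient3_L2])

lemma rep_abs_L2: "sq_int f \<Longrightarrow> AE x in lborel. rep_L2 (abs_L2 f) x = f x"
  using Quotient3_rep_abs[OF Quotient3_L2 ae_eq_refl, of f] by (simp add: ae_eq_def)

lemma abs_L2_eqI:
  assumes "sq_int f" "sq_int g" "AE x in lborel. f x = g x" shows "abs_L2 f = abs_L2 g"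
  using Quotient3_rel_abs[OF Quotient3_L2, of f g] assms by (simp add: ae_eq_def)

lemma cinner_abs: "sq_int f \<Longrightarrow> sq_int g \<Longrightarrow> cinner (abs_L2 f) (abs_L2 g) = (LINT x|lborel. f x * cnj (g x))"
  by (rule cinner.abs_eq) (auto simp: ae_eq_refl)

lemma plus_abs: "sq_int f \<Longrightarrow> sq_int g \<Longrightarrow> abs_L2 f + abs_L2 g = abs_L2 (\<lambda>x. f x + g x)"
  by (rule plus_L2.abs_eq) (auto simp: ae_eq_refl)

lemma minus_abs: "sq_int f \<Longrightarrow> sq_int g \<Longrightarrow> abs_L2 f - abs_L2 g = abs_L2 (\<lambda>x. f x - g x)"
  by (rule minus_L2.abs_eq) (auto simp: ae_eq_refl)

lemma zero_abs: "0 = abs_L2 (\<lambda>_. 0)"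
  by (rule zero_L2_def[THEN meta_eq_to_obj_eq])

text \<open>\<open>L2\<close> is instantiated only as a real vector space, but Fourier coefficients
  and eigenspaces are complex; this restores the complex multiples.\<close>

lift_definition cscale :: "complex \<Rightarrow> L2 \<Rightarrow> L2" is "\<lambda>c f x. c * f x"
  by (auto simp: ae_eq_def sq_int_cmult elim: AE_mp)

lemma cscale_abs: "sq_int f \<Longrightarrow> cscale c (abs_L2 f) = abs_L2 (\<lambda>x. c * f x)"
  by (rule cscale.abs_eq) (auto simp: ae_eq_refl)

section \<open>Sesquilinear algebra and Cauchy-Schwarz for the complex inner product\<close>

lemma cinner_add_left: "cinner (f + g) h = cinner f h + cinner g h"
  by transfer (simp add: ae_eq_def distrib_right Bochner_Integration.integral_add sq_int_mult_integrable)

lemma cinner_commute: "cinner g f = cnj (cinner f g)"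
proof transfer
  fix f g assume "ae_eq f f" "ae_eq g g"
  have "(LINT x|lborel. g x * cnj (f x)) = (LINT x|lborel. cnj (f x * cnj (g x)))"
    by (simp add: mult.commute)
  then show "(LINT x|lborel. g x * cnj (f x)) = cnj (LINT x|lborel. f x * cnj (g x))"
    by (simp del: complex_cnj_mult)
qed

lemma cinner_cscale_left: "cinner (cscale c f) g = c * cinner f g"
  by transfer (simp add: mult.assoc)

lemma cinner_add_right: "cinner h (f + g) = cinner h f + cinner h g"
  by (metis cinner_add_left cinner_commute complex_cnj_add)

lemma cinner_cscale_right: "cinner g (cscale c f) = cnj c * cinner g f"
  by (metis cinner_cscale_left cinner_commute complex_cnj_mult)

lemma cscale_of_real: "cscale (of_real r) f = r *\<^sub>R f"
  by transfer (simp add: ae_eq_def scaleR_conv_of_real sq_int_cmult)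

lemma cinner_scaleR_left: "cinner (r *\<^sub>R f) g = of_real r * cinner f g"
  by (metis cinner_cscale_left cscale_of_real)

lemma cinner_scaleR_right: "cinner g (r *\<^sub>R f) = of_real r * cinner g f"
  by (metis cinner_cscale_right cscale_of_real complex_cnj_complex_of_real)

lemma cinner_minus_left: "cinner (- f) g = - cinner f g"
  using cinner_scaleR_left[of "-1" f g] by simp

lemma cinner_diff_left: "cinner (f - g) h = cinner f h - cinner g h"
  using cinner_add_left[of f "- g" h] by (simp add: cinner_minus_left)

lemma cinner_minus_right: "cinner g (- f) = - cinner g f"
  using cinner_scaleR_right[of g "-1" f] by simp

lemma cinner_diff_right: "cinner h (f - g) = cinner h f - cinner h g"
  using cinner_add_right[of h f "- g"] by (simp add: cinner_minus_right)

lemma cinner_zero_left [simp]: "cinner 0 g = 0"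
  using cinner_diff_left[of 0 0 g] by simp

lemma cinner_zero_right [simp]: "cinner g 0 = 0"
  using cinner_diff_right[of g 0 0] by simp

lemma cinner_self: "cinner f f = of_real ((norm f)\<^sup>2)"
proof -
  have "Im (cinner f f) = 0" using cinner_commute[of f f] by (simp add: complex_eq_iff)
  moreover have "Re (cinner f f) = (norm f)\<^sup>2"
    by (simp add: power2_norm_eq_inner inner_L2_def)
  ultimately show ?thesis by (simp add: complex_eq_iff)
qed

lemma norm_cscale: "norm (cscale c f) = cmod c * norm f"
proof -
  have "of_real ((norm (cscale c f))\<^sup>2) = c * cnj c * cinner f f"
    unfolding cinner_self[symmetric] by (simp add: cinner_cscale_left cinner_cscale_right mult_ac)
  also have "\<dots> = of_real ((cmod c * norm f)\<^sup>2)"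
    by (simp add: cinner_self complex_norm_square[symmetric] power_mult_distrib)
  finally have "(norm (cscale c f))\<^sup>2 = (cmod c * norm f)\<^sup>2"
    using of_real_eq_iff by blast
  then show ?thesis by (simp add: power2_eq_iff_nonneg)
qed

lemma cinner_Cauchy_Schwarz: "cmod (cinner f g) \<le> norm f * norm g"
proof (cases "cinner f g = 0")
  case False
  \<comment> \<open>The phase \<open>c\<close> rotates the inner product onto the nonnegative real
    axis, where it equals the real inner product of the class \<open>real_inner\<close>.\<close>
  define c where "c = cnj (cinner f g) / cmod (cinner f g)"
  have c: "cmod c = 1" using False by (simp add: c_def norm_divide)
  have "c * cinner f g = cmod (cinner f g)"
    using False complex_norm_square[of "cinner f g"]
    by (simp add: c_def field_simps power2_eq_square)
  then have "cmod (cinner f g) = Re (cinner (cscale c f) g)"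
    by (simp add: cinner_cscale_left)
  also have "\<dots> = inner (cscale c f) g" by (simp add: inner_L2_def)
  also have "\<dots> \<le> norm (cscale c f) * norm g" by (rule norm_cauchy_schwarz)
  finally show ?thesis by (simp add: norm_cscale c)
qed simp

lemma bounded_linear_cinner_left: "bounded_linear (\<lambda>f. cinner f g)"
  by (rule bounded_linear_intro[where K="norm g"])
     (auto simp: cinner_add_left cinner_scaleR_left scaleR_conv_of_real cinner_Cauchy_Schwarz)

lemma bounded_linear_cinner_right: "bounded_linear (\<lambda>g. cinner f g)"
  by (rule bounded_linear_intro[where K="norm f"])
     (auto simp: cinner_add_right cinner_scaleR_right scaleR_conv_of_real mult.commute
       intro: order_trans[OF cinner_Cauchy_Schwarz])

lemmas tendsto_cinner_left = bounded_linear.tendsto[OF bounded_linear_cinner_left]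
lemmas tendsto_cinner_right = bounded_linear.tendsto[OF bounded_linear_cinner_right]

lemma cinner_sum_left: "cinner (\<Sum>i\<in>A. f i) g = (\<Sum>i\<in>A. cinner (f i) g)"
  by (rule linear_sum[OF bounded_linear.linear[OF bounded_linear_cinner_left]])

section \<open>Riesz-Fischer: completeness, and almost everywhere convergence of
  subsequences\<close>

lemma norm_abs_sq: "sq_int f \<Longrightarrow> (norm (abs_L2 f))\<^sup>2 = (LINT x|lborel. (cmod (f x))\<^sup>2)"
  by (simp add: power2_norm_eq_inner inner_L2_def cinner_abs cinner_self_Re)

lemma nn_integral_norm_sq:
  "sq_int f \<Longrightarrow> (\<integral>\<^sup>+ x. ennreal ((cmod (f x))\<^sup>2) \<partial>lborel) = ennreal ((norm (abs_L2 f))\<^sup>2)"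
  by (subst nn_integral_eq_integral) (auto simp: norm_abs_sq sq_int_def)

lemma sq_intI_nn:
  assumes "f \<in> borel_measurable lborel" "(\<integral>\<^sup>+ x. ennreal ((cmod (f x))\<^sup>2) \<partial>lborel) < \<infinity>"
  shows "sq_int f"
  unfolding sq_int_def
proof (intro conjI integrableI_nonneg)
  show "(\<lambda>x. (cmod (f x))\<^sup>2) \<in> borel_measurable lborel" using assms(1) by measurable
qed (use assms in auto)

text \<open>The weights \<open>4\<^sup>n\<close> turn the integrability of the series of the squared increments into
  geometric decay of the increments almost everywhere.\<close>

lemma tendsto_AE_of_summable_increments:
  assumes sq: "\<And>n. sq_int (f n)"
    and d: "\<And>n. norm (abs_L2 (f (Suc n)) - abs_L2 (f n)) \<le> (1/4)^n"
  shows "AE x in lborel. convergent (\<lambda>n. f n x)"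
proof -
  let ?e = "\<lambda>n x. ennreal (4^n * (cmod (f (Suc n) x - f n x))\<^sup>2)"
  have [measurable]: "f n \<in> borel_measurable lborel" for n using sq by (auto simp: sq_int_def)
  have "(\<integral>\<^sup>+ x. (\<Sum>n. ?e n x) \<partial>lborel) = (\<Sum>n. \<integral>\<^sup>+ x. ?e n x \<partial>lborel)"
    by (rule nn_integral_suminf) auto
  also have "\<dots> \<le> (\<Sum>n. ennreal ((1/4)^n))"
  proof (intro suminf_le allI)
    fix n
    have "(\<integral>\<^sup>+ x. ?e n x \<partial>lborel) = 4^n * (\<integral>\<^sup>+ x. ennreal ((cmod (f (Suc n) x - f n x))\<^sup>2) \<partial>lborel)"
      by (subst nn_integral_cmult[symmetric]) (auto simp: ennreal_mult ennreal_power[symmetric] simp flip: ennreal_numeral)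
    also have "\<dots> = 4^n * ennreal ((norm (abs_L2 (f (Suc n)) - abs_L2 (f n)))\<^sup>2)"
      by (subst nn_integral_norm_sq) (auto simp: sq sq_int_diff minus_abs)
    also have "\<dots> \<le> 4^n * ennreal (((1/4)^n)\<^sup>2)"
      by (intro mult_left_mono ennreal_leI power_mono d) auto
    also have "\<dots> = ennreal (4^n * ((1/4)^n)\<^sup>2)"
      by (auto simp: ennreal_mult ennreal_power[symmetric] simp flip: ennreal_numeral)
    also have "(4::real)^n * ((1/4)^n)\<^sup>2 = (1/4)^n"
      by (simp add: power2_eq_square flip: power_mult_distrib)
    finally show "(\<integral>\<^sup>+ x. ?e n x \<partial>lborel) \<le> ennreal ((1/4)^n)" .
  qed auto
  also have "\<dots> < \<infinity>"
    by (subst suminf_ennreal2) (auto intro: summable_geometric)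
  finally have "AE x in lborel. (\<Sum>n. ?e n x) \<noteq> \<infinity>"
    by (intro nn_integral_noteq_infinite) auto
  then show ?thesis
  proof eventually_elim
    fix x assume fin: "(\<Sum>n. ?e n x) \<noteq> \<infinity>"
    define C where "C = enn2real (\<Sum>n. ?e n x)"
    have C: "(\<Sum>n. ?e n x) = ennreal C" "C \<ge> 0" using fin by (auto simp: C_def top.not_eq_extremum)
    have b: "cmod (f (Suc n) x - f n x) \<le> sqrt C * (1/2)^n" for n
    proof -
      have sq4: "((2::real)^n)\<^sup>2 = 4^n" by (simp add: power2_eq_square flip: power_mult_distrib)
      have "(\<Sum>i\<in>{n}. ?e i x) \<le> (\<Sum>i. ?e i x)"
        by (rule sum_le_suminf) (simp_all add: summableI)
      then have "ennreal (4^n * (cmod (f (Suc n) x - f n x))\<^sup>2) \<le> ennreal C"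
        unfolding C by simp
      then have "4^n * (cmod (f (Suc n) x - f n x))\<^sup>2 \<le> C"
        using C(2) by (subst (asm) ennreal_le_iff)
      then have "(2^n * cmod (f (Suc n) x - f n x))\<^sup>2 \<le> C"
        using sq4 by (simp add: power_mult_distrib)
      then have "2^n * cmod (f (Suc n) x - f n x) \<le> sqrt C"
        by (rule real_le_rsqrt)
      then show ?thesis by (simp add: field_simps power_divide)
    qed
    have "summable (\<lambda>n. f (Suc n) x - f n x)"
      by (rule summable_comparison_test'[where g="\<lambda>n. sqrt C * (1/2)^n" and N=0])
         (auto intro!: summable_mult summable_geometric b)
    then have "convergent (\<lambda>n. \<Sum>i<n. f (Suc i) x - f i x)"
      by (simp add: summable_iff_convergent)
    then have "convergent (\<lambda>n. f n x - f 0 x)"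
      by (simp only: sum_lessThan_telescope[of "\<lambda>i. f i x"])
    then have "convergent (\<lambda>n. f n x - f 0 x + f 0 x)"
      by (intro convergent_add convergent_const)
    then show "convergent (\<lambda>n. f n x)" by simp
  qed
qed

text \<open>The pointwise limit exists almost everywhere by the previous lemma, and Fatou turns the
  bounds on the increments into norm convergence to the same function. The pointwise limit is kept
  in the statement because support conditions are passed to the limit through it.\<close>

lemma L2_increments_converge:
  assumes sq: "\<And>n. sq_int (f n)"
    and d: "\<And>n. norm (abs_L2 (f (Suc n)) - abs_L2 (f n)) \<le> (1/4)^n"
  shows "\<exists>F. sq_int F \<and> (\<lambda>n. abs_L2 (f n)) \<longlonglongrightarrow> abs_L2 F \<and> (AE x in lborel. (\<lambda>n. f n x) \<longlonglongrightarrow> F x)"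
proof -
  have [measurable]: "f n \<in> borel_measurable lborel" for n using sq by (auto simp: sq_int_def)
  define F where "F x = lim (\<lambda>n. f n x)" for x
  have F[measurable]: "F \<in> borel_measurable lborel"
    unfolding F_def by (rule borel_measurable_lim_metric) auto
  have conv: "AE x in lborel. (\<lambda>n. f n x) \<longlonglongrightarrow> F x"
    using tendsto_AE_of_summable_increments[OF assms]
    by eventually_elim (simp add: F_def convergent_LIMSEQ_iff)
  \<comment> \<open>The geometric tail \<open>(4/3) * (1/4)^n\<close> is rounded up to
    \<open>2 * (1/4)^n\<close>.\<close>
  have dist: "norm (abs_L2 (f (n+m)) - abs_L2 (f n)) \<le> 2 * (1/4)^n" for n m
  proof -
    have "norm (abs_L2 (f (n+m)) - abs_L2 (f n)) \<le> (\<Sum>i<m. (1/4)^(n+i))"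
    proof (induction m)
      case (Suc m)
      have "norm (abs_L2 (f (n+Suc m)) - abs_L2 (f n)) \<le>
        norm (abs_L2 (f (Suc (n+m))) - abs_L2 (f (n+m))) + norm (abs_L2 (f (n+m)) - abs_L2 (f n))"
        using norm_triangle_ineq[of "abs_L2 (f (Suc (n+m))) - abs_L2 (f (n+m))" "abs_L2 (f (n+m)) - abs_L2 (f n)"] by simp
      then show ?case using Suc d[of "n+m"] by simp
    qed simp
    also have "\<dots> = (1/4)^n * (\<Sum>i<m. (1/4)^i)"
      by (simp add: sum_distrib_left power_add)
    also have "(\<Sum>i<m. (1/4::real)^i) \<le> (\<Sum>i. (1/4)^i)"
      by (intro sum_le_suminf summable_geometric) auto
    also have "(\<Sum>i. (1/4::real)^i) \<le> 2" by (subst suminf_geometric) auto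
    finally show ?thesis by (simp add: mult.commute)
  qed
  \<comment> \<open>Fatou along \<open>m\<close>: the integrand is the pointwise limit of the
    squared distances between \<open>f (n+m)\<close> and \<open>f n\<close>, whose integrals are all
    bounded by the tail estimate.\<close>
  have nn: "(\<integral>\<^sup>+ x. ennreal ((cmod (F x - f n x))\<^sup>2) \<partial>lborel) \<le> ennreal ((2 * (1/4)^n)\<^sup>2)" for n
  proof -
    have "(\<integral>\<^sup>+ x. ennreal ((cmod (F x - f n x))\<^sup>2) \<partial>lborel)
        = (\<integral>\<^sup>+ x. liminf (\<lambda>m. ennreal ((cmod (f (n+m) x - f n x))\<^sup>2)) \<partial>lborel)"
    proof (rule nn_integral_cong_AE, use conv in eventually_elim)
      fix x assume "(\<lambda>n. f n x) \<longlonglongrightarrow> F x"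
      then have "(\<lambda>m. f (n+m) x) \<longlonglongrightarrow> F x"
        using LIMSEQ_ignore_initial_segment[of "\<lambda>n. f n x" "F x" n] by (simp add: add.commute)
      then have "(\<lambda>m. ennreal ((cmod (f (n+m) x - f n x))\<^sup>2)) \<longlonglongrightarrow> ennreal ((cmod (F x - f n x))\<^sup>2)"
        by (intro tendsto_intros) auto
      from lim_imp_Liminf[OF _ this]
      show "ennreal ((cmod (F x - f n x))\<^sup>2) = liminf (\<lambda>m. ennreal ((cmod (f (n+m) x - f n x))\<^sup>2))"
        by simp
    qed
    also have "\<dots> \<le> liminf (\<lambda>m. \<integral>\<^sup>+ x. ennreal ((cmod (f (n+m) x - f n x))\<^sup>2) \<partial>lborel)"
      by (rule nn_integral_liminf) auto
    also have "\<dots> = liminf (\<lambda>m. ennreal ((norm (abs_L2 (f (n+m)) - abs_L2 (f n)))\<^sup>2))"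
      by (simp add: nn_integral_norm_sq sq sq_int_diff minus_abs)
    also have "\<dots> \<le> liminf (\<lambda>m::nat. ennreal ((2 * (1/4)^n)\<^sup>2))"
      by (intro Liminf_mono always_eventually allI ennreal_leI power_mono dist) auto
    also have "\<dots> = ennreal ((2 * (1/4)^n)\<^sup>2)" by (simp add: Liminf_const)
    finally show ?thesis .
  qed
  have sqd: "sq_int (\<lambda>x. F x - f n x)" for n
    by (rule sq_intI_nn) (auto intro: le_less_trans[OF nn])
  then have sqF: "sq_int F" using sq_int_add[OF sqd[of 0] sq[of 0]] by simp
  have "norm (abs_L2 (f n) - abs_L2 F) \<le> 2 * (1/4)^n" for n
  proof -
    have "ennreal ((norm (abs_L2 F - abs_L2 (f n)))\<^sup>2) \<le> ennreal ((2 * (1/4)^n)\<^sup>2)"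
      using nn[of n] by (simp add: nn_integral_norm_sq sqd minus_abs sqF sq)
    then have "(norm (abs_L2 F - abs_L2 (f n)))\<^sup>2 \<le> (2 * (1/4)^n)\<^sup>2"
      by (subst (asm) ennreal_le_iff) auto
    then have "norm (abs_L2 F - abs_L2 (f n)) \<le> 2 * (1/4)^n"
      by (rule power2_le_imp_le) simp
    then show ?thesis by (simp add: norm_minus_commute)
  qed
  then have "\<forall>\<^sub>F n in sequentially. norm (abs_L2 (f n) - abs_L2 F) \<le> 2 * (1/4)^n"
    by simp
  moreover have "(\<lambda>n. 2 * (1/4::real)^n) \<longlonglongrightarrow> 0"
    by (intro tendsto_mult_right_zero LIMSEQ_power_zero) auto
  ultimately have "(\<lambda>n. abs_L2 (f n) - abs_L2 F) \<longlonglongrightarrow> 0"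
    by (rule Lim_null_comparison)
  then have "(\<lambda>n. abs_L2 (f n)) \<longlonglongrightarrow> abs_L2 F"
    by (rule LIM_zero_cancel)
  with sqF conv show ?thesis by blast
qed

lemma Cauchy_fast_subseq:
  fixes X :: "nat \<Rightarrow> 'a::metric_space"
  assumes "Cauchy X" and e: "\<And>n. e n > (0::real)"
  shows "\<exists>r. strict_mono r \<and> (\<forall>n::nat. dist (X (r (Suc n))) (X (r n)) < e n)"
proof -
  have "\<exists>r. \<forall>n. (\<forall>m\<ge>r n. \<forall>k\<ge>r n. dist (X m) (X k) < e n) \<and> r n < r (Suc n)"
  proof (rule dependent_nat_choice)
    show "\<exists>x. \<forall>m\<ge>x. \<forall>k\<ge>x. dist (X m) (X k) < e 0"
      using metric_CauchyD[OF assms(1) e[of 0]] by blast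
    fix x n
    obtain M where M: "\<forall>m\<ge>M. \<forall>k\<ge>M. dist (X m) (X k) < e (Suc n)"
      using metric_CauchyD[OF assms(1) e[of "Suc n"]] by blast
    show "\<exists>y. (\<forall>m\<ge>y. \<forall>k\<ge>y. dist (X m) (X k) < e (Suc n)) \<and> x < y"
      by (rule exI[of _ "max M (Suc x)"]) (use M in auto)
  qed
  then obtain r where r: "\<And>n. (\<forall>m\<ge>r n. \<forall>k\<ge>r n. dist (X m) (X k) < e n) \<and> r n < r (Suc n)"
    by blast
  then have "strict_mono r" by (simp add: strict_mono_Suc_iff)
  moreover have "dist (X (r (Suc n))) (X (r n)) < e n" for n
    using r[of n] by (meson less_imp_le order_refl)
  ultimately show ?thesis by blast
qed

text \<open>Needed for the convergence of Fourier series and for integrating curves in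
  \<open>state\<close>, where the fundamental theorem of calculus asks for a Banach space.\<close>

instance L2 :: complete_space
proof
  fix X :: "nat \<Rightarrow> L2" assume X: "Cauchy X"
  obtain r where r: "strict_mono r" "\<And>n. dist (X (r (Suc n))) (X (r n)) < (1/4)^n"
    using Cauchy_fast_subseq[OF X, of "\<lambda>n. (1/4)^n"] by auto
  have inc: "norm (abs_L2 (rep_L2 (X (r (Suc n)))) - abs_L2 (rep_L2 (X (r n)))) \<le> (1/4)^n" for n
    using less_imp_le[OF r(2)[of n]] by (simp only: abs_rep_L2 dist_norm)
  obtain F where "(\<lambda>n. abs_L2 (rep_L2 (X (r n)))) \<longlonglongrightarrow> abs_L2 F"
    using L2_increments_converge[of "\<lambda>n. rep_L2 (X (r n))", OF sq_int_rep inc] by blast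
  then have "(X \<circ> r) \<longlonglongrightarrow> abs_L2 F" by (simp add: o_def)
  with X r(1) show "convergent X"
    by (metis Cauchy_converges_subseq convergentI)
qed

instance L2 :: banach ..

lemma tendsto_L2_AE_subseq:
  assumes X: "X \<longlonglongrightarrow> u"
  shows "\<exists>r. strict_mono r \<and> (AE x in lborel. (\<lambda>n. rep_L2 (X (r n)) x) \<longlonglongrightarrow> rep_L2 u x)"
proof -
  obtain r where r: "strict_mono r" "\<And>n. dist (X (r (Suc n))) (X (r n)) < (1/4)^n"
    using Cauchy_fast_subseq[OF LIMSEQ_imp_Cauchy[OF X], of "\<lambda>n. (1/4)^n"] by auto
  have inc: "norm (abs_L2 (rep_L2 (X (r (Suc n)))) - abs_L2 (rep_L2 (X (r n)))) \<le> (1/4)^n" for n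
    using less_imp_le[OF r(2)[of n]] by (simp only: abs_rep_L2 dist_norm)
  obtain F where F: "sq_int F" "(\<lambda>n. abs_L2 (rep_L2 (X (r n)))) \<longlonglongrightarrow> abs_L2 F"
     "AE x in lborel. (\<lambda>n. rep_L2 (X (r n)) x) \<longlonglongrightarrow> F x"
    using L2_increments_converge[of "\<lambda>n. rep_L2 (X (r n))", OF sq_int_rep inc] by blast
  have "(X \<circ> r) \<longlonglongrightarrow> u" by (rule LIMSEQ_subseq_LIMSEQ[OF X r(1)])
  with F(2) have "u = abs_L2 F" by (simp add: o_def LIMSEQ_unique)
  then have "AE x in lborel. rep_L2 u x = F x" using rep_abs_L2[OF F(1)] by simp
  with F(3) have "AE x in lborel. (\<lambda>n. rep_L2 (X (r n)) x) \<longlonglongrightarrow> rep_L2 u x"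
    by eventually_elim simp
  with r(1) show ?thesis by blast
qed

subsection \<open>Orthonormal bases and diagonal operators\<close>

text \<open>Relative to a closed complex subspace \<open>X\<close>, so that one development serves
  the sines in \<open>L2_on l\<close> and the cosines in \<open>L2_mean0 l\<close>. Completeness of
  the system is assumed in the weak form \<open>total\<close>; expansions and Parseval are derived
  from it.\<close>

locale hilbert_basis =
  fixes X :: "L2 set" and e :: "nat \<Rightarrow> L2"
  assumes add_in: "x \<in> X \<Longrightarrow> y \<in> X \<Longrightarrow> x + y \<in> X"
    and cscale_in: "x \<in> X \<Longrightarrow> cscale c x \<in> X"
    and closed_space: "closed X"
    and basis_in: "e n \<in> X"
    and orthonormal: "cinner (e m) (e n) = (if m = n then 1 else 0)"
    and total: "x \<in> X \<Longrightarrow> (\<And>n. cinner x (e n) = 0) \<Longrightarrow> x = 0"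
begin

definition coef :: "L2 \<Rightarrow> nat \<Rightarrow> complex" where "coef x n = cinner x (e n)"

text \<open>An unordered sum, to agree with the one in \<open>pow_op\<close>. It defaults to
  \<open>0\<close> when the series diverges, hence the summability hypotheses attached to it
  later.\<close>

definition synth :: "(nat \<Rightarrow> complex) \<Rightarrow> L2" where
  "synth a = (\<Sum>\<^sub>\<infinity>n. cscale (a n) (e n))"

lemma zero_in: "0 \<in> X"
  using cscale_in[OF basis_in[of 0], of "of_real 0"] by (simp only: cscale_of_real scaleR_zero_left)

lemma scaleR_in: "x \<in> X \<Longrightarrow> r *\<^sub>R x \<in> X"
  using cscale_in[of x "of_real r"] by (simp only: cscale_of_real)

lemma diff_in: "x \<in> X \<Longrightarrow> y \<in> X \<Longrightarrow> x - y \<in> X"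
  using add_in[of x "- y"] scaleR_in[of y "-1"] by simp

lemma uminus_in: "x \<in> X \<Longrightarrow> - x \<in> X"
  using scaleR_in[of x "-1"] by simp

lemma sum_in: "(\<And>i. i \<in> A \<Longrightarrow> f i \<in> X) \<Longrightarrow> (\<Sum>i\<in>A. f i) \<in> X"
  by (induction A rule: infinite_finite_induct) (auto intro: add_in zero_in)

lemma coef_add: "coef (x + y) n = coef x n + coef y n"
  and coef_diff: "coef (x - y) n = coef x n - coef y n"
  and coef_minus: "coef (- x) n = - coef x n"
  and coef_scaleR: "coef (r *\<^sub>R x) n = r *\<^sub>R coef x n"
  and coef_zero: "coef 0 n = 0"
  by (simp_all add: coef_def cinner_add_left cinner_diff_left cinner_minus_left cinner_scaleR_left
      scaleR_conv_of_real)

lemma bounded_linear_coef: "bounded_linear (\<lambda>x. coef x n)"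
  unfolding coef_def by (rule bounded_linear_cinner_left)

lemma coef_ext: "x \<in> X \<Longrightarrow> y \<in> X \<Longrightarrow> (\<And>n. coef x n = coef y n) \<Longrightarrow> x = y"
  using total[OF diff_in, of x y] by (simp add: coef_def cinner_diff_left)

lemma coef_cscale_basis: "coef (cscale c (e m)) n = (if m = n then c else 0)"
  by (simp add: coef_def cinner_cscale_left orthonormal)

lemma coef_partial_sum:
  "finite F \<Longrightarrow> coef (\<Sum>i\<in>F. cscale (a i) (e i)) n = (if n \<in> F then a n else 0)"
  by (simp add: coef_def cinner_sum_left cinner_cscale_left orthonormal if_distrib cong: if_cong)

lemma cinner_partial_sum_right:
  "finite F \<Longrightarrow> cinner x (\<Sum>i\<in>F. cscale (a i) (e i)) = (\<Sum>i\<in>F. cnj (a i) * coef x i)"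
  by (simp add: linear_sum[OF bounded_linear.linear[OF bounded_linear_cinner_right]]
      cinner_cscale_right coef_def)

lemma norm_partial_sum:
  assumes "finite F"
  shows "(norm (\<Sum>i\<in>F. cscale (a i) (e i)))\<^sup>2 = (\<Sum>i\<in>F. (cmod (a i))\<^sup>2)"
proof -
  have "complex_of_real ((norm (\<Sum>i\<in>F. cscale (a i) (e i)))\<^sup>2) = (\<Sum>i\<in>F. cnj (a i) * a i)"
    unfolding cinner_self[symmetric] using assms by (simp add: cinner_partial_sum_right coef_partial_sum)
  also have "\<dots> = complex_of_real (\<Sum>i\<in>F. (cmod (a i))\<^sup>2)"
    unfolding of_real_sum complex_norm_square by (intro sum.cong) (auto simp: mult.commute)
  finally show ?thesis using of_real_eq_iff by blast
qed

lemma bessel: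
  assumes "finite F" shows "(\<Sum>i\<in>F. (cmod (coef x i))\<^sup>2) \<le> (norm x)\<^sup>2"
proof -
  let ?p = "\<Sum>i\<in>F. cscale (coef x i) (e i)"
  have "cinner (x - ?p) ?p = 0"
    using assms by (simp add: cinner_diff_left cinner_partial_sum_right coef_partial_sum)
  then have "inner (x - ?p) ?p = 0" by (simp add: inner_L2_def)
  then have "(norm ((x - ?p) + ?p))\<^sup>2 = (norm (x - ?p))\<^sup>2 + (norm ?p)\<^sup>2"
    using norm_add_Pythagorean[of "x - ?p" ?p] by (simp add: orthogonal_def)
  then show ?thesis using norm_partial_sum[OF assms, of "coef x"] by simp
qed

lemma coef_sq_summable: "summable (\<lambda>n. (cmod (coef x n))\<^sup>2)"
  by (rule bounded_imp_summable[where B="(norm x)\<^sup>2"]) (auto intro: bessel)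

lemma has_sum_coef:
  assumes "((\<lambda>n. cscale (a n) (e n)) has_sum s) UNIV"
  shows "coef s n = a n" "s \<in> X"
proof -
  let ?S = "sum (\<lambda>n. cscale (a n) (e n))"
  have lim: "(?S \<longlongrightarrow> s) (finite_subsets_at_top UNIV)"
    using assms by (simp add: has_sum_def)
  have *: "((\<lambda>F. coef (?S F) n) \<longlongrightarrow> coef s n) (finite_subsets_at_top UNIV)"
    by (rule bounded_linear.tendsto[OF bounded_linear_coef lim])
  have "\<forall>\<^sub>F F in finite_subsets_at_top UNIV. coef (?S F) n = a n"
    unfolding eventually_finite_subsets_at_top
    by (intro exI[of _ "{n}"]) (auto simp: coef_partial_sum)
  from tendsto_cong[OF this] * have "((\<lambda>F::nat set. a n) \<longlongrightarrow> coef s n) (finite_subsets_at_top UNIV)"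
    by blast
  then show "coef s n = a n"
    by (simp add: tendsto_const_iff)
  show "s \<in> X"
    by (rule Lim_in_closed_set[OF closed_space _ _ lim])
      (auto intro!: always_eventually sum_in cscale_in basis_in)
qed

lemma summable_on_basis:
  assumes a: "summable (\<lambda>n. (cmod (a n))\<^sup>2)"
  shows "(\<lambda>n. cscale (a n) (e n)) summable_on UNIV"
proof -
  let ?S = "sum (\<lambda>n. cscale (a n) (e n))" and ?N = "sum (\<lambda>n. (cmod (a n))\<^sup>2)"
  let ?L = "\<Sum>\<^sub>\<infinity>n. (cmod (a n))\<^sup>2"
  have "(\<lambda>n. (cmod (a n))\<^sup>2) summable_on UNIV"
    using a by (intro norm_summable_imp_summable_on) auto
  then have lim: "(?N \<longlongrightarrow> ?L) (finite_subsets_at_top UNIV)"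
    using has_sum_infsum has_sum_def by blast
  have "\<exists>P. eventually P (finite_subsets_at_top UNIV) \<and> (\<forall>F G. P F \<and> P G \<longrightarrow> dist (?S F) (?S G) < \<epsilon>)"
    if "\<epsilon> > 0" for \<epsilon> :: real
  proof -
    \<comment> \<open>Comparing \<open>F\<close> and \<open>F0\<close> with the total sum costs this
      amount twice, which leaves \<open>norm (?S F - ?S F0)\<close> below
      \<open>\<epsilon> / 2\<close>; two such sets are then \<open>\<epsilon>\<close>-close.\<close>
    from that have "(\<epsilon>/2)\<^sup>2 / 2 > 0" by simp
    from tendstoD[OF lim this] obtain F0 where F0: "finite F0"
      "\<And>F. finite F \<Longrightarrow> F0 \<subseteq> F \<Longrightarrow> dist (?N F) ?L < (\<epsilon>/2)\<^sup>2 / 2"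
      unfolding eventually_finite_subsets_at_top by auto
    have d: "norm (?S F - ?S F0) < \<epsilon> / 2" if F: "finite F" "F0 \<subseteq> F" for F
    proof -
      have "?S F - ?S F0 = ?S (F - F0)" using F by (simp add: sum_diff)
      then have "(norm (?S F - ?S F0))\<^sup>2 = ?N (F - F0)"
        using F by (simp add: norm_partial_sum)
      also have "\<dots> = ?N F - ?N F0" using F by (simp add: sum_diff)
      also have "\<dots> < (\<epsilon>/2)\<^sup>2"
        using F0(2)[OF F] F0(2)[OF F0(1) order_refl] unfolding dist_real_def by linarith
      finally show ?thesis by (rule power2_less_imp_less) (use \<open>\<epsilon> > 0\<close> in simp)
    qed
    define P where "P F \<longleftrightarrow> finite F \<and> F0 \<subseteq> F" for F
    have "eventually P (finite_subsets_at_top UNIV)"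
      unfolding eventually_finite_subsets_at_top P_def by (rule exI[of _ F0]) (simp add: F0(1))
    moreover have "dist (?S F) (?S G) < \<epsilon>" if "P F \<and> P G" for F G
    proof -
      have "norm (?S F - ?S F0) < \<epsilon> / 2" "norm (?S G - ?S F0) < \<epsilon> / 2"
        using d that by (auto simp: P_def)
      then show ?thesis
        using dist_triangle_half_l[of "?S F" "?S F0" \<epsilon> "?S G"]
        by (simp add: dist_norm norm_minus_commute)
    qed
    ultimately show ?thesis by blast
 qed
  then have "cauchy_filter (filtermap ?S (finite_subsets_at_top UNIV))"
    by (simp add: cauchy_filter_metric_filtermap)
  moreover have "complete (UNIV::L2 set)"
    by (meson Cauchy_convergent UNIV_I complete_def convergent_def)
  ultimately obtain s where "(?S \<longlongrightarrow> s) (finite_subsets_at_top UNIV)"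
    using complete_uniform[where S=UNIV] by (force simp: filterlim_def)
  then show ?thesis using summable_on_def has_sum_def by blast
qed

lemma summable_on_basis_iff:
  "(\<lambda>n. cscale (a n) (e n)) summable_on UNIV \<longleftrightarrow> summable (\<lambda>n. (cmod (a n))\<^sup>2)"
proof
  assume "(\<lambda>n. cscale (a n) (e n)) summable_on UNIV"
  then obtain s where "((\<lambda>n. cscale (a n) (e n)) has_sum s) UNIV" by (auto simp: summable_on_def)
  from has_sum_coef(1)[OF this] show "summable (\<lambda>n. (cmod (a n))\<^sup>2)"
    using coef_sq_summable[of s] by simp
qed (rule summable_on_basis)

lemma synth:
  assumes "summable (\<lambda>n. (cmod (a n))\<^sup>2)"
  shows "((\<lambda>n. cscale (a n) (e n)) has_sum synth a) UNIV" "synth a \<in> X" "coef (synth a) n = a n"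
proof -
  show *: "((\<lambda>n. cscale (a n) (e n)) has_sum synth a) UNIV"
    unfolding synth_def using summable_on_basis[OF assms] by simp
  show "synth a \<in> X" "coef (synth a) n = a n" using has_sum_coef[OF *] by auto
qed

text \<open>The series built from the coefficients of \<open>x\<close> lies in \<open>X\<close> and
  shares all coefficients with \<open>x\<close>, so totality identifies the two.\<close>

lemma expansion:
  assumes "x \<in> X" shows "((\<lambda>n. cscale (coef x n) (e n)) has_sum x) UNIV"
proof -
  have "synth (coef x) = x"
    by (rule coef_ext) (auto simp: synth[OF coef_sq_summable] assms)
  then show ?thesis using synth(1)[OF coef_sq_summable, of x] by simp
qed

lemma expansion_tendsto:
  "x \<in> X \<Longrightarrow> (\<lambda>N. \<Sum>n<N. cscale (coef x n) (e n)) \<longlonglongrightarrow> x"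
  using has_sum_imp_sums[OF expansion] by (simp add: sums_def)

lemma parseval:
  assumes "x \<in> X" shows "(\<lambda>n. (cmod (coef x n))\<^sup>2) sums (norm x)\<^sup>2"
proof -
  have "(\<lambda>N. (norm (\<Sum>n<N. cscale (coef x n) (e n)))\<^sup>2) \<longlonglongrightarrow> (norm x)\<^sup>2"
    by (intro tendsto_intros expansion_tendsto assms)
  then show ?thesis by (simp add: norm_partial_sum sums_def)
qed

end

text \<open>Common frame for \<open>A\<close> and \<open>A_*\<close>. Injectivity of
  \<open>lam\<close> makes every eigenspace a complex line, so the sums over the set of eigenvalues
  in \<open>pow_dom\<close> and \<open>pow_op\<close> reindex to sums over \<open>n\<close>. The
  assumption \<open>coef_T\<close> is symmetry tested against the basis and excludes further
  eigenvectors.\<close>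

locale diagonal_operator = hilbert_basis +
  fixes D :: "L2 set" and T :: "L2 \<Rightarrow> L2" and lam :: "nat \<Rightarrow> real"
  assumes lam_pos: "lam n > 0" and inj_lam: "inj lam"
    and dom_subset: "D \<subseteq> X"
    and eigen_in: "cscale c (e n) \<in> D"
    and eigen: "T (cscale c (e n)) = lam n *\<^sub>R cscale c (e n)"
    and coef_T: "x \<in> D \<Longrightarrow> coef (T x) n = lam n * coef x n"
begin

lemma eigenspace_imp_coef:
  assumes "x \<in> eigenspace D T \<mu>" "coef x n \<noteq> 0"
  shows "\<mu> = lam n"
proof -
  have "lam n * coef x n = \<mu> * coef x n"
    using assms(1) coef_T[of x n] by (auto simp: eigenspace_def coef_scaleR scaleR_conv_of_real)
  with assms(2) show ?thesis by simp
qed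

lemma eigenvalues_eq: "eigenvalues D T = range lam"
proof (intro set_eqI iffI)
  fix \<mu> assume "\<mu> \<in> eigenvalues D T"
  then obtain x where x: "x \<in> eigenspace D T \<mu>" "x \<noteq> 0" by (auto simp: eigenvalues_def)
  then have "x \<in> X" using dom_subset by (auto simp: eigenspace_def)
  with x(2) obtain n where "coef x n \<noteq> 0" using total by (auto simp: coef_def)
  from eigenspace_imp_coef[OF x(1) this] show "\<mu> \<in> range lam" by simp
next
  fix \<mu> assume "\<mu> \<in> range lam"
  then obtain n where n: "\<mu> = lam n" by auto
  have "cscale 1 (e n) \<in> eigenspace D T \<mu>"
    by (simp add: n eigenspace_def eigen_in eigen)
  moreover have "cscale 1 (e n) \<noteq> 0"
    using coef_cscale_basis[of 1 n n] by (auto simp: coef_zero)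
  ultimately show "\<mu> \<in> eigenvalues D T" by (auto simp: eigenvalues_def)
qed

lemma eigenspace_eq: "eigenspace D T (lam n) = range (\<lambda>c. cscale c (e n))"
proof (intro set_eqI iffI)
  fix x assume x: "x \<in> eigenspace D T (lam n)"
  then have "x \<in> X" using dom_subset by (auto simp: eigenspace_def)
  have "x = cscale (coef x n) (e n)"
  proof (rule coef_ext)
    fix k show "coef x k = coef (cscale (coef x n) (e n)) k"
      using eigenspace_imp_coef[OF x, of k] inj_lam by (auto simp: coef_cscale_basis inj_eq)
  qed (auto simp: \<open>x \<in> X\<close> intro: cscale_in basis_in)
  then show "x \<in> range (\<lambda>c. cscale c (e n))" by (rule range_eqI)
qed (auto simp: eigenspace_def eigen_in eigen)

lemma eigenproj_eq: "eigenproj D T (lam n) x = cscale (coef x n) (e n)"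
  unfolding eigenproj_def eigenspace_eq
proof (rule the_equality)
  show "cscale (coef x n) (e n) \<in> range (\<lambda>c. cscale c (e n)) \<and>
    (\<forall>q\<in>range (\<lambda>c. cscale c (e n)). cinner (x - cscale (coef x n) (e n)) q = 0)"
    by (auto simp: cinner_diff_left cinner_cscale_left cinner_cscale_right orthonormal coef_def)
  fix p assume p: "p \<in> range (\<lambda>c. cscale c (e n)) \<and>
    (\<forall>q\<in>range (\<lambda>c. cscale c (e n)). cinner (x - p) q = 0)"
  then obtain c where c: "p = cscale c (e n)" by auto
  have "cinner (x - p) (cscale 1 (e n)) = 0" using p by blast
  then have "coef x n = c"
    by (simp add: c cinner_diff_left cinner_cscale_left cinner_cscale_right orthonormal coef_def)
  with c show "p = cscale (coef x n) (e n)" by simp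
qed

lemma power_term: "(lam n powr \<sigma>) *\<^sub>R eigenproj D T (lam n) x
    = cscale (of_real (lam n powr \<sigma>) * coef x n) (e n)"
proof -
  have "cscale (of_real r * c) u = r *\<^sub>R cscale c u" for r c u
    unfolding cscale_of_real[symmetric] by transfer (simp add: ae_eq_def mult.assoc sq_int_cmult)
  then show ?thesis by (simp add: eigenproj_eq)
qed

lemma summable_on_power_iff:
  "(\<lambda>\<mu>. (\<mu> powr \<sigma>) *\<^sub>R eigenproj D T \<mu> x) summable_on eigenvalues D T
     \<longleftrightarrow> summable (\<lambda>n. (lam n powr \<sigma> * cmod (coef x n))\<^sup>2)"
proof -
  have "(\<lambda>\<mu>. (\<mu> powr \<sigma>) *\<^sub>R eigenproj D T \<mu> x) summable_on eigenvalues D T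
     \<longleftrightarrow> (\<lambda>n. cscale (of_real (lam n powr \<sigma>) * coef x n) (e n)) summable_on UNIV"
    unfolding eigenvalues_eq by (subst summable_on_reindex[OF inj_lam]) (simp add: o_def power_term)
  then show ?thesis by (simp add: summable_on_basis_iff norm_mult)
qed

lemma pow_dom_eq: "pow_dom X D T \<sigma> = {x \<in> X. summable (\<lambda>n. (lam n powr \<sigma> * cmod (coef x n))\<^sup>2)}"
  unfolding pow_dom_def summable_on_power_iff ..

lemma pow_op_eq: "pow_op D T \<sigma> x = synth (\<lambda>n. of_real (lam n powr \<sigma>) * coef x n)"
  unfolding pow_op_def eigenvalues_eq synth_def
  by (subst infsum_reindex[OF inj_lam]) (simp add: o_def power_term)

lemma pow_op:
  assumes "summable (\<lambda>n. (lam n powr \<sigma> * cmod (coef x n))\<^sup>2)"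
  shows "pow_op D T \<sigma> x \<in> X" "coef (pow_op D T \<sigma> x) n = of_real (lam n powr \<sigma>) * coef x n"
  unfolding pow_op_eq using assms by (subst synth; simp add: norm_mult)+

lemma pow_dom_zero: "pow_dom X D T 0 = X"
  \<comment> \<open>\<open>0 powr 0\<close> is \<open>0\<close>, so positivity of \<open>lam\<close>
    is what turns the weights into \<open>1\<close>.\<close>
  using coef_sq_summable lam_pos by (auto simp: pow_dom_eq less_imp_neq[symmetric])

end

subsection \<open>Functions on the interval\<close>

definition restr :: "real \<Rightarrow> (real \<Rightarrow> complex) \<Rightarrow> real \<Rightarrow> complex" where
  "restr l f x = (if x \<in> {0<..<l} then f x else 0)"

definition L2of :: "real \<Rightarrow> (real \<Rightarrow> complex) \<Rightarrow> L2" where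
  "L2of l f = abs_L2 (restr l f)"

lemma sq_int_restr_bounded:
  assumes [measurable]: "f \<in> borel_measurable borel"
    and b: "\<And>x. x \<in> {0<..<l} \<Longrightarrow> cmod (f x) \<le> C"
  shows "sq_int (restr l f)"
proof -
  have [measurable]: "restr l f \<in> borel_measurable lborel"
    unfolding restr_def[abs_def] by measurable
  have "integrable lborel (\<lambda>x. indicator {0<..<l} x * C\<^sup>2)"
    by (intro integrable_mult_left integrable_real_indicator; cases "0 \<le> l") auto
  then have "integrable lborel (\<lambda>x. (cmod (restr l f x))\<^sup>2)"
  proof (rule Bochner_Integration.integrable_bound)
    show "AE x in lborel. norm ((cmod (restr l f x))\<^sup>2) \<le> norm (indicator {0<..<l} x * C\<^sup>2)"
      using b by (auto simp: restr_def intro!: power_mono)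
  qed measurable
  then show ?thesis by (simp add: sq_int_def)
qed

lemma sq_int_restr:
  assumes "continuous_on UNIV f" shows "sq_int (restr l f)"
proof -
  have "compact (f ` {0..l})"
    by (intro compact_continuous_image continuous_on_subset[OF assms]) auto
  then obtain C where "\<forall>y\<in>f ` {0..l}. cmod y \<le> C"
    using compact_imp_bounded by (metis bounded_iff)
  then have C: "\<And>x. x \<in> {0..l} \<Longrightarrow> cmod (f x) \<le> C" by blast
  show ?thesis
    by (rule sq_int_restr_bounded[where C=C])
      (auto intro!: C borel_measurable_continuous_onI assms)
qed

lemma L2_on_iff: "u \<in> L2_on l \<longleftrightarrow> (AE x in lborel. x \<notin> {0<..<l} \<longrightarrow> rep_L2 u x = 0)"
  by (simp add: L2_on_def)

lemma L2_on_abs: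
  assumes "sq_int f" "\<And>x. x \<notin> {0<..<l} \<Longrightarrow> f x = 0" shows "abs_L2 f \<in> L2_on l"
  unfolding L2_on_iff using rep_abs_L2[OF assms(1)] by eventually_elim (auto simp: assms(2))

lemma L2of_in: "sq_int (restr l f) \<Longrightarrow> L2of l f \<in> L2_on l"
  unfolding L2of_def by (rule L2_on_abs) (auto simp: restr_def)

lemma rep_add: "AE x in lborel. rep_L2 (u + v) x = rep_L2 u x + rep_L2 v x"
  using rep_abs_L2[OF sq_int_add[OF sq_int_rep[of u] sq_int_rep[of v]]] plus_abs[OF sq_int_rep[of u] sq_int_rep[of v]]
  by simp

lemma rep_cscale: "AE x in lborel. rep_L2 (cscale c u) x = c * rep_L2 u x"
  using rep_abs_L2[OF sq_int_cmult[OF sq_int_rep[of u]]] cscale_abs[OF sq_int_rep[of u]]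
  by simp

lemma L2_on_add:
  assumes "u \<in> L2_on l" "v \<in> L2_on l" shows "u + v \<in> L2_on l"
  unfolding L2_on_iff using rep_add[of u v] assms[unfolded L2_on_iff] by eventually_elim auto

lemma L2_on_cscale:
  assumes "u \<in> L2_on l" shows "cscale c u \<in> L2_on l"
  unfolding L2_on_iff using rep_cscale[of c u] assms[unfolded L2_on_iff] by eventually_elim auto

text \<open>A subsequence converges almost everywhere, and the countably many exceptional null sets
  are removed together.\<close>

lemma closed_L2_on: "closed (L2_on l)"
proof (unfold closed_sequential_limits, intro allI impI)
  fix X u assume X: "(\<forall>n. X n \<in> L2_on l) \<and> X \<longlonglongrightarrow> u"
  then obtain r where r: "AE x in lborel. (\<lambda>n. rep_L2 (X (r n)) x) \<longlonglongrightarrow> rep_L2 u x"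
    using tendsto_L2_AE_subseq by blast
  have "AE x in lborel. \<forall>n. x \<notin> {0<..<l} \<longrightarrow> rep_L2 (X (r n)) x = 0"
    using X by (subst AE_all_countable) (auto simp: L2_on_iff)
  with r show "u \<in> L2_on l"
    unfolding L2_on_iff
  proof eventually_elim
    fix x assume lim: "(\<lambda>n. rep_L2 (X (r n)) x) \<longlonglongrightarrow> rep_L2 u x"
      and z: "\<forall>n. x \<notin> {0<..<l} \<longrightarrow> rep_L2 (X (r n)) x = 0"
    show "x \<notin> {0<..<l} \<longrightarrow> rep_L2 u x = 0"
    proof
      assume "x \<notin> {0<..<l}"
      with z lim have "(\<lambda>n. 0) \<longlonglongrightarrow> rep_L2 u x" by simp
      then show "rep_L2 u x = 0" by (simp add: LIMSEQ_const_iff)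
    qed
  qed
qed

lemma cinner_abs_right:
  assumes "sq_int g" shows "cinner u (abs_L2 g) = (LINT x|lborel. rep_L2 u x * cnj (g x))"
  using cinner_abs[OF sq_int_rep[of u] assms] by simp

lemma integrable_rep_mult: "sq_int g \<Longrightarrow> integrable lborel (\<lambda>x. rep_L2 u x * cnj (g x))"
  by (rule sq_int_mult_integrable[OF sq_int_rep])

lemma measurable_rep [measurable]: "rep_L2 u \<in> borel_measurable lborel"
  using sq_int_rep[of u] by (simp add: sq_int_def)

lemma measurable_cnj [measurable]: "cnj \<in> borel_measurable borel"
  by (intro borel_measurable_continuous_onI continuous_intros)

lemma LINT_cong_on:
  assumes u: "u \<in> L2_on l" and [measurable]: "f \<in> borel_measurable borel" "g \<in> borel_measurable borel"
    and eq: "\<And>x. x \<in> {0<..<l} \<Longrightarrow> f x = g x"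
  shows "(LINT x|lborel. rep_L2 u x * f x) = (LINT x|lborel. rep_L2 u x * g x)"
proof (rule integral_cong_AE)
  show "AE x in lborel. rep_L2 u x * f x = rep_L2 u x * g x"
    using u[unfolded L2_on_iff] by eventually_elim (use eq in auto)
qed measurable

lemma set_LINT_rep:
  assumes u: "u \<in> L2_on l" and [measurable]: "f \<in> borel_measurable borel"
  shows "(LINT x:{0<..<l}|lborel. rep_L2 u x * f x) = (LINT x|lborel. rep_L2 u x * f x)"
  unfolding set_lebesgue_integral_def
proof (rule integral_cong_AE)
  show "AE x in lborel. indicat_real {0<..<l} x *\<^sub>R (rep_L2 u x * f x) = rep_L2 u x * f x"
    using u[unfolded L2_on_iff] by eventually_elim (auto simp: indicator_def)
qed measurable

lemma measurable_restr [measurable]: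
  assumes [measurable]: "f \<in> borel_measurable borel" shows "restr l f \<in> borel_measurable borel"
  unfolding restr_def[abs_def] by measurable

lemma cinner_L2of:
  assumes u: "u \<in> L2_on l" and [measurable]: "f \<in> borel_measurable borel" and "sq_int (restr l f)"
  shows "cinner u (L2of l f) = (LINT x|lborel. rep_L2 u x * cnj (f x))"
  unfolding L2of_def cinner_abs_right[OF assms(3)]
  by (rule LINT_cong_on[OF u]) (auto simp: restr_def)

lemma integrable_rep_mult_on:
  assumes u: "u \<in> L2_on l" and [measurable]: "f \<in> borel_measurable borel" and f: "sq_int (restr l f)"
  shows "integrable lborel (\<lambda>x. rep_L2 u x * cnj (f x))"
proof (rule integrable_cong_AE_imp[OF integrable_rep_mult[OF f]])
  show "AE x in lborel. rep_L2 u x * cnj (restr l f x) = rep_L2 u x * cnj (f x)"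
    using u[unfolded L2_on_iff] by eventually_elim (auto simp: restr_def)
qed measurable

lemma integral_restr_FTC:
  fixes F f :: "real \<Rightarrow> complex"
  assumes "l > 0" and der: "\<And>x. (F has_vector_derivative f x) (at x)" and cont: "continuous_on UNIV f"
  shows "has_bochner_integral lborel (restr l f) (F l - F 0)"
proof -
  have "has_bochner_integral lborel (\<lambda>x. indicator {0..l} x *\<^sub>R f x) (F l - F 0)"
    by (rule has_bochner_integral_FTC_Icc)
      (use assms in \<open>auto intro: has_vector_derivative_at_within continuous_on_subset\<close>)
  \<comment> \<open>The fundamental theorem is used on the closed interval while
    \<open>restr\<close> refers to the open one; the two end points are null.\<close>
  moreover have "AE x in lborel. indicator {0..l} x *\<^sub>R f x = restr l f x"
    using AE_lborel_singleton[of 0] AE_lborel_singleton[of l]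
    by eventually_elim (auto simp: restr_def indicator_def)
  moreover have [measurable]: "f \<in> borel_measurable borel"
    by (intro borel_measurable_continuous_onI cont)
  ultimately show ?thesis
    by (subst (asm) has_bochner_integral_cong_AE) auto
qed

subsection \<open>Completeness of the trigonometric systems\<close>

text \<open>Half lines are stable under intersection and generate the Borel sets, so Dynkin's
  argument extends the vanishing to all Borel sets.\<close>

lemma integral_vanishing_Iio_imp_AE_zero:
  fixes w :: "real \<Rightarrow> complex"
  assumes w: "integrable lborel w" and z: "\<And>a. (LINT x:{..<a}|lborel. w x) = 0"
  shows "AE x in lborel. w x = 0"
proof (rule sigma_finite_measure.density_zero[OF sigma_finite_lborel w])
  have si: "set_integrable lborel A w" if "A \<in> sets borel" for A
    using integrable_mult_indicator[OF _ w, of A] that by (simp add: set_integrable_def)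
  have UN: "(\<Union>n. {..<real n}) = UNIV"
    by (auto intro: reals_Archimedean2)
  \<comment> \<open>The whole line is exhausted by half lines; its vanishing integral settles
    complements in the induction.\<close>
  have lim: "(\<lambda>n. LINT x:{..<real n}|lborel. w x) \<longlonglongrightarrow> (LINT x:(\<Union>n. {..<real n})|lborel. w x)"
    by (rule set_integral_cont_up) (auto simp: incseq_def intro!: si)
  then have total: "(LINT x:UNIV|lborel. w x) = 0"
    unfolding UN by (simp add: z LIMSEQ_const_iff)
  have IS: "Int_stable (range (lessThan :: real \<Rightarrow> _))" "range (lessThan :: real \<Rightarrow> _) \<subseteq> Pow UNIV"
  proof -
    have "{..<a} \<inter> {..<b} = {..<min a b}" for a b :: real by auto
    then show "Int_stable (range (lessThan :: real \<Rightarrow> _))" by (auto simp: Int_stable_def)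
  qed auto
  fix A :: "real set" assume "A \<in> sets lborel"
  then have "A \<in> sigma_sets UNIV (range lessThan)"
    by (simp add: borel_Iio)
  with IS show "(LINT x:A|lborel. w x) = 0"
  proof (induction A rule: sigma_sets_induct_disjoint)
    case (compl A)
    have "A \<in> sets borel" using compl(1) by (simp add: borel_Iio)
    then have "(LINT x:A \<union> (UNIV - A)|lborel. w x)
      = (LINT x:A|lborel. w x) + (LINT x:UNIV - A|lborel. w x)"
      by (intro set_integral_Un si) auto
    moreover have "A \<union> (UNIV - A) = UNIV" by auto
    ultimately show ?case using total compl(2) by simp
  next
    case (union A)
    have A: "A i \<in> sets borel" for i using union(2) by (auto simp: borel_Iio)
    have "(LINT x:(\<Union>i. A i)|lborel. w x) = (\<Sum>i. (LINT x:A i|lborel. w x))"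
      using union(1) A by (intro lebesgue_integral_countable_add si) (auto simp: disjoint_family_on_def)
    then show ?case using union(3) by simp
  next
    case (basic A)
    then show ?case using z by auto
  next
    case empty
    show ?case by (simp add: set_lebesgue_integral_def)
  qed
qed

text \<open>Since \<open>cos (\<pi> x / l)\<close> decreases on \<open>(0,l)\<close>, its superlevel sets are the initial intervals, and
  their indicator functions are limits of polynomials in \<open>cos (\<pi> x / l)\<close>.\<close>

lemma cos_moments_zero:
  fixes w :: "real \<Rightarrow> complex"
  assumes l: "l > 0" and w: "integrable lborel w" and supp: "AE x in lborel. x \<notin> {0<..<l} \<longrightarrow> w x = 0"
    and mom: "\<And>k. (LINT x|lborel. w x * of_real (cos (pi * x / l) ^ k)) = 0"
  shows "AE x in lborel. w x = 0"
proof (rule integral_vanishing_Iio_imp_AE_zero[OF w])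
  define c where "c x = cos (pi * x / l)" for x
  have [measurable]: "w \<in> borel_measurable borel" using w by auto
  have [measurable]: "c \<in> borel_measurable borel"
    unfolding c_def[abs_def] by (intro borel_measurable_continuous_onI continuous_intros) (use l in auto)
  have c1: "c x \<in> {-1..1}" for x by (simp add: c_def)
  have int: "integrable lborel (\<lambda>x. w x * of_real (g (c x)))"
    if g: "g \<in> borel_measurable borel" "\<And>t. t \<in> {-1..1} \<Longrightarrow> \<bar>g t\<bar> \<le> B" for g B
  proof (rule Bochner_Integration.integrable_bound[of _ "\<lambda>x. B * cmod (w x)"])
    have [measurable]: "g \<in> borel_measurable borel" by fact
    show "(\<lambda>x. w x * complex_of_real (g (c x))) \<in> borel_measurable lborel" by measurable
    show "AE x in lborel. norm (w x * complex_of_real (g (c x))) \<le> norm (B * cmod (w x))"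
    proof (rule AE_I2)
      fix x show "norm (w x * complex_of_real (g (c x))) \<le> norm (B * cmod (w x))"
        using mult_right_mono[OF g(2)[OF c1[of x]], of "cmod (w x)"]
        by (simp add: norm_mult mult.commute order_trans[OF _ abs_ge_self])
    qed
  qed (use w in simp)
  have poly: "(LINT x|lborel. w x * of_real (g (c x))) = 0" if "real_polynomial_function g" for g
  proof -
    obtain a n where g: "g = (\<lambda>x. \<Sum>i\<le>n. a i * x ^ i)"
      using \<open>real_polynomial_function g\<close> by (auto simp: real_polynomial_function_iff_sum)
    have "(LINT x|lborel. w x * of_real (g (c x)))
       = (LINT x|lborel. (\<Sum>i\<le>n. of_real (a i) * (w x * of_real (c x ^ i))))"
      by (simp add: g sum_distrib_left mult_ac)
    also have "\<dots> = (\<Sum>i\<le>n. LINT x|lborel. of_real (a i) * (w x * of_real (c x ^ i)))"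
    proof (rule Bochner_Integration.integral_sum)
      fix i show "integrable lborel (\<lambda>x. of_real (a i) * (w x * of_real (c x ^ i)))"
        by (intro integrable_mult_right int[of "\<lambda>t. t ^ i" 1]) (auto simp: power_abs intro!: power_le_one)
    qed
    also have "\<dots> = 0" using mom by (simp add: c_def)
    finally show ?thesis .
  qed
  \<comment> \<open>Stone-Weierstrass on \<open>{-1..1}\<close>, the range of the cosine; the error
    is the uniform error times the integral of \<open>cmod (w x)\<close>.\<close>
  have cont: "(LINT x|lborel. w x * of_real (g (c x))) = 0" if g: "continuous_on UNIV g" for g
  proof -
    have [measurable]: "g \<in> borel_measurable borel" by (rule borel_measurable_continuous_onI[OF g])
    have "cmod (LINT x|lborel. w x * of_real (g (c x))) \<le> e * (LINT x|lborel. cmod (w x))" if "e > 0" for e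
    proof -
      have "continuous_on {-1..1} g" using g continuous_on_subset by blast
      then obtain p where p: "real_polynomial_function p" "\<And>t. t \<in> {-1..1} \<Longrightarrow> \<bar>g t - p t\<bar> < e"
        using Stone_Weierstrass_real_polynomial_function[of "{-1..1}" g e] \<open>e > 0\<close> by auto
      have contp: "continuous_on UNIV p"
        using p(1) by (simp add: continuous_on_polymonial_function real_polynomial_function_eq)
      have bdd: "\<exists>B. \<forall>t\<in>{-1..1}. \<bar>f t\<bar> \<le> B" if "continuous_on UNIV f" for f :: "real \<Rightarrow> real"
      proof -
        have "compact (f ` {-1..1})"
          by (intro compact_continuous_image continuous_on_subset[OF that]) auto
        then obtain B where "\<forall>y\<in>f ` {-1..1}. norm y \<le> B"
          using compact_imp_bounded by (metis bounded_iff)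
        then have "\<forall>t\<in>{-1..1}. \<bar>f t\<bar> \<le> B" by auto
        then show ?thesis ..
      qed
      obtain B1 B2 where B: "\<forall>t\<in>{-1..1}. \<bar>g t\<bar> \<le> B1" "\<forall>t\<in>{-1..1}. \<bar>p t\<bar> \<le> B2"
        using bdd[OF g] bdd[OF contp] by blast
      have [measurable]: "p \<in> borel_measurable borel" by (rule borel_measurable_continuous_onI[OF contp])
      have ig: "integrable lborel (\<lambda>x. w x * of_real (g (c x)))" "integrable lborel (\<lambda>x. w x * of_real (p (c x)))"
        using int[of g B1] int[of p B2] B by auto
      then have "(LINT x|lborel. w x * of_real (g (c x)))
        = (LINT x|lborel. w x * of_real (g (c x)) - w x * of_real (p (c x)))"
        by (simp add: poly p(1))
      also have "cmod \<dots> \<le> (LINT x|lborel. e * cmod (w x))"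
      proof (rule order_trans[OF integral_norm_bound integral_mono])
        fix x
        have "cmod (w x * of_real (g (c x)) - w x * of_real (p (c x))) = cmod (w x) * \<bar>g (c x) - p (c x)\<bar>"
          by (simp add: norm_mult flip: right_diff_distrib of_real_diff)
        also have "\<dots> \<le> cmod (w x) * e"
          by (rule mult_left_mono[OF less_imp_le[OF p(2)[OF c1]] norm_ge_zero])
        also have "\<dots> = e * cmod (w x)" by (rule mult.commute)
        finally show "cmod (w x * of_real (g (c x)) - w x * of_real (p (c x))) \<le> e * cmod (w x)" .
      qed (use w ig in auto)
      also have "\<dots> = e * (LINT x|lborel. cmod (w x))" by simp
      finally show ?thesis .
    qed
    note b = this
    show ?thesis
    proof (rule ccontr)
      define I J where "I = cmod (LINT x|lborel. w x * of_real (g (c x)))" and "J = (LINT x|lborel. cmod (w x))"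
      assume "\<not> ?thesis"
      then have I: "I > 0" by (simp add: I_def)
      have J: "J \<ge> 0" unfolding J_def by simp
      have b': "I \<le> e * J" if "e > 0" for e using b[OF that] by (simp only: I_def J_def)
      \<comment> \<open>If \<open>J = 0\<close>, then \<open>e = 1\<close> gives
        \<open>I \<le> 0\<close>; otherwise \<open>e = I / (2 * J)\<close> gives
        \<open>I \<le> I / 2\<close>.\<close>
      show False using b'[of 1] b'[of "I / (2 * J)"] I J by (cases "J = 0") auto
    qed
  qed
  have ind: "(LINT x|lborel. w x * of_real (indicator {t<..} (c x))) = 0" for t
  proof -
    \<comment> \<open>Continuous ramps increasing to the indicator of \<open>{t<..}\<close>, with
      values in \<open>[0,1]\<close>, so that \<open>cmod (w x)\<close> dominates.\<close>
    let ?g = "\<lambda>(j::nat) s. min 1 (real j * max 0 (s - t))"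
    have "(\<lambda>j. LINT x|lborel. w x * of_real (?g j (c x))) \<longlonglongrightarrow> (LINT x|lborel. w x * of_real (indicator {t<..} (c x)))"
    proof (rule integral_dominated_convergence[where w="\<lambda>x. cmod (w x)"])
      show "AE x in lborel. (\<lambda>j. w x * of_real (?g j (c x))) \<longlonglongrightarrow> w x * of_real (indicator {t<..} (c x))"
      proof (intro AE_I2 tendsto_mult tendsto_const tendsto_of_real)
        fix x
        show "(\<lambda>j. ?g j (c x)) \<longlonglongrightarrow> indicator {t<..} (c x)"
        proof (cases "c x > t")
          case True
          obtain N where N: "1 / (c x - t) < real N" using reals_Archimedean2 by blast
          have "\<forall>\<^sub>F j in sequentially. ?g j (c x) = 1"
          proof (rule eventually_sequentiallyI[of N])
            fix j assume "N \<le> j"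
            then have "1 / (c x - t) \<le> real j" using N by simp
            then show "?g j (c x) = 1" using True by (simp add: field_simps max_def min_def)
          qed
          then show ?thesis using True by (simp add: tendsto_eventually)
        qed (simp add: max_def)
      qed
      show "AE x in lborel. norm (w x * of_real (?g j (c x))) \<le> cmod (w x)" for j
        by (intro AE_I2) (auto simp: norm_mult intro!: mult_left_le)
    qed (use w in auto)
    moreover have "(LINT x|lborel. w x * of_real (?g j (c x))) = 0" for j
      by (intro cont continuous_intros)
    ultimately show ?thesis by (simp add: LIMSEQ_const_iff)
  qed
  fix a
  show "(LINT x:{..<a}|lborel. w x) = 0"
  proof -
    \<comment> \<open>For \<open>a\<close> outside \<open>(0,l)\<close> the cosine at
      \<open>a\<close> is not the right threshold: level \<open>1\<close> gives the empty set, and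
      level \<open>-1\<close>, not attained inside the interval, gives all of it.\<close>
    define t where "t = (if a \<le> 0 then 1 else if a \<ge> l then -1 else c a)"
    have key: "x < a \<longleftrightarrow> t < c x" if "x \<in> {0<..<l}" for x
    proof -
      have x: "0 < pi * x / l" "pi * x / l < pi" using that l by (auto simp: field_simps)
      show ?thesis
      proof (cases "a \<le> 0")
        case True
        then show ?thesis using that c1[of x] by (auto simp: t_def)
      next
        case a0: False
        show ?thesis
        proof (cases "a \<ge> l")
          case True
          have "cos pi < cos (pi * x / l)" using x by (intro cos_monotone_0_pi) auto
          then show ?thesis using True a0 that by (auto simp: t_def c_def)
        next
          case False
          have "pi * a / l \<in> {0..pi}" "pi * x / l \<in> {0..pi}" using a0 False x l by (auto simp: field_simps)
          then have "cos (pi * a / l) < cos (pi * x / l) \<longleftrightarrow> pi * x / l < pi * a / l"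
            by (intro cos_mono_less_eq) auto
          then show ?thesis using a0 False l by (simp add: t_def c_def divide_less_cancel)
        qed
      qed
    qed
    have "(LINT x:{..<a}|lborel. w x) = (LINT x|lborel. w x * of_real (indicator {t<..} (c x)))"
      unfolding set_lebesgue_integral_def
    proof (rule integral_cong_AE)
      show "AE x in lborel. indicat_real {..<a} x *\<^sub>R w x = w x * of_real (indicator {t<..} (c x))"
        using supp
      proof eventually_elim
        fix x assume "x \<notin> {0<..<l} \<longrightarrow> w x = 0"
        then show "indicat_real {..<a} x *\<^sub>R w x = w x * of_real (indicator {t<..} (c x))"
          using key[of x] by (cases "x \<in> {0<..<l}") (auto simp: indicator_def)
      qed
    qed measurable
    then show ?thesis using ind by simp
  qed
qed

text \<open>Multiplying by the cosine moves a frequency one step up and one step down, so induction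
  on the power \<open>k\<close> reduces to the coefficients themselves. The downward neighbour is
  the separate parameter \<open>\<psi>\<close> because at the lowest frequency it is
  \<open>0\<close> for sines and the next higher function for cosines.\<close>

lemma cos_coeffs_imp_moments:
  fixes v :: "real \<Rightarrow> complex" and \<phi> :: "nat \<Rightarrow> real \<Rightarrow> real"
  assumes int: "\<And>g. g \<in> borel_measurable borel \<Longrightarrow> (\<And>x. \<bar>g x\<bar> \<le> 1) \<Longrightarrow> integrable lborel (\<lambda>x. v x * of_real (g x))"
    and meas: "\<And>n. \<phi> n \<in> borel_measurable borel" "c \<in> borel_measurable borel"
    and bnd: "\<And>n x. \<bar>\<phi> n x\<bar> \<le> 1" "\<And>x. \<bar>c x\<bar> \<le> 1"
    and rec: "\<And>n x. c x * \<phi> n x = (\<phi> (Suc n) x + \<psi> n x) / 2"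
    and psi: "\<And>n. \<psi> n = (\<lambda>_. 0) \<or> \<psi> n \<in> range \<phi>"
    and z: "\<And>n. (LINT x|lborel. v x * of_real (\<phi> n x)) = 0"
  shows "(LINT x|lborel. v x * of_real (c x ^ k * \<phi> n x)) = 0"
proof (induction k arbitrary: n)
  case 0 then show ?case using z by simp
next
  case (Suc k)
  have I: "integrable lborel (\<lambda>x. v x * of_real (c x ^ k * \<phi> m x))" for m
  proof (rule int)
    show "(\<lambda>x. c x ^ k * \<phi> m x) \<in> borel_measurable borel" using meas by measurable
    show "\<bar>c x ^ k * \<phi> m x\<bar> \<le> 1" for x
      using bnd by (auto simp: abs_mult power_abs intro!: mult_le_one power_le_one)
  qed
  have J: "integrable lborel (\<lambda>x. v x * of_real (c x ^ k * \<psi> n x)) \<and> (LINT x|lborel. v x * of_real (c x ^ k * \<psi> n x)) = 0"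
    using psi[of n] I Suc.IH by auto
  have "(\<lambda>x. v x * of_real (c x ^ Suc k * \<phi> n x))
    = (\<lambda>x. (v x * of_real (c x ^ k * \<phi> (Suc n) x) + v x * of_real (c x ^ k * \<psi> n x)) / 2)"
  proof
    fix x
    have "c x ^ Suc k * \<phi> n x = c x ^ k * (c x * \<phi> n x)" by simp
    also have "\<dots> = (c x ^ k * \<phi> (Suc n) x + c x ^ k * \<psi> n x) / 2"
      unfolding rec by (simp add: distrib_left)
    finally have e: "c x ^ Suc k * \<phi> n x = (c x ^ k * \<phi> (Suc n) x + c x ^ k * \<psi> n x) / 2" .
    show "v x * of_real (c x ^ Suc k * \<phi> n x)
      = (v x * of_real (c x ^ k * \<phi> (Suc n) x) + v x * of_real (c x ^ k * \<psi> n x)) / 2"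
      unfolding e by (simp add: distrib_left add_divide_distrib)
  qed
  then show ?case using I J Suc.IH[of "Suc n"] by (simp add: Bochner_Integration.integral_add)
qed


subsection \<open>The sine and cosine bases\<close>

text \<open>The frequencies are indexed from \<open>0\<close>: the mode with index \<open>n\<close> has wave number \<open>(n + 1) \<pi> / l\<close>.\<close>

definition wave :: "real \<Rightarrow> nat \<Rightarrow> real" where "wave l n = real (Suc n) * pi / l"

lemma wave_pos: "l > 0 \<Longrightarrow> wave l n > 0"
  by (simp add: wave_def)

definition sinf :: "real \<Rightarrow> nat \<Rightarrow> real \<Rightarrow> complex" where
  "sinf l n x = of_real (sqrt (2 / l) * sin (wave l n * x))"

definition cosf :: "real \<Rightarrow> nat \<Rightarrow> real \<Rightarrow> complex" where
  "cosf l n x = of_real (sqrt (2 / l) * cos (wave l n * x))"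

definition sL :: "real \<Rightarrow> nat \<Rightarrow> L2" where "sL l n = L2of l (sinf l n)"
definition cL :: "real \<Rightarrow> nat \<Rightarrow> L2" where "cL l n = L2of l (cosf l n)"
definition oneL :: "real \<Rightarrow> L2" where "oneL l = L2of l (\<lambda>_. 1)"

lemma continuous_sinf: "continuous_on A (sinf l n)" and continuous_cosf: "continuous_on A (cosf l n)"
  unfolding sinf_def[abs_def] cosf_def[abs_def] by (intro continuous_intros)+

lemma measurable_sinf [measurable]: "sinf l n \<in> borel_measurable borel"
  and measurable_cosf [measurable]: "cosf l n \<in> borel_measurable borel"
  by (intro borel_measurable_continuous_onI continuous_sinf continuous_cosf)+

lemma sq_int_sinf: "sq_int (restr l (sinf l n))" and sq_int_cosf: "sq_int (restr l (cosf l n))"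
  and sq_int_one: "sq_int (restr l (\<lambda>_. 1))"
  by (intro sq_int_restr continuous_sinf continuous_cosf continuous_on_const)+

lemma cinner_L2of_L2of:
  assumes "sq_int (restr l f)" "sq_int (restr l g)"
  shows "cinner (L2of l f) (L2of l g) = (LINT x|lborel. restr l (\<lambda>x. f x * cnj (g x)) x)"
  unfolding L2of_def cinner_abs[OF assms] by (intro Bochner_Integration.integral_cong) (auto simp: restr_def)

lemma integral_cos_multiple:
  assumes "l > 0"
  shows "has_bochner_integral lborel (restr l (\<lambda>x. of_real (cos (of_int j * pi / l * x)))) (if j = 0 then of_real l else 0)"
proof (cases "j = 0")
  case True
  have "has_bochner_integral lborel (restr l (\<lambda>x. of_real (cos (of_int j * pi / l * x)))) (of_real l - of_real 0)"
    using assms True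
    by (intro integral_restr_FTC[of l of_real]) (auto intro!: derivative_eq_intros continuous_intros
      simp: has_vector_derivative_def scaleR_conv_of_real)
  then show ?thesis using True by simp
next
  case False
  define k where "k = of_int j * pi / l"
  have k: "k \<noteq> 0" using False assms by (simp add: k_def)
  let ?F = "\<lambda>x. complex_of_real (sin (k * x) / k)"
  have "has_bochner_integral lborel (restr l (\<lambda>x. of_real (cos (k * x)))) (?F l - ?F 0)"
  proof (rule integral_restr_FTC[OF assms])
    fix x
    have "((\<lambda>x. sin (k * x) / k) has_real_derivative cos (k * x)) (at x)"
      using k by (auto intro!: derivative_eq_intros)
    then show "(?F has_vector_derivative of_real (cos (k * x))) (at x)"
      by (intro has_vector_derivative_of_real)
        (simp add: has_real_derivative_iff_has_vector_derivative)
  qed (intro continuous_intros)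
  moreover have "sin (k * l) = 0"
    using assms by (simp add: k_def sin_zero_iff_int2)
  ultimately show ?thesis using False by (simp add: k_def)
qed

lemma trig_orthonormal:
  assumes l: "l > 0"
  shows "cinner (sL l m) (sL l n) = (if m = n then 1 else 0)"
    and "cinner (cL l m) (cL l n) = (if m = n then 1 else 0)"
    and "cinner (cL l n) (oneL l) = 0"
proof -
  let ?c = "\<lambda>j. restr l (\<lambda>x. of_real (cos (of_int j * pi / l * x)))"
  let ?I = "\<lambda>j::int. if j = 0 then complex_of_real l else 0"
  have r: "sqrt (2 / l) * sqrt (2 / l) = 2 / l" using l by simp
  \<comment> \<open>Frequencies are counted from \<open>0\<close>, hence the shift by
    \<open>2\<close> in the sum; that index is never zero, so only the difference term can
    contribute to the integral.\<close>
  have arg: "cos (wave l m * x - wave l n * x) = cos (of_int (int m - int n) * pi / l * x)"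
    "cos (wave l m * x + wave l n * x) = cos (of_int (int m + int n + 2) * pi / l * x)" for x
    by (auto simp: wave_def algebra_simps add_divide_distrib diff_divide_distrib intro!: arg_cong[of _ _ cos])
  have "restr l (\<lambda>x. sinf l m x * cnj (sinf l n x))
    = (\<lambda>x. of_real (1 / l) * ?c (int m - int n) x - of_real (1 / l) * ?c (int m + int n + 2) x)"
  proof
    fix x
    have "sinf l m x * cnj (sinf l n x) = of_real ((sqrt (2 / l) * sqrt (2 / l)) * (sin (wave l m * x) * sin (wave l n * x)))"
      by (simp only: sinf_def complex_cnj_complex_of_real complex_cnj_mult of_real_mult mult_ac)
    also have "\<dots> = of_real (1 / l) * of_real (cos (of_int (int m - int n) * pi / l * x))
        - of_real (1 / l) * of_real (cos (of_int (int m + int n + 2) * pi / l * x))"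
      unfolding r sin_times_sin arg of_real_mult[symmetric] of_real_diff[symmetric]
      by (intro arg_cong[of _ _ of_real]) (simp add: diff_divide_distrib)
    finally show "restr l (\<lambda>x. sinf l m x * cnj (sinf l n x)) x
      = of_real (1 / l) * ?c (int m - int n) x - of_real (1 / l) * ?c (int m + int n + 2) x"
      by (auto simp: restr_def)
  qed
  then have "has_bochner_integral lborel (restr l (\<lambda>x. sinf l m x * cnj (sinf l n x)))
      (of_real (1 / l) * ?I (int m - int n) - of_real (1 / l) * ?I (int m + int n + 2))"
    by (simp only:) (intro has_bochner_integral_diff has_bochner_integral_mult_right integral_cos_multiple l)
  then show "cinner (sL l m) (sL l n) = (if m = n then 1 else 0)"
    using l by (auto simp: sL_def cinner_L2of_L2of sq_int_sinf has_bochner_integral_integral_eq)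
  have "restr l (\<lambda>x. cosf l m x * cnj (cosf l n x))
    = (\<lambda>x. of_real (1 / l) * ?c (int m - int n) x + of_real (1 / l) * ?c (int m + int n + 2) x)"
  proof
    fix x
    have "cosf l m x * cnj (cosf l n x) = of_real ((sqrt (2 / l) * sqrt (2 / l)) * (cos (wave l m * x) * cos (wave l n * x)))"
      by (simp only: cosf_def complex_cnj_complex_of_real complex_cnj_mult of_real_mult mult_ac)
    also have "\<dots> = of_real (1 / l) * of_real (cos (of_int (int m - int n) * pi / l * x))
        + of_real (1 / l) * of_real (cos (of_int (int m + int n + 2) * pi / l * x))"
      unfolding r cos_times_cos arg of_real_mult[symmetric] of_real_add[symmetric]
      by (intro arg_cong[of _ _ of_real]) (simp add: add_divide_distrib)
    finally show "restr l (\<lambda>x. cosf l m x * cnj (cosf l n x)) x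
      = of_real (1 / l) * ?c (int m - int n) x + of_real (1 / l) * ?c (int m + int n + 2) x"
      by (auto simp: restr_def)
  qed
  then have "has_bochner_integral lborel (restr l (\<lambda>x. cosf l m x * cnj (cosf l n x)))
      (of_real (1 / l) * ?I (int m - int n) + of_real (1 / l) * ?I (int m + int n + 2))"
    by (simp only:) (intro has_bochner_integral_add has_bochner_integral_mult_right integral_cos_multiple l)
  then show "cinner (cL l m) (cL l n) = (if m = n then 1 else 0)"
    using l by (auto simp: cL_def cinner_L2of_L2of sq_int_cosf has_bochner_integral_integral_eq)
  have "restr l (\<lambda>x. cosf l n x * cnj 1) = (\<lambda>x. of_real (sqrt (2 / l)) * ?c (int (Suc n)) x)"
    by (auto simp: fun_eq_iff restr_def cosf_def wave_def)
  then have "has_bochner_integral lborel (restr l (\<lambda>x. cosf l n x * cnj 1)) (of_real (sqrt (2 / l)) * ?I (int (Suc n)))"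
    by (simp only:) (intro has_bochner_integral_mult_right integral_cos_multiple l)
  then show "cinner (cL l n) (oneL l) = 0"
    by (simp add: cL_def oneL_def cinner_L2of_L2of sq_int_cosf sq_int_one has_bochner_integral_integral_eq)
qed

lemma L2_zeroI:
  assumes "AE x in lborel. rep_L2 u x = 0" shows "u = 0"
proof -
  have "abs_L2 (rep_L2 u) = abs_L2 (\<lambda>_. 0)"
    by (rule abs_L2_eqI) (use assms in \<open>auto simp: sq_int_rep sq_int_zero\<close>)
  then show ?thesis by (simp add: zero_abs)
qed

lemma integrable_rep_mult_bounded:
  assumes u: "u \<in> L2_on l" and [measurable]: "g \<in> borel_measurable borel" and g: "\<And>x. \<bar>g x\<bar> \<le> (1::real)"
  shows "integrable lborel (\<lambda>x. rep_L2 u x * of_real (g x))"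
proof -
  have "sq_int (restr l (\<lambda>x. of_real (g x)))"
    by (rule sq_int_restr_bounded[where C=1]) (auto simp: g)
  from integrable_rep_mult_on[OF u _ this] show ?thesis by simp
qed

text \<open>The moment lemma is applied to \<open>u\<close> times the lowest sine, because powers of
  the cosine times that sine are finite combinations of sines whereas the powers alone are not. The
  factor has no zero in \<open>(0,l)\<close> and can be divided out.\<close>

lemma sine_total:
  assumes l: "l > 0" and u: "u \<in> L2_on l" and z: "\<And>n. cinner u (sL l n) = 0"
  shows "u = 0"
proof -
  let ?s = "\<lambda>n x. sin (wave l n * x)" and ?c = "\<lambda>x. cos (pi * x / l)"
  let ?\<psi> = "\<lambda>n. case n of 0 \<Rightarrow> (\<lambda>_. 0) | Suc m \<Rightarrow> ?s m"
  have int: "integrable lborel (\<lambda>x. rep_L2 u x * of_real (g x))"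
    if "g \<in> borel_measurable borel" "\<And>x. \<bar>g x\<bar> \<le> 1" for g
    by (rule integrable_rep_mult_bounded[OF u that])
  have c: "?c \<in> borel_measurable borel" and s: "?s n \<in> borel_measurable borel" for n
    using l by (auto intro!: borel_measurable_continuous_onI continuous_intros)
  have sz: "(LINT x|lborel. rep_L2 u x * of_real (?s n x)) = 0" for n
  proof -
    have "0 = (LINT x|lborel. of_real (sqrt (2 / l)) * (rep_L2 u x * of_real (?s n x)))"
      using z[of n] unfolding sL_def cinner_L2of[OF u measurable_sinf sq_int_sinf]
      by (simp add: sinf_def mult_ac)
    then show ?thesis using l by simp
  qed
  have mom: "(LINT x|lborel. rep_L2 u x * of_real (?c x ^ k * ?s n x)) = 0" for k n
  proof (rule cos_coeffs_imp_moments[where c="?c" and \<phi>="?s" and \<psi>="?\<psi>" and v="rep_L2 u", OF int s c _ _ _ _ sz])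
    show "?c x * ?s n x = (?s (Suc n) x + ?\<psi> n x) / 2" for n x
    proof (cases n)
      case 0
      have "?s (Suc 0) x = sin (2 * (pi * x / l))" by (simp add: wave_def mult.assoc)
      then show ?thesis unfolding sin_double using 0 by (simp add: wave_def mult_ac)
    next
      case (Suc m)
      have "?s (Suc n) x = sin (wave l n * x + pi * x / l)" "?s m x = sin (wave l n * x - pi * x / l)"
        using Suc by (auto simp: wave_def algebra_simps add_divide_distrib intro!: arg_cong[of _ _ sin])
      then show ?thesis unfolding Suc by (simp add: sin_add sin_diff Suc)
    qed
    show "?\<psi> n = (\<lambda>_. 0) \<or> ?\<psi> n \<in> range ?s" for n by (cases n) auto
  qed auto
  have "AE x in lborel. rep_L2 u x * of_real (?s 0 x) = 0"
  proof (rule cos_moments_zero[OF l])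
    show "integrable lborel (\<lambda>x. rep_L2 u x * of_real (?s 0 x))" by (rule int) (use s in auto)
    show "AE x in lborel. x \<notin> {0<..<l} \<longrightarrow> rep_L2 u x * of_real (?s 0 x) = 0"
      using u[unfolded L2_on_iff] by eventually_elim auto
    fix k show "(LINT x|lborel. rep_L2 u x * of_real (?s 0 x) * of_real (?c x ^ k)) = 0"
      using mom[of k 0] by (simp add: mult_ac)
  qed
  then have "AE x in lborel. rep_L2 u x = 0"
    using u[unfolded L2_on_iff]
  proof eventually_elim
    fix x assume a: "rep_L2 u x * of_real (?s 0 x) = 0" "x \<notin> {0<..<l} \<longrightarrow> rep_L2 u x = 0"
    show "rep_L2 u x = 0"
    proof (cases "x \<in> {0<..<l}")
      case True
      then have "0 < wave l 0 * x" "wave l 0 * x < pi" using l by (auto simp: wave_def field_simps)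
      then have "?s 0 x > 0" by (rule sin_gt_zero)
      with a(1) show ?thesis by simp
    qed (use a in simp)
  qed
  then show ?thesis by (rule L2_zeroI)
qed

lemma cosine_total:
  assumes l: "l > 0" and u: "u \<in> L2_on l" and z: "\<And>n. cinner u (cL l n) = 0" and z1: "cinner u (oneL l) = 0"
  shows "u = 0"
proof -
  \<comment> \<open>Here index \<open>0\<close> is the constant function and index
    \<open>n + 1\<close> is the mode \<open>n\<close> of \<open>cL\<close>; with the constant
    included, the moments of \<open>u\<close> itself vanish.\<close>
  let ?s = "\<lambda>n x. cos (real n * pi / l * x)" and ?c = "\<lambda>x. cos (pi * x / l)"
  let ?\<psi> = "\<lambda>n. case n of 0 \<Rightarrow> ?s 1 | Suc m \<Rightarrow> ?s m"
  have int: "integrable lborel (\<lambda>x. rep_L2 u x * of_real (g x))"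
    if "g \<in> borel_measurable borel" "\<And>x. \<bar>g x\<bar> \<le> 1" for g
    by (rule integrable_rep_mult_bounded[OF u that])
  have c: "?c \<in> borel_measurable borel" and s: "?s n \<in> borel_measurable borel" for n
    using l by (auto intro!: borel_measurable_continuous_onI continuous_intros)
  have sz: "(LINT x|lborel. rep_L2 u x * of_real (?s n x)) = 0" for n
  proof (cases n)
    case 0
    then show ?thesis
      using z1 unfolding oneL_def by (subst (asm) cinner_L2of[OF u _ sq_int_one]) auto
  next
    case (Suc m)
    have "0 = (LINT x|lborel. of_real (sqrt (2 / l)) * (rep_L2 u x * of_real (?s n x)))"
      using z[of m] unfolding cL_def cinner_L2of[OF u measurable_cosf sq_int_cosf]
      by (simp add: cosf_def wave_def Suc mult_ac)
    then show ?thesis using l by simp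
  qed
  have mom: "(LINT x|lborel. rep_L2 u x * of_real (?c x ^ k * ?s n x)) = 0" for k n
  proof (rule cos_coeffs_imp_moments[where c="?c" and \<phi>="?s" and \<psi>="?\<psi>" and v="rep_L2 u", OF int s c _ _ _ _ sz])
    show "?c x * ?s n x = (?s (Suc n) x + ?\<psi> n x) / 2" for n x
    proof (cases n)
      case (Suc m)
      have "?s (Suc n) x = cos (real n * pi / l * x + pi * x / l)" "?s m x = cos (real n * pi / l * x - pi * x / l)"
        using Suc by (auto simp: algebra_simps add_divide_distrib intro!: arg_cong[of _ _ cos])
      then show ?thesis unfolding Suc by (simp add: cos_add cos_diff Suc)
    qed simp
    show "?\<psi> n = (\<lambda>_. 0) \<or> ?\<psi> n \<in> range ?s" for n
    proof (cases n)
      case 0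
      then show ?thesis by (intro disjI2 range_eqI[of _ _ 1]) simp
    next
      case (Suc m)
      then show ?thesis by (intro disjI2 range_eqI[of _ _ m]) simp
    qed
  qed auto
  have "AE x in lborel. rep_L2 u x = 0"
  proof (rule cos_moments_zero[OF l])
    show "integrable lborel (rep_L2 u)" using int[of "\<lambda>_. 1"] by simp
    show "AE x in lborel. x \<notin> {0<..<l} \<longrightarrow> rep_L2 u x = 0"
      using u[unfolded L2_on_iff] .
    fix k show "(LINT x|lborel. rep_L2 u x * of_real (?c x ^ k)) = 0"
      using mom[of k 0] by simp
  qed
  then show ?thesis by (rule L2_zeroI)
qed

text \<open>Writing the mean as an inner product makes the subspace visibly closed and complex
  linear.\<close>

lemma L2_mean0_iff: "u \<in> L2_mean0 l \<longleftrightarrow> u \<in> L2_on l \<and> cinner u (oneL l) = 0"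
proof -
  have "(LINT x:{0<..<l}|lborel. rep_L2 u x) = cinner u (oneL l)" if "u \<in> L2_on l"
    using set_LINT_rep[OF that, of "\<lambda>_. 1"] that
    by (simp add: oneL_def cinner_L2of sq_int_one)
  then show ?thesis by (auto simp: L2_mean0_def)
qed

lemma sine_basis: "l > 0 \<Longrightarrow> hilbert_basis (L2_on l) (sL l)"
  by unfold_locales (auto simp: L2_on_add L2_on_cscale closed_L2_on trig_orthonormal
    L2of_in[OF sq_int_sinf, folded sL_def] intro: sine_total)

lemma cosine_basis: "l > 0 \<Longrightarrow> hilbert_basis (L2_mean0 l) (cL l)"
proof unfold_locales
  assume l: "l > 0"
  have "L2_mean0 l = L2_on l \<inter> (\<lambda>u. cinner u (oneL l)) -` {0}" by (auto simp: L2_mean0_iff)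
  then show "closed (L2_mean0 l)"
    by (auto intro!: closed_Int closed_L2_on continuous_closed_vimage linear_continuous_at bounded_linear_cinner_left)
  show "cL l n \<in> L2_mean0 l" for n
    using L2of_in[OF sq_int_cosf, of l n] trig_orthonormal(3)[OF l] by (simp add: L2_mean0_iff cL_def)
  show "cinner (cL l m) (cL l n) = (if m = n then 1 else 0)" for m n
    by (rule trig_orthonormal(2)[OF l])
  show "x = 0" if "x \<in> L2_mean0 l" "\<And>n. cinner x (cL l n) = 0" for x
    using that cosine_total[OF l, of x] by (simp add: L2_mean0_iff)
qed (auto simp: L2_mean0_iff L2_on_add L2_on_cscale cinner_add_left cinner_cscale_left)

subsection \<open>Smooth cutoff functions\<close>

text \<open>Existence of \<open>n\<close> successive derivatives, with the derivative as a witness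
  instead of iterated \<open>vderiv\<close>, so that the closure rules are plain inductions. Level
  \<open>0\<close> carries no information, not even continuity.\<close>

primrec diffk :: "nat \<Rightarrow> (real \<Rightarrow> 'a::real_normed_vector) \<Rightarrow> bool" where
  "diffk 0 f = True"
| "diffk (Suc n) f = (\<exists>f'. (\<forall>x. (f has_vector_derivative f' x) (at x)) \<and> diffk n f')"

lemma diffk_SucI:
  "(\<And>x. (f has_vector_derivative f' x) (at x)) \<Longrightarrow> diffk n f' \<Longrightarrow> diffk (Suc n) f"
  by auto

lemma continuous_on_vector_derivative:
  assumes "\<And>x. (f has_vector_derivative f' x) (at x)" shows "continuous_on A f"
  using assms by (intro continuous_at_imp_continuous_on ballI has_vector_derivative_continuous)

lemma diffk_SucD: "diffk (Suc n) f \<Longrightarrow> diffk n f"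
proof (induction n arbitrary: f)
  case (Suc n)
  then obtain f' where "\<forall>x. (f has_vector_derivative f' x) (at x)" "diffk (Suc n) f'" by auto
  with Suc.IH show ?case by auto
qed simp

lemma diffk_const: "diffk n (\<lambda>x. c)"
proof (induction n arbitrary: c)
  case (Suc n)
  show ?case using Suc[of 0] by (auto intro!: exI[of _ "\<lambda>_. 0"])
qed simp

lemma diffk_add: "diffk n f \<Longrightarrow> diffk n g \<Longrightarrow> diffk n (\<lambda>x. f x + g x)"
proof (induction n arbitrary: f g)
  case (Suc n)
  then obtain f' g' where "\<forall>x. (f has_vector_derivative f' x) (at x)" "diffk n f'"
    "\<forall>x. (g has_vector_derivative g' x) (at x)" "diffk n g'" by auto
  with Suc.IH[of f' g'] show ?case
    by (auto intro!: exI[of _ "\<lambda>x. f' x + g' x"] has_vector_derivative_add)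
qed simp

lemma diffk_mult:
  fixes f g :: "real \<Rightarrow> 'a::real_normed_algebra"
  shows "diffk n f \<Longrightarrow> diffk n g \<Longrightarrow> diffk n (\<lambda>x. f x * g x)"
proof (induction n arbitrary: f g)
  case (Suc n)
  then obtain f' g' where d: "\<forall>x. (f has_vector_derivative f' x) (at x)" "diffk n f'"
    "\<forall>x. (g has_vector_derivative g' x) (at x)" "diffk n g'" by auto
  have "diffk n (\<lambda>x. f x * g' x + f' x * g x)"
    by (intro diffk_add Suc.IH d diffk_SucD[OF Suc.prems(1)] diffk_SucD[OF Suc.prems(2)])
  with d show ?case
    by (auto intro!: exI[of _ "\<lambda>x. f x * g' x + f' x * g x"] has_vector_derivative_mult)
qed simp

lemma diffk_affine:
  fixes f :: "real \<Rightarrow> 'a::real_normed_algebra_1"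
  shows "diffk n f \<Longrightarrow> diffk n (\<lambda>x. f (a * x + b))"
proof (induction n arbitrary: f)
  case (Suc n)
  then obtain f' where d: "\<forall>x. (f has_vector_derivative f' x) (at x)" "diffk n f'" by auto
  have "((\<lambda>x. f (a * x + b)) has_vector_derivative of_real a * f' (a * x + b)) (at x)" for x
  proof -
    have "((\<lambda>x. a * x + b) has_vector_derivative a) (at x)"
      by (auto intro!: derivative_eq_intros simp flip: has_real_derivative_iff_has_vector_derivative)
    then have "((f \<circ> (\<lambda>x. a * x + b)) has_vector_derivative a *\<^sub>R f' (a * x + b)) (at x)"
      by (rule vector_diff_chain_at) (use d in blast)
    then show ?thesis by (simp add: o_def scaleR_conv_of_real)
  qed
  moreover have "diffk n (\<lambda>x. of_real a * f' (a * x + b))"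
    by (intro diffk_mult diffk_const Suc.IH d)
  ultimately show ?case by (rule diffk_SucI)
qed simp

lemma diffk_of_real: "diffk n f \<Longrightarrow> diffk n (\<lambda>x. of_real (f x) :: 'a::real_normed_algebra_1)"
proof (induction n arbitrary: f)
  case (Suc n)
  then obtain f' where d: "\<forall>x. (f has_vector_derivative f' x) (at x)" "diffk n f'" by auto
  show ?case
    by (rule diffk_SucI[OF has_vector_derivative_of_real Suc.IH[OF d(2)]])
      (use d(1) in \<open>simp add: has_real_derivative_iff_has_vector_derivative\<close>)
qed simp

lemma diffk_inverse:
  fixes f :: "real \<Rightarrow> real"
  assumes "\<And>x. f x \<noteq> 0"
  shows "diffk n f \<Longrightarrow> diffk n (\<lambda>x. inverse (f x))"
proof (induction n)
  case (Suc n)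
  then obtain f' where d: "\<forall>x. (f has_vector_derivative f' x) (at x)" "diffk n f'" by auto
  have "((\<lambda>x. inverse (f x)) has_vector_derivative (- 1) * (inverse (f x) * (f' x * inverse (f x)))) (at x)" for x
    using d(1) assms[of x]
    by (auto simp flip: has_real_derivative_iff_has_vector_derivative intro!: derivative_eq_intros)
  moreover have "diffk n (\<lambda>x. (- 1) * (inverse (f x) * (f' x * inverse (f x))))"
    by (intro diffk_mult diffk_const d Suc.IH diffk_SucD[OF Suc.prems])
  ultimately show ?case by (rule diffk_SucI)
qed simp

text \<open>The function \<open>exp (- (1 / t))\<close>, multiplied by powers of
  \<open>1 / t\<close> and extended by zero. With these powers the family is closed under
  differentiation up to linear combination, which makes smoothness an induction.\<close>

definition flat :: "nat \<Rightarrow> real \<Rightarrow> real" where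
  "flat k t = (if t > 0 then (1 / t) ^ k * exp (- (1 / t)) else 0)"

lemma flat_tendsto: "(flat k \<longlongrightarrow> 0) (at_right 0)"
proof -
  have "((\<lambda>s. s ^ k / exp s) \<longlongrightarrow> (0::real)) at_top" by (rule tendsto_power_div_exp_0)
  then have "((\<lambda>t. inverse t ^ k / exp (inverse t)) \<longlongrightarrow> (0::real)) (at_right 0)"
    using filterlim_inverse_at_top_right by (rule filterlim_compose)
  moreover have "\<forall>\<^sub>F t in at_right 0. inverse t ^ k / exp (inverse t) = flat k t"
    unfolding eventually_at_right_field
    by (intro exI[of _ 1]) (auto simp: flat_def divide_simps exp_minus)
  ultimately show ?thesis by (rule Lim_transform_eventually)
qed

lemma flat_derivative:
  "(flat k has_vector_derivative (- real k) * flat (k + 1) x + flat (k + 2) x) (at x)"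
proof (cases "x = 0")
  case False
  show ?thesis
  proof (cases "x > 0")
    case True
    have "((\<lambda>t. (1 / t) ^ k * exp (- (1 / t))) has_real_derivative (- real k) * flat (k + 1) x + flat (k + 2) x) (at x)"
    proof (rule DERIV_cong)
      have "((\<lambda>t. 1 / t) has_real_derivative - (1 / x * (1 / x))) (at x)"
        using True by (auto intro!: derivative_eq_intros)
      then show "((\<lambda>t. (1 / t) ^ k * exp (- (1 / t))) has_real_derivative
          real k * (- (1 / x * (1 / x)) * (1 / x) ^ (k - Suc 0)) * exp (- (1 / x))
          + exp (- (1 / x)) * - (- (1 / x * (1 / x))) * (1 / x) ^ k) (at x)"
        by (intro DERIV_mult DERIV_power DERIV_fun_exp DERIV_minus)
      have "real k * (- (a * a) * a ^ (k - Suc 0)) * e + e * - (- (a * a)) * a ^ k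
          = (- real k) * (a ^ (k + 1) * e) + a ^ (k + 2) * e" for a e :: real
        by (cases k) (simp_all add: algebra_simps)
      from this[of "1 / x" "exp (- (1 / x))"] True
      show "real k * (- (1 / x * (1 / x)) * (1 / x) ^ (k - Suc 0)) * exp (- (1 / x))
          + exp (- (1 / x)) * - (- (1 / x * (1 / x))) * (1 / x) ^ k
          = (- real k) * flat (k + 1) x + flat (k + 2) x"
        by (simp only: flat_def if_True)
    qed
    then have "(flat k has_real_derivative (- real k) * flat (k + 1) x + flat (k + 2) x) (at x)"
      by (rule DERIV_cong_ev[THEN iffD1, rotated -1])
        (use True in \<open>auto simp: flat_def eventually_nhds intro!: exI[of _ "{0<..}"]\<close>)
    then show ?thesis by (simp add: has_real_derivative_iff_has_vector_derivative)
  next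
    case x: False
    have "((\<lambda>t. 0) has_real_derivative (- real k) * flat (k + 1) x + flat (k + 2) x) (at x)"
      using x by (simp add: flat_def)
    then have "(flat k has_real_derivative (- real k) * flat (k + 1) x + flat (k + 2) x) (at x)"
      by (rule DERIV_cong_ev[THEN iffD1, rotated -1])
        (use x False in \<open>auto simp: flat_def eventually_nhds intro!: exI[of _ "{..<0}"]\<close>)
    then show ?thesis by (simp add: has_real_derivative_iff_has_vector_derivative)
  qed
next
  case True
  \<comment> \<open>At the origin the right difference quotient is \<open>flat (k + 1)\<close>,
    which tends to \<open>0\<close>, and the left one vanishes.\<close>
  have "((\<lambda>h. (flat k (0 + h) - flat k 0) / h) \<longlongrightarrow> 0) (at 0)"
  proof (rule filterlim_split_at)
    have "\<forall>\<^sub>F h in at_right 0. flat (k + 1) h = (flat k (0 + h) - flat k 0) / h"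
      unfolding eventually_at_right_field by (intro exI[of _ 1]) (auto simp: flat_def divide_simps)
    then show "((\<lambda>h. (flat k (0 + h) - flat k 0) / h) \<longlongrightarrow> 0) (at_right 0)"
      by (rule Lim_transform_eventually[OF flat_tendsto])
    have "\<forall>\<^sub>F h in at_left 0. 0 = (flat k (0 + h) - flat k 0) / h"
      unfolding eventually_at_left_field by (intro exI[of _ "-1"]) (auto simp: flat_def)
    then show "((\<lambda>h. (flat k (0 + h) - flat k 0) / h) \<longlongrightarrow> 0) (at_left 0)"
      by (rule Lim_transform_eventually[OF tendsto_const])
  qed
  then have "(flat k has_real_derivative 0) (at 0)" by (simp add: DERIV_def)
  then show ?thesis using True
    by (simp add: flat_def[of _ 0] has_real_derivative_iff_has_vector_derivative)
qed

lemma diffk_flat: "diffk n (flat k)"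
proof (induction n arbitrary: k)
  case (Suc n)
  have "diffk n (\<lambda>x. (- real k) * flat (k + 1) x + flat (k + 2) x)"
    by (intro diffk_add diffk_mult diffk_const Suc)
  with flat_derivative show ?case by (rule diffk_SucI)
qed simp

text \<open>The usual smooth transition from \<open>0\<close> to \<open>1\<close> over
  \<open>[0,1]\<close>; the denominator is positive because \<open>t\<close> and
  \<open>1 - t\<close> are never both nonpositive.\<close>

definition smooth_step :: "real \<Rightarrow> real" where
  "smooth_step t = flat 0 t * inverse (flat 0 t + flat 0 (1 - t))"

lemma flat_nonneg: "flat k t \<ge> 0" and flat_pos: "t > 0 \<Longrightarrow> flat k t > 0"
  by (auto simp: flat_def)

lemma flat_sum_pos: "flat 0 t + flat 0 (1 - t) > 0"
  using flat_pos[of t 0] flat_pos[of "1 - t" 0] flat_nonneg[of 0 t] flat_nonneg[of 0 "1 - t"]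
  by (cases "t > 0") (auto intro: add_pos_nonneg add_nonneg_pos)

lemma diffk_smooth_step: "diffk n smooth_step"
proof -
  have "diffk n (\<lambda>t. flat 0 ((-1) * t + 1))" by (rule diffk_affine) (rule diffk_flat)
  then have "diffk n (\<lambda>t. flat 0 (1 - t))" by simp
  then have "diffk n (\<lambda>t. flat 0 t * inverse (flat 0 t + flat 0 (1 - t)))"
    by (intro diffk_mult diffk_inverse diffk_add diffk_flat) (simp add: less_imp_neq[OF flat_sum_pos, symmetric])
  then show ?thesis by (simp add: smooth_step_def[abs_def])
qed

lemma smooth_step_01: "0 \<le> smooth_step t" "smooth_step t \<le> 1"
  using flat_sum_pos[of t] flat_nonneg[of 0 t] flat_nonneg[of 0 "1 - t"]
  by (auto simp: smooth_step_def field_simps)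

lemma smooth_step_0: "t \<le> 0 \<Longrightarrow> smooth_step t = 0" and smooth_step_1: "t \<ge> 1 \<Longrightarrow> smooth_step t = 1"
  using flat_pos[of t 0] by (auto simp: smooth_step_def flat_def)

lemma smooth_step_deriv:
  "\<exists>s' C. (\<forall>t. (smooth_step has_vector_derivative s' t) (at t)) \<and> continuous_on UNIV s' \<and>
     (\<forall>t. \<bar>s' t\<bar> \<le> C) \<and> (\<forall>t. t \<notin> {0..1} \<longrightarrow> s' t = 0)"
proof -
  \<comment> \<open>The second derivative makes the first one continuous, hence bounded on
    \<open>[0,1]\<close>.\<close>
  obtain s' s'' where s': "\<forall>t. (smooth_step has_vector_derivative s' t) (at t)"
    and s'': "\<forall>t. (s' has_vector_derivative s'' t) (at t)"
    using diffk_smooth_step[of "Suc (Suc 0)"] by auto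
  have cont: "continuous_on UNIV s'"
    by (rule continuous_on_vector_derivative) (use s'' in blast)
  have out: "s' t = 0" if t: "t \<notin> {0..1}" for t
  proof -
    define U :: "real set" and c :: real where "U = (if t < 0 then {..<0} else {1<..})" and "c = (if t < 0 then 0 else 1)"
    have "((\<lambda>t. c) has_vector_derivative s' t) (at t)"
    proof (rule has_vector_derivative_transform_within_open)
      show "(smooth_step has_vector_derivative s' t) (at t)" using s' by blast
      show "open U" "t \<in> U" using t by (auto simp: U_def)
      show "smooth_step x = c" if "x \<in> U" for x
        using that by (auto simp: U_def c_def smooth_step_0 smooth_step_1 split: if_splits)
    qed
    then show ?thesis using vector_derivative_unique_at[OF _ has_vector_derivative_const] by blast
  qed
  have "compact (s' ` {0..1})" by (intro compact_continuous_image continuous_on_subset[OF cont]) auto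
  then obtain C where "\<forall>y\<in>s' ` {0..1}. norm y \<le> C" using compact_imp_bounded by (metis bounded_iff)
  then have C: "\<bar>s' t\<bar> \<le> C" if "t \<in> {0..1}" for t using that by auto
  have "\<bar>s' t\<bar> \<le> C" for t
    using C[of t] out[of t] C[of 0] by (cases "t \<in> {0..1}") auto
  with s' cont out show ?thesis by blast
qed

text \<open>The offset \<open>5\<close> keeps \<open>4 * cut_width l j\<close> below
  \<open>l\<close> for every \<open>j\<close>, so that the layers of width
  \<open>2 * cut_width l j\<close> at the two ends are disjoint.\<close>

definition cut_width :: "real \<Rightarrow> nat \<Rightarrow> real" where "cut_width l j = l / (real j + 5)"

text \<open>Rises between one and two widths from the left end and falls symmetrically at the right
  end. The arguments are written as \<open>a * x + b\<close> to fit
  \<open>diffk_affine\<close>.\<close>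

definition cut :: "real \<Rightarrow> nat \<Rightarrow> real \<Rightarrow> real" where
  "cut l j x = smooth_step (1 / cut_width l j * x + - 1) * smooth_step (- 1 / cut_width l j * x + (l / cut_width l j - 1))"

lemma cut_width: assumes "l > 0" shows "cut_width l j > 0" "4 * cut_width l j < l"
  using assms by (auto simp: cut_width_def field_simps intro!: add_pos_nonneg mult_nonneg_nonneg)

lemma cut_width_tendsto: "(\<lambda>j. cut_width l j) \<longlonglongrightarrow> 0"
  unfolding cut_width_def
  by (intro real_tendsto_divide_at_top[OF tendsto_const] filterlim_at_top_mono[OF filterlim_real_sequentially]) simp

lemma diffk_cut: "diffk n (cut l j)"
  unfolding cut_def[abs_def] by (intro diffk_mult diffk_affine diffk_smooth_step)

lemma cut_arg:
  assumes "l > 0"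
  shows "1 / cut_width l j * x + - 1 = (x - cut_width l j) / cut_width l j"
    and "- 1 / cut_width l j * x + (l / cut_width l j - 1) = (l - cut_width l j - x) / cut_width l j"
  using cut_width(1)[OF assms, of j] by (simp_all add: diff_divide_distrib)

lemma cut_01: "0 \<le> cut l j x" "cut l j x \<le> 1"
  using smooth_step_01 by (auto simp: cut_def intro!: mult_nonneg_nonneg mult_le_one)

lemma cut_zero:
  assumes "l > 0" "x \<notin> {cut_width l j..l - cut_width l j}" shows "cut l j x = 0"
proof -
  have "1 / cut_width l j * x + - 1 \<le> 0 \<or> - 1 / cut_width l j * x + (l / cut_width l j - 1) \<le> 0"
    unfolding cut_arg[OF assms(1)] using assms cut_width[OF assms(1), of j] by (auto simp: divide_le_0_iff)
  then show ?thesis by (auto simp: cut_def smooth_step_0)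
qed

lemma cut_one:
  assumes "l > 0" "x \<in> {2 * cut_width l j..l - 2 * cut_width l j}" shows "cut l j x = 1"
proof -
  have "1 / cut_width l j * x + - 1 \<ge> 1" "- 1 / cut_width l j * x + (l / cut_width l j - 1) \<ge> 1"
    unfolding cut_arg[OF assms(1)] using assms cut_width[OF assms(1), of j] by (auto simp: le_divide_eq)
  then show ?thesis by (simp add: cut_def smooth_step_1)
qed

text \<open>The constant \<open>C\<close> does not depend on \<open>j\<close>: the slope grows at
  most like the inverse width, on a set whose length shrinks like the width. Both limit arguments at
  the boundary rest on this balance.\<close>

lemma cut_derivative:
  assumes l: "l > 0"
  shows "\<exists>cut' C. (\<forall>j x. (cut l j has_vector_derivative cut' j x) (at x)) \<and> (\<forall>j. continuous_on UNIV (cut' j)) \<and>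
     (\<forall>j x. \<bar>cut' j x\<bar> \<le> C / cut_width l j) \<and>
     (\<forall>j x. x \<notin> {0..2 * cut_width l j} \<and> x \<notin> {l - 2 * cut_width l j..l} \<longrightarrow> cut' j x = 0)"
proof -
  obtain s' C where s': "\<And>t. (smooth_step has_vector_derivative s' t) (at t)" "continuous_on UNIV s'"
    and C: "\<And>t. \<bar>s' t\<bar> \<le> C" and out: "\<And>t. t \<notin> {0..1} \<Longrightarrow> s' t = 0"
    using smooth_step_deriv by blast
  define L R where "L j x = 1 / cut_width l j * x + - 1"
    and "R j x = - 1 / cut_width l j * x + (l / cut_width l j - 1)" for j x
  define cut' where "cut' j x = smooth_step (L j x) * ((- 1 / cut_width l j) * s' (R j x))
     + ((1 / cut_width l j) * s' (L j x)) * smooth_step (R j x)" for j x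
  have comp: "((\<lambda>x. smooth_step (a * x + b)) has_vector_derivative a * s' (a * x + b)) (at x)" for a b x
  proof -
    have "((\<lambda>x. a * x + b) has_vector_derivative a) (at x)"
      by (auto intro!: derivative_eq_intros simp flip: has_real_derivative_iff_has_vector_derivative)
    from vector_diff_chain_at[OF this s'(1)] show ?thesis by (simp add: o_def)
  qed
  have "(cut l j has_vector_derivative cut' j x) (at x)" for j x
    unfolding cut_def[abs_def] cut'_def L_def R_def by (intro has_vector_derivative_mult comp)
  moreover have "continuous_on UNIV (cut' j)" for j
  proof -
    have s: "continuous_on UNIV smooth_step"
      by (rule continuous_on_vector_derivative[OF s'(1)])
    show ?thesis
      unfolding cut'_def[abs_def] L_def R_def
      by (intro continuous_intros continuous_on_compose2[OF s] continuous_on_compose2[OF s'(2)]) auto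
  qed
  moreover have "\<bar>cut' j x\<bar> \<le> 2 * C / cut_width l j" for j x
  proof -
    note w = cut_width(1)[OF l, of j]
    have 1: "\<bar>smooth_step (L j x) * ((- 1 / cut_width l j) * s' (R j x))\<bar> \<le> 1 * (1 / cut_width l j * C)"
      unfolding abs_mult by (intro mult_mono C) (use w smooth_step_01 C[of 0] in auto)
    have 2: "\<bar>((1 / cut_width l j) * s' (L j x)) * smooth_step (R j x)\<bar> \<le> (1 / cut_width l j * C) * 1"
      unfolding abs_mult by (intro mult_mono C) (use w smooth_step_01 C[of 0] in auto)
    have "\<bar>cut' j x\<bar> \<le> 1 * (1 / cut_width l j * C) + (1 / cut_width l j * C) * 1"
      unfolding cut'_def by (rule order_trans[OF abs_triangle_ineq add_mono[OF 1 2]])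
    then show ?thesis by simp
  qed
  moreover have "cut' j x = 0" if x: "x \<notin> {0..2 * cut_width l j} \<and> x \<notin> {l - 2 * cut_width l j..l}" for j x
  proof -
    note w = cut_width[OF l, of j]
    have "L j x \<notin> {0..1}" "R j x \<notin> {0..1}"
      unfolding L_def R_def cut_arg[OF l] using x w by (auto simp: zero_le_divide_iff divide_le_eq)
    then show ?thesis by (simp add: cut'_def out)
  qed
  ultimately show ?thesis by blast
qed

text \<open>The inequalities are strict because the derivative of the cutoff is only known to vanish
  off the closed layers.\<close>

lemma cut_tendsto_1:
  assumes "x \<in> {0<..<l}" shows "\<forall>\<^sub>F j in sequentially. x \<in> {2 * cut_width l j<..<l - 2 * cut_width l j}"
proof -
  have "(\<lambda>j. 2 * cut_width l j) \<longlonglongrightarrow> 2 * 0" by (intro tendsto_intros cut_width_tendsto)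
  then have t: "(\<lambda>j. 2 * cut_width l j) \<longlonglongrightarrow> 0" by simp
  have "\<forall>\<^sub>F j in sequentially. 2 * cut_width l j < x" "\<forall>\<^sub>F j in sequentially. 2 * cut_width l j < l - x"
    by (rule order_tendstoD(2)[OF t]; use assms in simp)+
  then show ?thesis by eventually_elim auto
qed

subsection \<open>Test functions and weak derivatives\<close>

lemma diffk_imp_funpow_differentiable:
  "diffk (Suc n) \<phi> \<Longrightarrow> (vderiv ^^ n) \<phi> differentiable (at x)"
proof (induction n arbitrary: \<phi>)
  case 0
  then obtain f' where "\<forall>x. (\<phi> has_vector_derivative f' x) (at x)" by auto
  then show ?case by (auto intro: differentiableI_vector)
next
  case (Suc n)
  then obtain f' where f': "\<forall>x. (\<phi> has_vector_derivative f' x) (at x)" "diffk (Suc n) f'" by auto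
  then have "vderiv \<phi> = f'" by (auto simp: vderiv_def vector_derivative_at)
  then show ?case using Suc.IH[OF f'(2)] by (simp add: funpow_swap1)
qed

lemma test_funI:
  assumes "\<And>n. diffk n \<phi>" "0 < a" "b < l" "\<And>x. x \<notin> {a..b} \<Longrightarrow> \<phi> x = 0"
  shows "\<phi> \<in> test_fun l"
proof -
  have "(vderiv ^^ n) \<phi> differentiable (at x)" for n x
    by (rule diffk_imp_funpow_differentiable[OF assms(1)])
  moreover have "\<exists>a b. 0 < a \<and> b < l \<and> (\<forall>x. x \<notin> {a..b} \<longrightarrow> \<phi> x = 0)"
    using assms(2-4) by (intro exI[of _ a] exI[of _ b]) simp
  ultimately show ?thesis unfolding test_fun_def by simp
qed

lemma test_fun_derivative:
  assumes "\<phi> \<in> test_fun l"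
  shows "(\<phi> has_vector_derivative vderiv \<phi> x) (at x)" "continuous_on UNIV (vderiv \<phi>)" "continuous_on UNIV \<phi>"
    "x \<notin> {0<..<l} \<Longrightarrow> \<phi> x = 0" "x \<notin> {0<..<l} \<Longrightarrow> vderiv \<phi> x = 0"
proof -
  have d: "(vderiv ^^ n) \<phi> differentiable (at x)" for n x using assms by (auto simp: test_fun_def)
  show der: "(\<phi> has_vector_derivative vderiv \<phi> x) (at x)" for x
    using d[of 0 x] by (simp add: vderiv_def vector_derivative_works)
  show "continuous_on UNIV (vderiv \<phi>)"
    using d[of 1] by (auto intro!: continuous_at_imp_continuous_on differentiable_imp_continuous_within)
  show "continuous_on UNIV \<phi>"
    using d[of 0] by (auto intro!: continuous_at_imp_continuous_on differentiable_imp_continuous_within)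
  obtain a b where ab: "0 < a" "b < l" "\<And>x. x \<notin> {a..b} \<Longrightarrow> \<phi> x = 0"
    using assms by (auto simp: test_fun_def)
  show "\<phi> x = 0" if "x \<notin> {0<..<l}" using ab that by auto
  show "vderiv \<phi> x = 0" if x: "x \<notin> {0<..<l}"
  proof -
    have "((\<lambda>_. 0) has_vector_derivative vderiv \<phi> x) (at x)"
      by (rule has_vector_derivative_transform_within_open[OF der, of "- {a..b}"]) (use ab x in auto)
    then show ?thesis using vector_derivative_unique_at[OF _ has_vector_derivative_const] by blast
  qed
qed

text \<open>\<open>is_wderiv\<close> pairs without conjugation while \<open>cinner\<close>
  conjugates its second argument; invariance of the test functions under conjugation reconciles the
  two.\<close>

lemma test_fun_cnj:
  assumes "\<phi> \<in> test_fun l"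
  shows "(\<lambda>x. cnj (\<phi> x)) \<in> test_fun l" "vderiv (\<lambda>x. cnj (\<phi> x)) = (\<lambda>x. cnj (vderiv \<phi> x))"
proof -
  have d: "(vderiv ^^ n) \<phi> differentiable (at x)" for n x using assms by (auto simp: test_fun_def)
  have c: "vderiv (\<lambda>x. cnj (f x)) = (\<lambda>x. cnj (vderiv f x)) \<and> (\<forall>x. (\<lambda>x. cnj (f x)) differentiable (at x))"
    if "\<And>x. f differentiable (at x)" for f
  proof -
    have "((\<lambda>x. cnj (f x)) has_vector_derivative cnj (vderiv f x)) (at x)" for x
      using bounded_linear.has_vector_derivative[OF bounded_linear_cnj, of f] that[of x]
      by (simp add: vderiv_def vector_derivative_works)
    then show ?thesis by (auto simp: vderiv_def vector_derivative_at intro: differentiableI_vector)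
  qed
  show "vderiv (\<lambda>x. cnj (\<phi> x)) = (\<lambda>x. cnj (vderiv \<phi> x))" using c[of \<phi>] d[of 0] by simp
  have f: "(vderiv ^^ n) (\<lambda>x. cnj (\<phi> x)) = (\<lambda>x. cnj ((vderiv ^^ n) \<phi> x))" for n
    by (induction n) (use c d in auto)
  have "(vderiv ^^ n) (\<lambda>x. cnj (\<phi> x)) differentiable (at x)" for n x
    unfolding f using c d by blast
  then show "(\<lambda>x. cnj (\<phi> x)) \<in> test_fun l" using assms by (auto simp: test_fun_def)
qed

lemma test_fun_L2of:
  assumes "\<phi> \<in> test_fun l"
  shows "abs_L2 \<phi> = L2of l \<phi>" "abs_L2 (vderiv \<phi>) = L2of l (vderiv \<phi>)"
  using test_fun_derivative(4,5)[OF assms] unfolding L2of_def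
  by (auto intro!: arg_cong[of _ _ abs_L2] simp: restr_def fun_eq_iff)

text \<open>In this form both sides are continuous in \<open>u\<close> and \<open>g\<close>, so weak
  differentiation becomes a closed relation.\<close>

lemma is_wderiv_iff:
  "is_wderiv l u g \<longleftrightarrow> u \<in> L2_on l \<and> g \<in> L2_on l \<and>
     (\<forall>\<phi>\<in>test_fun l. cinner u (L2of l (vderiv \<phi>)) = - cinner g (L2of l \<phi>))"
proof -
  have "(LINT x:{0<..<l}|lborel. rep_L2 w x * f x) = cinner w (L2of l (\<lambda>x. cnj (f x)))"
    if "w \<in> L2_on l" "continuous_on UNIV f" for w f
  proof -
    have [measurable]: "f \<in> borel_measurable borel" by (rule borel_measurable_continuous_onI[OF that(2)])
    have "sq_int (restr l (\<lambda>x. cnj (f x)))" by (intro sq_int_restr continuous_intros that)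
    then show ?thesis by (simp add: cinner_L2of that set_LINT_rep)
  qed
  note key = this
  have "(LINT x:{0<..<l}|lborel. rep_L2 u x * vderiv \<phi> x) = - (LINT x:{0<..<l}|lborel. rep_L2 g x * \<phi> x)
     \<longleftrightarrow> cinner u (L2of l (vderiv (\<lambda>x. cnj (\<phi> x)))) = - cinner g (L2of l (\<lambda>x. cnj (\<phi> x)))"
    if "u \<in> L2_on l" "g \<in> L2_on l" "\<phi> \<in> test_fun l" for \<phi>
    using that by (simp add: key test_fun_derivative(2,3)[OF that(3)] test_fun_cnj)
  note key2 = this
  have cc: "(\<lambda>x. cnj (cnj (\<phi> x))) = \<phi>" for \<phi> :: "real \<Rightarrow> complex" by simp
  show ?thesis
    unfolding is_wderiv_def
  proof (intro conj_cong refl iffI ballI)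
    fix \<phi> assume a: "u \<in> L2_on l" "g \<in> L2_on l" "\<phi> \<in> test_fun l"
      "\<forall>\<phi>\<in>test_fun l. (LINT x:{0<..<l}|lborel. rep_L2 u x * vderiv \<phi> x) = - (LINT x:{0<..<l}|lborel. rep_L2 g x * \<phi> x)"
    show "cinner u (L2of l (vderiv \<phi>)) = - cinner g (L2of l \<phi>)"
      using key2[OF a(1,2) test_fun_cnj(1)[OF a(3)]] a(4) test_fun_cnj(1)[OF a(3)] unfolding cc by blast
  next
    fix \<phi> assume a: "u \<in> L2_on l" "g \<in> L2_on l" "\<phi> \<in> test_fun l"
      "\<forall>\<phi>\<in>test_fun l. cinner u (L2of l (vderiv \<phi>)) = - cinner g (L2of l \<phi>)"
    show "(LINT x:{0<..<l}|lborel. rep_L2 u x * vderiv \<phi> x) = - (LINT x:{0<..<l}|lborel. rep_L2 g x * \<phi> x)"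
      using key2[OF a(1,2,3)] a(4) test_fun_cnj(1)[OF a(3)] by blast
  qed
qed

text \<open>Closedness of the weak derivative; it allows Fourier series to be differentiated term by
  term.\<close>

lemma is_wderiv_limit:
  assumes "\<And>j. is_wderiv l (u j) (g j)" "u \<longlonglongrightarrow> u0" "g \<longlonglongrightarrow> g0"
  shows "is_wderiv l u0 g0"
  unfolding is_wderiv_iff
proof (intro conjI ballI)
  have "u j \<in> L2_on l" "g j \<in> L2_on l" for j
    using assms(1)[of j] by (simp_all add: is_wderiv_iff)
  then show "u0 \<in> L2_on l" "g0 \<in> L2_on l"
    using closed_sequentially[OF closed_L2_on _ assms(2)] closed_sequentially[OF closed_L2_on _ assms(3)]
    by simp_all
  fix \<phi> assume "\<phi> \<in> test_fun l"
  then have "cinner (u j) (L2of l (vderiv \<phi>)) = - cinner (g j) (L2of l \<phi>)" for j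
    using assms(1) by (auto simp: is_wderiv_iff)
  moreover have "(\<lambda>j. cinner (u j) (L2of l (vderiv \<phi>))) \<longlonglongrightarrow> cinner u0 (L2of l (vderiv \<phi>))"
    "(\<lambda>j. - cinner (g j) (L2of l \<phi>)) \<longlonglongrightarrow> - cinner g0 (L2of l \<phi>)"
    by (intro tendsto_minus tendsto_cinner_left assms)+
  ultimately show "cinner u0 (L2of l (vderiv \<phi>)) = - cinner g0 (L2of l \<phi>)"
    using LIMSEQ_unique by simp
qed

lemma is_wderiv_add: "is_wderiv l u g \<Longrightarrow> is_wderiv l v h \<Longrightarrow> is_wderiv l (u + v) (g + h)"
  by (auto simp: is_wderiv_iff L2_on_add cinner_add_left)

lemma is_wderiv_cscale: "is_wderiv l u g \<Longrightarrow> is_wderiv l (cscale c u) (cscale c g)"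
  by (auto simp: is_wderiv_iff L2_on_cscale cinner_cscale_left)

lemma is_wderiv_zero: "is_wderiv l 0 0"
proof -
  have "(0::L2) \<in> L2_on l" using L2of_in[OF sq_int_one, of l] L2_on_cscale[of "oneL l" l "of_real 0"]
    by (simp add: oneL_def cscale_of_real del: of_real_0)
  then show ?thesis by (simp add: is_wderiv_iff)
qed

lemma is_wderiv_sum: "(\<And>i. i \<in> A \<Longrightarrow> is_wderiv l (u i) (g i)) \<Longrightarrow> is_wderiv l (\<Sum>i\<in>A. u i) (\<Sum>i\<in>A. g i)"
  by (induction A rule: infinite_finite_induct) (auto intro: is_wderiv_add is_wderiv_zero)

lemma L2of_tendsto:
  assumes meas: "\<And>j. f j \<in> borel_measurable borel" "g \<in> borel_measurable borel"
    and bnd: "\<And>j x. x \<in> {0<..<l} \<Longrightarrow> cmod (f j x) \<le> C"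
    and lim: "\<And>x. x \<in> {0<..<l} \<Longrightarrow> (\<lambda>j. f j x) \<longlonglongrightarrow> g x"
  shows "(\<lambda>j. L2of l (f j)) \<longlonglongrightarrow> L2of l g"
proof -
  have [measurable]: "f j \<in> borel_measurable borel" "g \<in> borel_measurable borel" for j using meas by auto
  have gb: "cmod (g x) \<le> C" if "x \<in> {0<..<l}" for x
    by (rule LIMSEQ_le_const2[OF tendsto_norm[OF lim[OF that]]]) (use bnd that in blast)
  have sq: "sq_int (restr l (f j))" "sq_int (restr l g)" for j
    by (intro sq_int_restr_bounded[where C=C] bnd gb meas; assumption)+
  have "(norm (L2of l (f j) - L2of l g))\<^sup>2 = (LINT x|lborel. (cmod (restr l (f j) x - restr l g x))\<^sup>2)" for j
    unfolding L2of_def by (simp add: minus_abs sq sq_int_diff norm_abs_sq)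
  moreover have "(\<lambda>j. LINT x|lborel. (cmod (restr l (f j) x - restr l g x))\<^sup>2) \<longlonglongrightarrow> (LINT x::real|lborel. (0::real))"
  proof (rule integral_dominated_convergence[where w="\<lambda>x. indicator {0<..<l} x * (2 * C)\<^sup>2"])
    show "integrable lborel (\<lambda>x. indicator {0<..<l} x * (2 * C)\<^sup>2)"
      by (intro integrable_mult_left integrable_real_indicator; cases "0 \<le> l") auto
    show "AE x in lborel. (\<lambda>j. (cmod (restr l (f j) x - restr l g x))\<^sup>2) \<longlonglongrightarrow> 0"
    proof (rule AE_I2)
      fix x
      have "(\<lambda>j. (cmod (restr l (f j) x - restr l g x))\<^sup>2) \<longlonglongrightarrow> (cmod (restr l g x - restr l g x))\<^sup>2"
        by (intro tendsto_intros) (use lim in \<open>auto simp: restr_def\<close>)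
      then show "(\<lambda>j. (cmod (restr l (f j) x - restr l g x))\<^sup>2) \<longlonglongrightarrow> 0" by simp
    qed
    show "AE x in lborel. norm ((cmod (restr l (f j) x - restr l g x))\<^sup>2) \<le> indicator {0<..<l} x * (2 * C)\<^sup>2" for j
    proof (rule AE_I2)
      fix x
      show "norm ((cmod (restr l (f j) x - restr l g x))\<^sup>2) \<le> indicator {0<..<l} x * (2 * C)\<^sup>2"
      proof (cases "x \<in> {0<..<l}")
        case True
        have "cmod (f j x - g x) \<le> 2 * C"
          using norm_triangle_ineq4[of "f j x" "g x"] bnd[OF True, of j] gb[OF True] by linarith
        then have "(cmod (f j x - g x))\<^sup>2 \<le> (2 * C)\<^sup>2" by (intro power_mono) auto
        then show ?thesis using True by (simp add: restr_def)
      qed (auto simp: restr_def)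
    qed
  qed measurable
  ultimately have "(\<lambda>j. (norm (L2of l (f j) - L2of l g))\<^sup>2) \<longlonglongrightarrow> 0" by simp
  then have "(\<lambda>j. norm (L2of l (f j) - L2of l g)) \<longlonglongrightarrow> 0"
    using tendsto_real_sqrt[of "\<lambda>j. (norm (L2of l (f j) - L2of l g))\<^sup>2" 0] by simp
  then show ?thesis by (rule tendsto_norm_zero_cancel[THEN LIM_zero_cancel])
qed

lemma cut_test_fun:
  assumes l: "l > 0" and "\<And>n. diffk n \<psi>" shows "(\<lambda>x. of_real (cut l j x) * \<psi> x) \<in> test_fun l"
  by (rule test_funI[where a="cut_width l j" and b="l - cut_width l j"])
    (use assms cut_width[OF l, of j] cut_zero[OF l, of _ j] in
      \<open>auto intro!: diffk_mult diffk_of_real diffk_cut\<close>)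

lemma cut_L2of_tendsto:
  assumes l: "l > 0" and c: "continuous_on UNIV \<psi>"
  shows "(\<lambda>j. L2of l (\<lambda>x. of_real (cut l j x) * \<psi> x)) \<longlonglongrightarrow> L2of l \<psi>"
proof -
  have "compact (\<psi> ` {0..l})" by (intro compact_continuous_image continuous_on_subset[OF c]) auto
  then obtain C where C: "\<forall>y\<in>\<psi> ` {0..l}. cmod y \<le> C" using compact_imp_bounded by (metis bounded_iff)
  have cc: "continuous_on UNIV (cut l j)" for j
  proof -
    obtain f' where "\<forall>x. (cut l j has_vector_derivative f' x) (at x)"
      using diffk_cut[of "Suc 0" l j] by auto
    then show ?thesis by (intro continuous_on_vector_derivative) blast
  qed
  show ?thesis
  proof (rule L2of_tendsto[where C=C])
    fix j x assume x: "x \<in> {0<..<l}"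
    have "cmod (of_real (cut l j x) * \<psi> x) \<le> 1 * C"
      unfolding norm_mult by (intro mult_mono) (use cut_01[of l j x] C x in auto)
    then show "cmod (of_real (cut l j x) * \<psi> x) \<le> C" by simp
  next
    fix x assume x: "x \<in> {0<..<l}"
    have "\<forall>\<^sub>F j in sequentially. of_real (cut l j x) * \<psi> x = \<psi> x"
      using cut_tendsto_1[OF x] by eventually_elim (use cut_one[OF l, of x] in auto)
    then show "(\<lambda>j. of_real (cut l j x) * \<psi> x) \<longlonglongrightarrow> \<psi> x" by (rule tendsto_eventually)
  qed (auto intro!: borel_measurable_continuous_onI continuous_intros cc c)
qed

lemma diffk_trig: "diffk n (sinf l k)" "diffk n (cosf l k)"
proof -
  \<comment> \<open>Generalised to all combinations of sine and cosine, a family closed under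
    differentiation.\<close>
  have "diffk n (\<lambda>x. of_real a * of_real (sin (w * x)) + of_real b * of_real (cos (w * x)) :: complex)" for a b w
  proof (induction n arbitrary: a b)
    case (Suc n)
    have "((\<lambda>x. a * sin (w * x) + b * cos (w * x)) has_real_derivative (- b * w) * sin (w * x) + (a * w) * cos (w * x)) (at x)" for x
      by (auto intro!: derivative_eq_intros)
    then have "((\<lambda>x. of_real (a * sin (w * x) + b * cos (w * x)) :: complex) has_vector_derivative
        of_real ((- b * w) * sin (w * x) + (a * w) * cos (w * x))) (at x)" for x
      by (intro has_vector_derivative_of_real) (simp add: has_real_derivative_iff_has_vector_derivative)
    from diffk_SucI[OF this] show ?case using Suc[of "- b * w" "a * w"] by (simp only: of_real_add of_real_mult)
  qed simp
  from this[of "sqrt (2 / l)" "wave l k" 0] this[of 0 "wave l k" "sqrt (2 / l)"]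
  show "diffk n (sinf l k)" "diffk n (cosf l k)"
    unfolding sinf_def[abs_def] cosf_def[abs_def] by simp_all
qed

text \<open>Products of cutoffs and sines are test functions, so completeness of the sines takes the place of
  the fundamental lemma of the calculus of variations.\<close>

lemma is_wderiv_unique:
  assumes l: "l > 0" and "is_wderiv l u g" "is_wderiv l u h" shows "g = h"
proof -
  have gh: "g - h \<in> L2_on l"
    using assms hilbert_basis.diff_in[OF sine_basis[OF l]] by (auto simp: is_wderiv_iff)
  have "cinner (g - h) (sL l n) = 0" for n
  proof -
    have "cinner (g - h) (L2of l (\<lambda>x. of_real (cut l j x) * sinf l n x)) = 0" for j
    proof -
      let ?\<phi> = "\<lambda>x. of_real (cut l j x) * sinf l n x"
      have "?\<phi> \<in> test_fun l" by (rule cut_test_fun[OF l diffk_trig(1)])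
      then have "- cinner g (L2of l ?\<phi>) = - cinner h (L2of l ?\<phi>)"
        using assms(2,3) unfolding is_wderiv_iff by metis
      then show ?thesis by (simp add: cinner_diff_left)
    qed
    moreover have "(\<lambda>j. cinner (g - h) (L2of l (\<lambda>x. of_real (cut l j x) * sinf l n x))) \<longlonglongrightarrow> cinner (g - h) (sL l n)"
      unfolding sL_def by (intro tendsto_cinner_right cut_L2of_tendsto l continuous_sinf)
    ultimately show ?thesis by (simp add: LIMSEQ_const_iff)
  qed
  then have "g - h = 0" by (rule sine_total[OF l gh])
  then show ?thesis by simp
qed

lemma wderiv_eq: "l > 0 \<Longrightarrow> is_wderiv l u g \<Longrightarrow> wderiv l u = g"
  unfolding wderiv_def by (rule the_equality) (auto intro: is_wderiv_unique)

lemma H1_wderiv: "l > 0 \<Longrightarrow> u \<in> H1 l \<Longrightarrow> is_wderiv l u (wderiv l u)"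
  using wderiv_eq by (auto simp: H1_def)

lemma L2of_by_parts:
  assumes l: "l > 0" and f: "\<And>x. (f has_vector_derivative f' x) (at x)" "continuous_on UNIV f'"
    and g: "\<And>x. (g has_vector_derivative g' x) (at x)" "continuous_on UNIV g'"
  shows "cinner (L2of l f) (L2of l g') = f l * cnj (g l) - f 0 * cnj (g 0) - cinner (L2of l f') (L2of l g)"
proof -
  have cf: "continuous_on UNIV f" and cg: "continuous_on UNIV g"
    by (rule continuous_on_vector_derivative[OF f(1)], rule continuous_on_vector_derivative[OF g(1)])
  note sq = sq_int_restr[OF cf] sq_int_restr[OF cg] sq_int_restr[OF f(2)] sq_int_restr[OF g(2)]
  have "has_bochner_integral lborel (restr l (\<lambda>x. f x * cnj (g' x) + f' x * cnj (g x)))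
     (f l * cnj (g l) - f 0 * cnj (g 0))"
    by (rule integral_restr_FTC[OF l])
      (auto intro!: has_vector_derivative_mult f bounded_linear.has_vector_derivative[OF bounded_linear_cnj] g
        continuous_intros cf cg)
  then have "f l * cnj (g l) - f 0 * cnj (g 0) = (LINT x|lborel. restr l (\<lambda>x. f x * cnj (g' x) + f' x * cnj (g x)) x)"
    by (simp add: has_bochner_integral_integral_eq)
  also have "\<dots> = (LINT x|lborel. restr l f x * cnj (restr l g' x) + restr l f' x * cnj (restr l g x))"
    by (intro Bochner_Integration.integral_cong) (auto simp: restr_def)
  also have "\<dots> = cinner (L2of l f) (L2of l g') + cinner (L2of l f') (L2of l g)"
    unfolding L2of_def by (simp add: cinner_abs sq sq_int_mult_integrable Bochner_Integration.integral_add)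
  finally show ?thesis by simp
qed

subsection \<open>Weak derivatives in terms of Fourier coefficients\<close>

lemma L2of_zero: "L2of l (\<lambda>_. 0) = 0"
  unfolding L2of_def zero_abs by (intro arg_cong[of _ _ abs_L2]) (simp add: restr_def fun_eq_iff)

lemma L2of_cscale: "sq_int (restr l f) \<Longrightarrow> L2of l (\<lambda>x. c * f x) = cscale c (L2of l f)"
  unfolding L2of_def by (subst cscale_abs) (auto intro!: arg_cong[of _ _ abs_L2] simp: restr_def fun_eq_iff)

lemma L2of_add: "sq_int (restr l f) \<Longrightarrow> sq_int (restr l g) \<Longrightarrow> L2of l (\<lambda>x. f x + g x) = L2of l f + L2of l g"
  unfolding L2of_def by (subst plus_abs) (auto intro!: arg_cong[of _ _ abs_L2] simp: restr_def fun_eq_iff)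

section \<open>Linear structure of test functions and the closure of the graph of their
  derivative\<close>

lemma test_fun_diffk:
  assumes "\<phi> \<in> test_fun l" shows "diffk n \<phi>"
proof -
  have d: "(vderiv ^^ n) \<phi> differentiable (at x)" for n x using assms by (auto simp: test_fun_def)
  have "diffk n ((vderiv ^^ m) \<phi>)" for m
  proof (induction n arbitrary: m)
    case (Suc n)
    have "((vderiv ^^ m) \<phi> has_vector_derivative (vderiv ^^ Suc m) \<phi> x) (at x)" for x
      using d[of m x] by (simp add: vderiv_def vector_derivative_works)
    then show ?case using Suc[of "Suc m"] by (rule diffk_SucI)
  qed simp
  from this[of 0] show ?thesis by simp
qed

lemma test_fun_support:
  assumes "\<phi> \<in> test_fun l"
  obtains a b where "0 < a" "b < l" "\<And>x. x \<notin> {a..b} \<Longrightarrow> \<phi> x = 0"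
  using assms unfolding test_fun_def by blast

lemma test_fun_add:
  assumes "\<phi> \<in> test_fun l" "\<psi> \<in> test_fun l"
  shows "(\<lambda>x. \<phi> x + \<psi> x) \<in> test_fun l" "vderiv (\<lambda>x. \<phi> x + \<psi> x) = (\<lambda>x. vderiv \<phi> x + vderiv \<psi> x)"
proof -
  obtain a b where 1: "0 < a" "b < l" "\<And>x. x \<notin> {a..b} \<Longrightarrow> \<phi> x = 0"
    using test_fun_support[OF assms(1)] by blast
  obtain a' b' where 2: "0 < a'" "b' < l" "\<And>x. x \<notin> {a'..b'} \<Longrightarrow> \<psi> x = 0"
    using test_fun_support[OF assms(2)] by blast
  show "(\<lambda>x. \<phi> x + \<psi> x) \<in> test_fun l"
  proof (rule test_funI)
    show "diffk n (\<lambda>x. \<phi> x + \<psi> x)" for n by (intro diffk_add test_fun_diffk[of _ l] assms)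
    show "0 < min a a'" "max b b' < l" using 1 2 by auto
    show "\<phi> x + \<psi> x = 0" if "x \<notin> {min a a'..max b b'}" for x
    proof -
      have "x \<notin> {a..b}" "x \<notin> {a'..b'}" using that by auto
      from 1(3)[OF this(1)] 2(3)[OF this(2)] show ?thesis by simp
    qed
  qed
  show "vderiv (\<lambda>x. \<phi> x + \<psi> x) = (\<lambda>x. vderiv \<phi> x + vderiv \<psi> x)"
    unfolding vderiv_def[of "\<lambda>x. \<phi> x + \<psi> x"]
    by (intro ext vector_derivative_at has_vector_derivative_add test_fun_derivative(1)[of _ l] assms)
qed

lemma test_fun_cmult:
  assumes "\<phi> \<in> test_fun l"
  shows "(\<lambda>x. c * \<phi> x) \<in> test_fun l" "vderiv (\<lambda>x. c * \<phi> x) = (\<lambda>x. c * vderiv \<phi> x)"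
proof -
  obtain a b where 1: "0 < a" "b < l" "\<And>x. x \<notin> {a..b} \<Longrightarrow> \<phi> x = 0"
    using test_fun_support[OF assms] by blast
  show "(\<lambda>x. c * \<phi> x) \<in> test_fun l"
    by (rule test_funI[OF _ 1(1,2)]) (use 1(3) in \<open>auto intro!: diffk_mult diffk_const test_fun_diffk[OF assms]\<close>)
  show "vderiv (\<lambda>x. c * \<phi> x) = (\<lambda>x. c * vderiv \<phi> x)"
    unfolding vderiv_def[of "\<lambda>x. c * \<phi> x"]
    by (intro ext vector_derivative_at has_vector_derivative_mult_right test_fun_derivative(1)[OF assms])
qed

lemma sq_int_test_fun:
  assumes "\<phi> \<in> test_fun l" shows "sq_int (restr l \<phi>)" "sq_int (restr l (vderiv \<phi>))"
  by (intro sq_int_restr test_fun_derivative[OF assms])+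

text \<open>The approximation clause of \<open>H10\<close> with the derivative \<open>g\<close> as a
  free argument. As a relation between \<open>u\<close> and \<open>g\<close> it is linear and
  closed; \<open>wderiv l u\<close> is inserted for \<open>g\<close> only at the end.\<close>

definition near_test :: "real \<Rightarrow> L2 \<Rightarrow> L2 \<Rightarrow> bool" where
  "near_test l u g \<longleftrightarrow> (\<forall>\<epsilon>>0. \<exists>\<phi>\<in>test_fun l. norm (u - L2of l \<phi>) < \<epsilon> \<and> norm (g - L2of l (vderiv \<phi>)) < \<epsilon>)"

lemma near_test_iff:
  "near_test l u g \<longleftrightarrow> (\<exists>\<phi>. (\<forall>j. \<phi> j \<in> test_fun l) \<and> (\<lambda>j. L2of l (\<phi> j)) \<longlonglongrightarrow> u \<and> (\<lambda>j. L2of l (vderiv (\<phi> j))) \<longlonglongrightarrow> g)"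
proof
  assume n: "near_test l u g"
  have *: "\<exists>\<phi>\<in>test_fun l. norm (u - L2of l \<phi>) < inverse (real (Suc j)) \<and> norm (g - L2of l (vderiv \<phi>)) < inverse (real (Suc j))" for j
    by (rule n[unfolded near_test_def, rule_format]) simp
  have "\<forall>j. \<exists>\<phi>. \<phi> \<in> test_fun l \<and> norm (u - L2of l \<phi>) < inverse (real (Suc j)) \<and>
      norm (g - L2of l (vderiv \<phi>)) < inverse (real (Suc j))"
    using * by blast
  from choice[OF this] obtain \<phi> where \<phi>: "\<forall>j. \<phi> j \<in> test_fun l \<and> norm (u - L2of l (\<phi> j)) < inverse (real (Suc j)) \<and>
      norm (g - L2of l (vderiv (\<phi> j))) < inverse (real (Suc j))" by (rule exE)
  have "(\<lambda>j. L2of l (\<phi> j) - u) \<longlonglongrightarrow> 0"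
    by (rule Lim_null_comparison[OF always_eventually LIMSEQ_inverse_real_of_nat])
      (use \<phi> in \<open>simp add: norm_minus_commute less_imp_le\<close>)
  moreover have "(\<lambda>j. L2of l (vderiv (\<phi> j)) - g) \<longlonglongrightarrow> 0"
    by (rule Lim_null_comparison[OF always_eventually LIMSEQ_inverse_real_of_nat])
      (use \<phi> in \<open>simp add: norm_minus_commute less_imp_le\<close>)
  ultimately have "(\<lambda>j. L2of l (\<phi> j)) \<longlonglongrightarrow> u" "(\<lambda>j. L2of l (vderiv (\<phi> j))) \<longlonglongrightarrow> g"
    by (simp_all only: LIM_zero_iff)
  then show "\<exists>\<phi>. (\<forall>j. \<phi> j \<in> test_fun l) \<and> (\<lambda>j. L2of l (\<phi> j)) \<longlonglongrightarrow> u \<and> (\<lambda>j. L2of l (vderiv (\<phi> j))) \<longlonglongrightarrow> g"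
    using \<phi> by blast
next
  assume "\<exists>\<phi>. (\<forall>j. \<phi> j \<in> test_fun l) \<and> (\<lambda>j. L2of l (\<phi> j)) \<longlonglongrightarrow> u \<and> (\<lambda>j. L2of l (vderiv (\<phi> j))) \<longlonglongrightarrow> g"
  then obtain \<phi> where \<phi>: "\<And>j. \<phi> j \<in> test_fun l" "(\<lambda>j. L2of l (\<phi> j)) \<longlonglongrightarrow> u" "(\<lambda>j. L2of l (vderiv (\<phi> j))) \<longlonglongrightarrow> g" by blast
  show "near_test l u g"
    unfolding near_test_def
  proof (intro allI impI)
    fix \<epsilon> :: real assume "\<epsilon> > 0"
    then have "\<forall>\<^sub>F j in sequentially. dist (L2of l (\<phi> j)) u < \<epsilon>" "\<forall>\<^sub>F j in sequentially. dist (L2of l (vderiv (\<phi> j))) g < \<epsilon>"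
      using \<phi>(2,3) by (simp_all add: tendstoD)
    then have "\<forall>\<^sub>F j in sequentially. norm (u - L2of l (\<phi> j)) < \<epsilon> \<and> norm (g - L2of l (vderiv (\<phi> j))) < \<epsilon>"
      by eventually_elim (simp add: dist_norm norm_minus_commute)
    then obtain j where "norm (u - L2of l (\<phi> j)) < \<epsilon> \<and> norm (g - L2of l (vderiv (\<phi> j))) < \<epsilon>"
      using eventually_happens'[OF sequentially_bot] by blast
    then show "\<exists>\<phi>\<in>test_fun l. norm (u - L2of l \<phi>) < \<epsilon> \<and> norm (g - L2of l (vderiv \<phi>)) < \<epsilon>"
      using \<phi>(1) by blast
  qed
qed

lemma near_test_add:
  assumes "near_test l u g" "near_test l v h" shows "near_test l (u + v) (g + h)"
proof -
  obtain \<phi> where \<phi>: "\<And>j. \<phi> j \<in> test_fun l" "(\<lambda>j. L2of l (\<phi> j)) \<longlonglongrightarrow> u" "(\<lambda>j. L2of l (vderiv (\<phi> j))) \<longlonglongrightarrow> g"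
    using assms(1) unfolding near_test_iff by blast
  obtain \<psi> where \<psi>: "\<And>j. \<psi> j \<in> test_fun l" "(\<lambda>j. L2of l (\<psi> j)) \<longlonglongrightarrow> v" "(\<lambda>j. L2of l (vderiv (\<psi> j))) \<longlonglongrightarrow> h"
    using assms(2) unfolding near_test_iff by blast
  show ?thesis
    unfolding near_test_iff
    by (rule exI[of _ "\<lambda>j x. \<phi> j x + \<psi> j x"])
      (auto simp: test_fun_add[OF \<phi>(1) \<psi>(1)] \<phi>(1) \<psi>(1) L2of_add sq_int_test_fun intro!: tendsto_add \<phi> \<psi>)
qed

lemma near_test_cscale:
  assumes "near_test l u g" shows "near_test l (cscale c u) (cscale c g)"
proof -
  obtain \<phi> where \<phi>: "\<And>j. \<phi> j \<in> test_fun l" "(\<lambda>j. L2of l (\<phi> j)) \<longlonglongrightarrow> u" "(\<lambda>j. L2of l (vderiv (\<phi> j))) \<longlonglongrightarrow> g"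
    using assms unfolding near_test_iff by blast
  have lin: "bounded_linear (cscale c)"
  proof (rule bounded_linear_intro[where K="cmod c"])
    show "cscale c (x + y) = cscale c x + cscale c y" for x y
      by transfer (simp add: ae_eq_def distrib_left sq_int_add sq_int_cmult)
    show "cscale c (r *\<^sub>R x) = r *\<^sub>R cscale c x" for r x
      by transfer (simp add: ae_eq_def sq_int_scaleR sq_int_cmult)
  qed (simp add: norm_cscale)
  show ?thesis
    unfolding near_test_iff
    by (rule exI[of _ "\<lambda>j x. c * \<phi> j x"])
      (auto simp: test_fun_cmult[OF \<phi>(1)] \<phi>(1) L2of_cscale sq_int_test_fun intro!: bounded_linear.tendsto[OF lin] \<phi>)
qed

lemma near_test_limit:
  assumes "\<And>j. near_test l (u j) (g j)" "u \<longlonglongrightarrow> u0" "g \<longlonglongrightarrow> g0"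
  shows "near_test l u0 g0"
  unfolding near_test_def
proof (intro allI impI)
  fix \<epsilon> :: real assume "\<epsilon> > 0"
  then have "\<epsilon> / 2 > 0" by simp
  then have "\<forall>\<^sub>F j in sequentially. dist (u j) u0 < \<epsilon> / 2" "\<forall>\<^sub>F j in sequentially. dist (g j) g0 < \<epsilon> / 2"
    using assms(2,3) by (simp_all only: tendstoD)
  then have "\<forall>\<^sub>F j in sequentially. dist (u j) u0 < \<epsilon> / 2 \<and> dist (g j) g0 < \<epsilon> / 2"
    by eventually_elim simp
  then obtain j where j: "dist (u j) u0 < \<epsilon> / 2" "dist (g j) g0 < \<epsilon> / 2"
    using eventually_happens'[OF sequentially_bot] by blast
  obtain \<phi> where \<phi>: "\<phi> \<in> test_fun l" "norm (u j - L2of l \<phi>) < \<epsilon> / 2" "norm (g j - L2of l (vderiv \<phi>)) < \<epsilon> / 2"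
    using assms(1)[of j] \<open>\<epsilon> / 2 > 0\<close> unfolding near_test_def by blast
  have "norm (u0 - L2of l \<phi>) < \<epsilon>" "norm (g0 - L2of l (vderiv \<phi>)) < \<epsilon>"
    using dist_triangle_half_r[OF j(1), of "L2of l \<phi>"] dist_triangle_half_r[OF j(2), of "L2of l (vderiv \<phi>)"] \<phi>(2,3)
    by (simp_all add: dist_norm)
  with \<phi>(1) show "\<exists>\<phi>\<in>test_fun l. norm (u0 - L2of l \<phi>) < \<epsilon> \<and> norm (g0 - L2of l (vderiv \<phi>)) < \<epsilon>" by blast
qed

lemma H10_iff: "u \<in> H10 l \<longleftrightarrow> u \<in> H1 l \<and> near_test l u (wderiv l u)"
  unfolding H10_def near_test_def by (auto simp: test_fun_L2of)

lemma trig_derivative: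
  "(sinf l n has_vector_derivative of_real (wave l n) * cosf l n x) (at x)"
  "(cosf l n has_vector_derivative of_real (- wave l n) * sinf l n x) (at x)"
proof -
  have "((\<lambda>x. sqrt (2 / l) * sin (wave l n * x)) has_real_derivative wave l n * (sqrt (2 / l) * cos (wave l n * x))) (at x)"
    "((\<lambda>x. sqrt (2 / l) * cos (wave l n * x)) has_real_derivative (- wave l n) * (sqrt (2 / l) * sin (wave l n * x))) (at x)"
    by (auto intro!: derivative_eq_intros)
  from this[THEN has_vector_derivative_of_real, where 'a=complex]
  show "(sinf l n has_vector_derivative of_real (wave l n) * cosf l n x) (at x)"
    "(cosf l n has_vector_derivative of_real (- wave l n) * sinf l n x) (at x)"
    unfolding sinf_def[abs_def] cosf_def[abs_def] by (simp_all only: of_real_mult)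
qed

lemma sinf_0: "sinf l n 0 = 0" and sinf_l: "l > 0 \<Longrightarrow> sinf l n l = 0"
  using sin_npi[of "Suc n"] by (simp_all add: sinf_def wave_def)

lemma cut_mult_derivative:
  assumes "\<And>x. (cut l j has_vector_derivative c' x) (at x)" "\<And>x. (\<psi> has_vector_derivative \<psi>' x) (at x)"
  shows "vderiv (\<lambda>x. of_real (cut l j x) * \<psi> x) = (\<lambda>x. of_real (cut l j x) * \<psi>' x + of_real (c' x) * \<psi> x)"
  unfolding vderiv_def
proof (intro ext vector_derivative_at has_vector_derivative_mult assms)
  show "((\<lambda>x. of_real (cut l j x) :: complex) has_vector_derivative of_real (c' x)) (at x)" for x
    by (intro has_vector_derivative_of_real) (simp add: has_real_derivative_iff_has_vector_derivative assms)
qed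

locale interval = fixes l :: real assumes l_pos: "l > 0"
begin

sublocale S: hilbert_basis "L2_on l" "sL l" by (rule sine_basis[OF l_pos])
sublocale C: hilbert_basis "L2_mean0 l" "cL l" by (rule cosine_basis[OF l_pos])

lemma mean0_on: "v \<in> L2_mean0 l \<Longrightarrow> v \<in> L2_on l" by (simp add: L2_mean0_iff)

lemma wave_gt0: "wave l n > 0" by (rule wave_pos[OF l_pos])

lemma L2of_wave_cosf: "L2of l (\<lambda>x. of_real r * cosf l n x) = r *\<^sub>R cL l n"
  and L2of_wave_sinf: "L2of l (\<lambda>x. of_real r * sinf l n x) = r *\<^sub>R sL l n"
  by (simp_all add: L2of_cscale sq_int_cosf sq_int_sinf cL_def sL_def cscale_of_real)

text \<open>Integration by parts against a cosine, a sine and the constant; the test function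
  removes the boundary terms in all three cases.\<close>

lemma test_coef:
  assumes "\<phi> \<in> test_fun l"
  shows "C.coef (L2of l (vderiv \<phi>)) n = of_real (wave l n) * S.coef (L2of l \<phi>) n"
    and "S.coef (L2of l (vderiv \<phi>)) n = - of_real (wave l n) * C.coef (L2of l \<phi>) n"
    and "L2of l (vderiv \<phi>) \<in> L2_mean0 l"
proof -
  note d = test_fun_derivative[OF assms]
  have "0 = cinner (L2of l (vderiv \<phi>)) (cL l n) + cinner (L2of l \<phi>) ((- wave l n) *\<^sub>R sL l n)"
    using L2of_by_parts[OF l_pos d(1,2) trig_derivative(2)[of l n]]
    by (simp add: continuous_intros continuous_sinf d(4) L2of_wave_sinf cL_def del: of_real_minus)
  then show "C.coef (L2of l (vderiv \<phi>)) n = of_real (wave l n) * S.coef (L2of l \<phi>) n"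
    by (simp add: C.coef_def S.coef_def cinner_scaleR_right cinner_minus_right)
  have "0 = cinner (L2of l (vderiv \<phi>)) (sL l n) + cinner (L2of l \<phi>) (wave l n *\<^sub>R cL l n)"
    using L2of_by_parts[OF l_pos d(1,2) trig_derivative(1)[of l n]]
    by (simp add: continuous_intros continuous_cosf d(4) L2of_wave_cosf sL_def)
  then show "S.coef (L2of l (vderiv \<phi>)) n = - of_real (wave l n) * C.coef (L2of l \<phi>) n"
    by (simp add: C.coef_def S.coef_def cinner_scaleR_right eq_neg_iff_add_eq_0)
  have "0 = cinner (L2of l (vderiv \<phi>)) (oneL l) + cinner (L2of l \<phi>) (L2of l (\<lambda>_. 0))"
    using L2of_by_parts[OF l_pos d(1,2), of "\<lambda>_. 1" "\<lambda>_. 0"]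
    by (simp add: d(4) oneL_def)
  then show "L2of l (vderiv \<phi>) \<in> L2_mean0 l"
    by (simp add: L2of_zero L2_mean0_iff L2of_in sq_int_test_fun[OF assms])
qed

lemma is_wderiv_sL: "is_wderiv l (sL l n) (wave l n *\<^sub>R cL l n)"
  and is_wderiv_cL: "is_wderiv l (cL l n) ((- wave l n) *\<^sub>R sL l n)"
proof -
  have S: "sL l n \<in> L2_on l" "cL l n \<in> L2_on l" using S.basis_in C.basis_in mean0_on by auto
  have b: "cinner (L2of l f) (L2of l (vderiv \<phi>)) = - cinner (L2of l f') (L2of l \<phi>)"
    if "\<phi> \<in> test_fun l" "\<And>x. (f has_vector_derivative f' x) (at x)" "continuous_on UNIV f'" for \<phi> f f'
    using L2of_by_parts[OF l_pos that(2,3) test_fun_derivative(1,2)[OF that(1)]]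
    by (simp add: test_fun_derivative(4)[OF that(1)])
  show "is_wderiv l (sL l n) (wave l n *\<^sub>R cL l n)"
    unfolding is_wderiv_iff L2of_wave_cosf[symmetric]
    using b[OF _ trig_derivative(1)[of l n]] S S.scaleR_in[OF S(2)]
    by (simp add: sL_def L2of_wave_cosf continuous_intros continuous_cosf)
  show "is_wderiv l (cL l n) ((- wave l n) *\<^sub>R sL l n)"
    unfolding is_wderiv_iff L2of_wave_sinf[symmetric]
    using b[OF _ trig_derivative(2)[of l n]] S S.scaleR_in[OF S(1), of "- wave l n"]
    by (simp add: cL_def L2of_wave_sinf continuous_intros continuous_sinf del: of_real_minus scaleR_minus_left)
qed

lemma cscale_cscale: "cscale c (cscale d u) = cscale (c * d) u"
  by transfer (simp add: ae_eq_def mult.assoc sq_int_cmult)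

lemma cscale_scaleR: "cscale c (r *\<^sub>R u) = cscale (of_real r * c) u"
  unfolding cscale_of_real[symmetric] cscale_cscale by (simp only: mult.commute)

text \<open>The weighted summability makes the differentiated series converge in the cosine basis,
  and the weak derivative is a closed relation.\<close>

lemma sine_series_wderiv:
  assumes "u \<in> L2_on l" "summable (\<lambda>n. (wave l n * cmod (S.coef u n))\<^sup>2)"
  shows "is_wderiv l u (C.synth (\<lambda>n. of_real (wave l n) * S.coef u n))"
proof -
  have s: "summable (\<lambda>n. (cmod (of_real (wave l n) * S.coef u n))\<^sup>2)"
    using assms(2) wave_gt0 by (simp add: norm_mult abs_of_pos)
  show ?thesis
  proof (rule is_wderiv_limit)
    show "(\<lambda>N. \<Sum>n<N. cscale (S.coef u n) (sL l n)) \<longlonglongrightarrow> u" by (rule S.expansion_tendsto[OF assms(1)])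
    show "(\<lambda>N. \<Sum>n<N. cscale (of_real (wave l n) * S.coef u n) (cL l n)) \<longlonglongrightarrow> C.synth (\<lambda>n. of_real (wave l n) * S.coef u n)"
      using has_sum_imp_sums[OF C.synth(1)[OF s]] by (simp add: sums_def)
    show "is_wderiv l (\<Sum>n<N. cscale (S.coef u n) (sL l n)) (\<Sum>n<N. cscale (of_real (wave l n) * S.coef u n) (cL l n))" for N
      by (intro is_wderiv_sum) (use is_wderiv_cscale[OF is_wderiv_sL] in \<open>simp add: cscale_scaleR\<close>)
  qed
qed

lemma cosine_series_wderiv:
  assumes "v \<in> L2_mean0 l" "summable (\<lambda>n. (wave l n * cmod (C.coef v n))\<^sup>2)"
  shows "is_wderiv l v (S.synth (\<lambda>n. of_real (- wave l n) * C.coef v n))"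
proof -
  have s: "summable (\<lambda>n. (cmod (of_real (- wave l n) * C.coef v n))\<^sup>2)"
    using assms(2) wave_gt0 by (simp add: norm_mult abs_of_pos)
  show ?thesis
  proof (rule is_wderiv_limit)
    show "(\<lambda>N. \<Sum>n<N. cscale (C.coef v n) (cL l n)) \<longlonglongrightarrow> v" by (rule C.expansion_tendsto[OF assms(1)])
    show "(\<lambda>N. \<Sum>n<N. cscale (of_real (- wave l n) * C.coef v n) (sL l n)) \<longlonglongrightarrow> S.synth (\<lambda>n. of_real (- wave l n) * C.coef v n)"
      using has_sum_imp_sums[OF S.synth(1)[OF s]] by (simp add: sums_def)
    show "is_wderiv l (\<Sum>n<N. cscale (C.coef v n) (cL l n)) (\<Sum>n<N. cscale (of_real (- wave l n) * C.coef v n) (sL l n))" for N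
      by (intro is_wderiv_sum) (use is_wderiv_cscale[OF is_wderiv_cL] in \<open>simp only: cscale_scaleR\<close>)
  qed
qed

text \<open>Passes to the limit from test functions, whose boundary terms vanish; for a general
  element of \<open>H1\<close> the cosine coefficients of the derivative would see the boundary
  values.\<close>

lemma H10_coef:
  assumes "u \<in> H10 l"
  shows "wderiv l u \<in> L2_mean0 l" "C.coef (wderiv l u) n = of_real (wave l n) * S.coef u n"
proof -
  obtain \<phi> where \<phi>: "\<And>j. \<phi> j \<in> test_fun l" "(\<lambda>j. L2of l (\<phi> j)) \<longlonglongrightarrow> u" "(\<lambda>j. L2of l (vderiv (\<phi> j))) \<longlonglongrightarrow> wderiv l u"
    using assms unfolding H10_iff near_test_iff by blast
  show "wderiv l u \<in> L2_mean0 l"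
    by (rule closed_sequentially[OF C.closed_space _ \<phi>(3)]) (rule test_coef(3)[OF \<phi>(1)])
  have "(\<lambda>j. C.coef (L2of l (vderiv (\<phi> j))) n) \<longlonglongrightarrow> C.coef (wderiv l u) n"
    by (rule bounded_linear.tendsto[OF C.bounded_linear_coef \<phi>(3)])
  moreover have "(\<lambda>j. of_real (wave l n) * S.coef (L2of l (\<phi> j)) n) \<longlonglongrightarrow> of_real (wave l n) * S.coef u n"
    by (intro tendsto_mult tendsto_const bounded_linear.tendsto[OF S.bounded_linear_coef \<phi>(2)])
  ultimately show "C.coef (wderiv l u) n = of_real (wave l n) * S.coef u n"
    using LIMSEQ_unique by (simp add: test_coef(1)[OF \<phi>(1)])
qed

text \<open>The sine vanishes at the end points but lacks compact support, so it is multiplied by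
  cutoffs. The dangerous term is the cutoff derivative times the sine: the first is of the order of
  the inverse width, the second of the order of the width wherever the first is nonzero, so the
  product stays bounded and tends to zero pointwise.\<close>

lemma near_test_sL: "near_test l (sL l n) (wave l n *\<^sub>R cL l n)"
proof -
  obtain c' K where c': "\<And>j x. (cut l j has_vector_derivative c' j x) (at x)" "\<And>j. continuous_on UNIV (c' j)"
    and K: "\<And>j x. \<bar>c' j x\<bar> \<le> K / cut_width l j"
    and out: "\<And>j x. x \<notin> {0..2 * cut_width l j} \<and> x \<notin> {l - 2 * cut_width l j..l} \<Longrightarrow> c' j x = 0"
    using cut_derivative[OF l_pos] by metis
  have K0: "K \<ge> 0" using K[of 0 0] cut_width(1)[OF l_pos, of 0]
    by (smt (verit) divide_less_0_iff)
  have ct: "continuous_on UNIV (cut l j)" for j by (rule continuous_on_vector_derivative[OF c'(1)])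
  define \<phi> where "\<phi> j x = of_real (cut l j x) * sinf l n x" for j x
  define B where "B = sqrt (2 / l)"
  have B0: "B \<ge> 0" using l_pos by (simp add: B_def)
  have v: "vderiv (\<phi> j) = (\<lambda>x. of_real (cut l j x) * (of_real (wave l n) * cosf l n x) + of_real (c' j x) * sinf l n x)" for j
    unfolding \<phi>_def[abs_def] by (rule cut_mult_derivative[OF c'(1) trig_derivative(1)])
  have cb: "cmod (cosf l n x) \<le> B" for x
    using B0 by (simp add: cosf_def norm_mult B_def[symmetric] mult_left_le abs_of_nonneg)
  have lip: "cmod (sinf l n x - sinf l n y) \<le> wave l n * B * \<bar>x - y\<bar>" for x y
  proof -
    have "norm (sinf l n x - sinf l n y) \<le> wave l n * B * norm (x - y)"
    proof (rule differentiable_bound[of UNIV])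
      show "(sinf l n has_derivative (\<lambda>h. h *\<^sub>R (of_real (wave l n) * cosf l n x))) (at x within UNIV)" for x
        using trig_derivative(1)[of l n x] by (simp add: has_vector_derivative_def)
      show "onorm (\<lambda>h. h *\<^sub>R (of_real (wave l n) * cosf l n x)) \<le> wave l n * B" for x
        by (rule onorm_le) (use cb[of x] wave_gt0[of n] in \<open>simp add: norm_mult abs_of_pos mult.commute mult_left_mono\<close>)
    qed auto
    then show ?thesis by simp
  qed
  \<comment> \<open>\<open>K / cut_width l j\<close> times the Lipschitz constant
    \<open>wave l n * B\<close> over a distance of at most \<open>2 * cut_width l j\<close>; the
    width cancels.\<close>
  have small: "cmod (of_real (c' j x) * sinf l n x) \<le> 2 * K * wave l n * B" if x: "x \<in> {0<..<l}" for j x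
  proof (cases "x \<in> {0..2 * cut_width l j} \<or> x \<in> {l - 2 * cut_width l j..l}")
    case True
    have "cmod (sinf l n x) \<le> wave l n * B * (2 * cut_width l j)"
    proof -
      have wB: "wave l n * B \<ge> 0" using wave_gt0[of n] B0 by simp
      from True show ?thesis
      proof
        assume "x \<in> {0..2 * cut_width l j}"
        then have "wave l n * B * \<bar>x - 0\<bar> \<le> wave l n * B * (2 * cut_width l j)"
          by (intro mult_left_mono wB) auto
        then show ?thesis using lip[of x 0] by (simp add: sinf_0)
      next
        assume "x \<in> {l - 2 * cut_width l j..l}"
        then have "wave l n * B * \<bar>x - l\<bar> \<le> wave l n * B * (2 * cut_width l j)"
          by (intro mult_left_mono wB) auto
        then show ?thesis using lip[of x l] by (simp add: sinf_l l_pos)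
      qed
    qed
    then have "\<bar>c' j x\<bar> * cmod (sinf l n x) \<le> (K / cut_width l j) * (wave l n * B * (2 * cut_width l j))"
      using K0 cut_width(1)[OF l_pos, of j] by (intro mult_mono K) auto
    also have "\<dots> = 2 * K * wave l n * B" using cut_width(1)[OF l_pos, of j] by simp
    finally show ?thesis by (simp add: norm_mult)
  next
    case False
    then have "c' j x = 0" using out by blast
    then show ?thesis using K0 B0 wave_gt0[of n] by simp
  qed
  have "(\<lambda>j. L2of l (vderiv (\<phi> j))) \<longlonglongrightarrow> L2of l (\<lambda>x. of_real (wave l n) * cosf l n x)"
  proof (rule L2of_tendsto[where C="wave l n * B + 2 * K * wave l n * B"])
    show "vderiv (\<phi> j) \<in> borel_measurable borel" for j
      unfolding v by (intro borel_measurable_continuous_onI continuous_intros ct c' continuous_sinf continuous_cosf)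
    show "(\<lambda>x. of_real (wave l n) * cosf l n x) \<in> borel_measurable borel" by measurable
    fix x assume x: "x \<in> {0<..<l}"
    have 1: "cmod (of_real (cut l j x) * (of_real (wave l n) * cosf l n x)) \<le> 1 * (wave l n * B)" for j
      unfolding norm_mult using cut_01[of l j x] wave_gt0[of n] cb[of x] B0 by (intro mult_mono) auto
    show "cmod (vderiv (\<phi> j) x) \<le> wave l n * B + 2 * K * wave l n * B" for j
      unfolding v by (rule order_trans[OF norm_triangle_ineq add_mono[OF 1[unfolded mult_1] small[OF x]]])
    have "\<forall>\<^sub>F j in sequentially. vderiv (\<phi> j) x = of_real (wave l n) * cosf l n x"
      using cut_tendsto_1[OF x] by eventually_elim (use out cut_one[OF l_pos, of x] in \<open>auto simp: v\<close>)
    then show "(\<lambda>j. vderiv (\<phi> j) x) \<longlonglongrightarrow> of_real (wave l n) * cosf l n x" by (rule tendsto_eventually)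
  qed
  moreover have "(\<lambda>j. L2of l (\<phi> j)) \<longlonglongrightarrow> sL l n"
    unfolding \<phi>_def[abs_def] sL_def by (rule cut_L2of_tendsto[OF l_pos continuous_sinf])
  moreover have "\<phi> j \<in> test_fun l" for j
    unfolding \<phi>_def[abs_def] by (rule cut_test_fun[OF l_pos diffk_trig(1)])
  ultimately show ?thesis unfolding near_test_iff L2of_wave_cosf by blast
qed

text \<open>Sines together with their derivatives are limits of test functions, so the defining
  identity of a weak derivative may be tested against them, whatever the boundary values of
  \<open>g\<close>.\<close>

lemma wderiv_sine_coef:
  assumes "is_wderiv l g h"
  shows "S.coef h n = - of_real (wave l n) * C.coef g n"
proof -
  obtain \<phi> where \<phi>: "\<And>j. \<phi> j \<in> test_fun l" "(\<lambda>j. L2of l (\<phi> j)) \<longlonglongrightarrow> sL l n"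
    "(\<lambda>j. L2of l (vderiv (\<phi> j))) \<longlonglongrightarrow> wave l n *\<^sub>R cL l n"
    using near_test_sL unfolding near_test_iff by blast
  have "cinner g (L2of l (vderiv (\<phi> j))) = - cinner h (L2of l (\<phi> j))" for j
    using assms \<phi>(1) by (simp add: is_wderiv_iff)
  moreover have "(\<lambda>j. cinner g (L2of l (vderiv (\<phi> j)))) \<longlonglongrightarrow> cinner g (wave l n *\<^sub>R cL l n)"
    "(\<lambda>j. - cinner h (L2of l (\<phi> j))) \<longlonglongrightarrow> - cinner h (sL l n)"
    by (intro tendsto_minus tendsto_cinner_right \<phi>)+
  ultimately have "cinner g (wave l n *\<^sub>R cL l n) = - cinner h (sL l n)"
    using LIMSEQ_unique by simp
  then show ?thesis by (simp add: S.coef_def C.coef_def cinner_scaleR_right)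
qed

lemma near_test_sum: "(\<And>i. i < N \<Longrightarrow> near_test l (u i) (g i)) \<Longrightarrow> near_test l (\<Sum>i<N. u i) (\<Sum>i<(N::nat). g i)"
proof (induction N)
  case 0
  show ?case using near_test_cscale[OF near_test_sL, of "of_real 0"] by (simp only: cscale_of_real scaleR_zero_left lessThan_0 sum.empty)
qed (auto intro: near_test_add)

lemma sine_series_H10:
  assumes "u \<in> L2_on l" "summable (\<lambda>n. (wave l n * cmod (S.coef u n))\<^sup>2)"
  shows "u \<in> H10 l"
proof -
  have s: "summable (\<lambda>n. (cmod (of_real (wave l n) * S.coef u n))\<^sup>2)"
    using assms(2) wave_gt0 by (simp add: norm_mult abs_of_pos)
  have w: "is_wderiv l u (C.synth (\<lambda>n. of_real (wave l n) * S.coef u n))" by (rule sine_series_wderiv[OF assms])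
  have "near_test l u (C.synth (\<lambda>n. of_real (wave l n) * S.coef u n))"
  proof (rule near_test_limit)
    show "(\<lambda>N. \<Sum>n<N. cscale (S.coef u n) (sL l n)) \<longlonglongrightarrow> u" by (rule S.expansion_tendsto[OF assms(1)])
    show "(\<lambda>N. \<Sum>n<N. cscale (of_real (wave l n) * S.coef u n) (cL l n)) \<longlonglongrightarrow> C.synth (\<lambda>n. of_real (wave l n) * S.coef u n)"
      using has_sum_imp_sums[OF C.synth(1)[OF s]] by (simp add: sums_def)
    show "near_test l (\<Sum>n<N. cscale (S.coef u n) (sL l n)) (\<Sum>n<N. cscale (of_real (wave l n) * S.coef u n) (cL l n))" for N
      by (intro near_test_sum) (use near_test_cscale[OF near_test_sL] in \<open>simp add: cscale_scaleR\<close>)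
  qed
  then show ?thesis using w by (auto simp: H10_iff H1_def wderiv_eq[OF l_pos w])
qed

text \<open>The derivatives of the cutoffs are bounded in \<open>L\<^sup>1\<close> and concentrate at the end points, where \<open>g\<close>
  vanishes; hence they do not contribute in the limit.\<close>

lemma zero_trace_by_parts:
  assumes w: "is_wderiv l g h" and z: "zero_trace l g" and smooth: "\<And>n. diffk n \<psi>"
    and d: "\<And>x. (\<psi> has_vector_derivative \<psi>' x) (at x)" "continuous_on UNIV \<psi>'"
  shows "cinner h (L2of l \<psi>) = - cinner g (L2of l \<psi>')"
proof -
  obtain c' K where c': "\<And>j x. (cut l j has_vector_derivative c' j x) (at x)" "\<And>j. continuous_on UNIV (c' j)"
    and K: "\<And>j x. \<bar>c' j x\<bar> \<le> K / cut_width l j"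
    and out: "\<And>j x. x \<notin> {0..2 * cut_width l j} \<and> x \<notin> {l - 2 * cut_width l j..l} \<Longrightarrow> c' j x = 0"
    using cut_derivative[OF l_pos] by metis
  have K0: "K \<ge> 0" using K[of 0 0] cut_width(1)[OF l_pos, of 0]
    by (smt (verit) divide_less_0_iff)
  have gL: "g \<in> L2_on l" using w by (simp add: is_wderiv_iff)
  have ct: "continuous_on UNIV (cut l j)" for j by (rule continuous_on_vector_derivative[OF c'(1)])
  have cpsi: "continuous_on UNIV \<psi>" by (rule continuous_on_vector_derivative[OF d(1)])
  have "compact (\<psi> ` {0..l})" by (intro compact_continuous_image continuous_on_subset[OF cpsi]) auto
  then obtain B where "\<forall>y\<in>\<psi> ` {0..l}. cmod y \<le> B" using compact_imp_bounded by (metis bounded_iff)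
  then have B: "\<And>x. x \<in> {0..l} \<Longrightarrow> cmod (\<psi> x) \<le> B" by blast
  have B0: "B \<ge> 0" using order_trans[OF norm_ge_zero B[of 0]] l_pos by simp
  obtain f where f: "continuous_on {0..l} f" "AE x in lborel. x \<in> {0<..<l} \<longrightarrow> rep_L2 g x = f x" "f 0 = 0" "f l = 0"
    using z unfolding zero_trace_def by blast
  define \<phi> where "\<phi> j x = of_real (cut l j x) * \<psi> x" for j x
  have v: "vderiv (\<phi> j) = (\<lambda>x. of_real (cut l j x) * \<psi>' x + of_real (c' j x) * \<psi> x)" for j
    unfolding \<phi>_def[abs_def] by (rule cut_mult_derivative[OF c'(1) d(1)])
  have test: "\<phi> j \<in> test_fun l" for j unfolding \<phi>_def[abs_def] by (rule cut_test_fun[OF l_pos smooth])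
  have c1: "continuous_on UNIV (\<lambda>x. of_real (cut l j x) * \<psi>' x)" and c2: "continuous_on UNIV (\<lambda>x. of_real (c' j x) * \<psi> x)" for j
    by (intro continuous_intros ct c' cpsi d)+
  have bdry: "(\<lambda>j. cinner g (L2of l (\<lambda>x. of_real (c' j x) * \<psi> x))) \<longlonglongrightarrow> 0"
  proof (rule tendstoI)
    fix e :: real assume e: "e > 0"
    \<comment> \<open>Two layers of length \<open>2 * W\<close>, a slope of at most
      \<open>K / W\<close> and the bound \<open>B\<close> on \<open>\<psi>\<close> give the error
      \<open>4 * B * K * \<eta>\<close>; the added \<open>1\<close> avoids division by zero.\<close>
    define \<eta> where "\<eta> = e / (4 * B * K + 1)"
    have BK: "4 * B * K \<ge> 0" using B0 K0 by simp
    have \<eta>: "\<eta> > 0" "4 * B * K * \<eta> < e" using e BK by (simp_all add: \<eta>_def field_simps)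
    obtain \<delta>1 where \<delta>1: "\<delta>1 > 0" "\<And>x. x \<in> {0..l} \<Longrightarrow> dist x 0 < \<delta>1 \<Longrightarrow> dist (f x) (f 0) < \<eta>"
      using f(1) \<eta>(1) l_pos unfolding continuous_on_iff by (metis atLeastAtMost_iff less_imp_le order_refl)
    obtain \<delta>2 where \<delta>2: "\<delta>2 > 0" "\<And>x. x \<in> {0..l} \<Longrightarrow> dist x l < \<delta>2 \<Longrightarrow> dist (f x) (f l) < \<eta>"
      using f(1) \<eta>(1) l_pos unfolding continuous_on_iff by (metis atLeastAtMost_iff less_imp_le order_refl)
    have "min \<delta>1 \<delta>2 / 2 > 0" using \<delta>1(1) \<delta>2(1) by simp
    from order_tendstoD(2)[OF cut_width_tendsto[of l] this]
    show "\<forall>\<^sub>F j in sequentially. dist (cinner g (L2of l (\<lambda>x. of_real (c' j x) * \<psi> x))) 0 < e"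
    proof eventually_elim
      fix j assume j: "cut_width l j < min \<delta>1 \<delta>2 / 2"
      define W where "W = cut_width l j"
      have W: "W > 0" "4 * W < l" "2 * W < \<delta>1" "2 * W < \<delta>2"
        using cut_width[OF l_pos, of j] j by (auto simp: W_def)
      let ?h = "\<lambda>x. (indicator {0..2 * W} x + indicator {l - 2 * W..l} x) * (\<eta> * (K / W * B))"
      have meas: "(\<lambda>x. of_real (c' j x) * \<psi> x) \<in> borel_measurable borel"
        by (rule borel_measurable_continuous_onI[OF c2])
      have sq: "sq_int (restr l (\<lambda>x. of_real (c' j x) * \<psi> x))" by (rule sq_int_restr[OF c2])
      have "cinner g (L2of l (\<lambda>x. of_real (c' j x) * \<psi> x)) = (LINT x|lborel. rep_L2 g x * cnj (of_real (c' j x) * \<psi> x))"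
        by (rule cinner_L2of[OF gL meas sq])
      also have "cmod \<dots> \<le> (LINT x|lborel. cmod (rep_L2 g x * cnj (of_real (c' j x) * \<psi> x)))"
        by (rule integral_norm_bound)
      also have "\<dots> \<le> (LINT x|lborel. ?h x)"
      proof (rule integral_mono_AE)
        show "integrable lborel (\<lambda>x. cmod (rep_L2 g x * cnj (of_real (c' j x) * \<psi> x)))"
          by (intro integrable_norm integrable_rep_mult_on[OF gL meas sq])
        show "integrable lborel ?h"
          using W by (intro integrable_mult_left Bochner_Integration.integrable_add integrable_real_indicator) auto
        show "AE x in lborel. cmod (rep_L2 g x * cnj (of_real (c' j x) * \<psi> x)) \<le> ?h x"
          using f(2) gL[unfolded L2_on_iff]
        proof eventually_elim
          fix x assume x: "x \<in> {0<..<l} \<longrightarrow> rep_L2 g x = f x" "x \<notin> {0<..<l} \<longrightarrow> rep_L2 g x = 0"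
          have h0: "?h x \<ge> 0" using \<eta> K0 B0 W by simp
          show "cmod (rep_L2 g x * cnj (of_real (c' j x) * \<psi> x)) \<le> ?h x"
          proof (cases "x \<in> {0<..<l} \<and> (x \<in> {0..2 * W} \<or> x \<in> {l - 2 * W..l})")
            case True
            have "cmod (f x) \<le> \<eta>"
            proof (cases "x \<in> {0..2 * W}")
              case in0: True
              have "x \<in> {0..l}" using True by auto
              moreover have "dist x 0 < \<delta>1" using in0 W by (simp add: dist_real_def)
              ultimately show ?thesis using \<delta>1(2)[of x] f(3) by (simp add: dist_norm less_imp_le)
            next
              case False
              then have "x \<in> {l - 2 * W..l}" using True by blast
              then have "dist x l < \<delta>2" using W by (simp add: dist_real_def)
              moreover have "x \<in> {0..l}" using True by auto
              ultimately show ?thesis using \<delta>2(2)[of x] f(4) by (simp add: dist_norm less_imp_le)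
            qed
            moreover have "cmod (of_real (c' j x) * \<psi> x) \<le> K / W * B"
              unfolding norm_mult W_def using K[of j x] B[of x] True K0 cut_width(1)[OF l_pos, of j]
              by (intro mult_mono) auto
            ultimately have "cmod (rep_L2 g x) * cmod (of_real (c' j x) * \<psi> x) \<le> \<eta> * (K / W * B)"
              using x True \<eta> by (intro mult_mono) auto
            moreover have "1 * (\<eta> * (K / W * B)) \<le> ?h x"
              using True \<eta> K0 B0 W by (intro mult_right_mono) (auto simp: indicator_def)
            moreover have "cmod (rep_L2 g x * cnj (of_real (c' j x) * \<psi> x)) = cmod (rep_L2 g x) * cmod (of_real (c' j x) * \<psi> x)"
              by (simp only: norm_mult complex_mod_cnj)
            ultimately show ?thesis by linarith
          next
            case False
            then have "rep_L2 g x = 0 \<or> c' j x = 0" using x(2) out[of x j] unfolding W_def by blast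
            then show ?thesis using h0 by auto
          qed
        qed
      qed
      also have "(LINT x|lborel. ?h x) = (LINT x|lborel. indicator {0..2 * W} x + indicator {l - 2 * W..l} x) * (\<eta> * (K / W * B))"
        by simp
      also have "(LINT x|lborel. indicator {0..2 * W} x + indicator {l - 2 * W..l} x) = 4 * W"
        using W by (subst Bochner_Integration.integral_add) auto
      also have "4 * W * (\<eta> * (K / W * B)) = 4 * B * K * \<eta>" using W by simp
      finally show "dist (cinner g (L2of l (\<lambda>x. of_real (c' j x) * \<psi> x))) 0 < e" using \<eta> by simp
    qed
  qed
  have "cinner g (L2of l (vderiv (\<phi> j))) = - cinner h (L2of l (\<phi> j))" for j
    using w test by (simp add: is_wderiv_iff)
  then have eq: "cinner g (L2of l (\<lambda>x. of_real (cut l j x) * \<psi>' x)) + cinner g (L2of l (\<lambda>x. of_real (c' j x) * \<psi> x))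
      = - cinner h (L2of l (\<lambda>x. of_real (cut l j x) * \<psi> x))" for j
    unfolding v by (simp add: L2of_add[OF sq_int_restr[OF c1] sq_int_restr[OF c2]] cinner_add_right \<phi>_def[abs_def])
  have "(\<lambda>j. cinner g (L2of l (\<lambda>x. of_real (cut l j x) * \<psi>' x)) + cinner g (L2of l (\<lambda>x. of_real (c' j x) * \<psi> x)))
     \<longlonglongrightarrow> cinner g (L2of l \<psi>') + 0"
    by (intro tendsto_add bdry tendsto_cinner_right cut_L2of_tendsto l_pos d)
  moreover have "(\<lambda>j. - cinner h (L2of l (\<lambda>x. of_real (cut l j x) * \<psi> x))) \<longlonglongrightarrow> - cinner h (L2of l \<psi>)"
    by (intro tendsto_minus tendsto_cinner_right cut_L2of_tendsto l_pos cpsi)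
  ultimately have "cinner g (L2of l \<psi>') + 0 = - cinner h (L2of l \<psi>)"
    unfolding eq using LIMSEQ_unique by blast
  then show ?thesis by simp
qed

text \<open>The conclusions of \<open>H10_coef\<close> under the other form of the Dirichlet
  condition, stated for the continuous representative. It is applied to the derivative of an element
  of \<open>dom_As\<close>.\<close>

lemma zero_trace_coef:
  assumes "is_wderiv l g h" "zero_trace l g"
  shows "h \<in> L2_mean0 l" "C.coef h n = of_real (wave l n) * S.coef g n"
proof -
  have "cinner h (oneL l) = 0"
    using zero_trace_by_parts[OF assms diffk_const, of 1 "\<lambda>_. 0"] by (simp add: oneL_def L2of_zero)
  then show "h \<in> L2_mean0 l" using assms(1) by (simp add: is_wderiv_iff L2_mean0_iff)
  have "cinner h (cL l n) = - cinner g ((- wave l n) *\<^sub>R sL l n)"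
    unfolding cL_def L2of_wave_sinf[symmetric]
    by (rule zero_trace_by_parts[OF assms diffk_trig(2) trig_derivative(2)]) (intro continuous_intros continuous_sinf)
  then show "C.coef h n = of_real (wave l n) * S.coef g n"
    by (simp add: C.coef_def S.coef_def cinner_scaleR_right cinner_minus_right)
qed

lemma summable_inverse_wave: "summable (\<lambda>n. (1 / wave l n)\<^sup>2)"
proof -
  have "summable (\<lambda>n. inverse (real n ^ 2))" by (rule inverse_power_summable) simp
  then have "summable (\<lambda>n. inverse (real (Suc n) ^ 2))" using summable_Suc_iff[of "\<lambda>n. inverse (real n ^ 2)"] by blast
  then have "summable (\<lambda>n. (l / pi)\<^sup>2 * inverse (real (Suc n) ^ 2))" by (rule summable_mult)
  moreover have "(l / pi)\<^sup>2 * inverse (real (Suc n) ^ 2) = (1 / wave l n)\<^sup>2" for n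
    by (simp only: wave_def power_divide power_mult_distrib) (simp add: field_simps)
  ultimately show ?thesis by (simp only:)
qed

text \<open>Writing a coefficient as the product of \<open>wave l n * a n\<close> and
  \<open>1 / wave l n\<close> shows that the coefficients are absolutely summable. The series
  therefore converges uniformly to a continuous function, which inherits the zeros of the sines at
  the end points and represents \<open>w\<close>.\<close>

lemma sine_series_zero_trace:
  assumes w: "w \<in> L2_on l" and s: "summable (\<lambda>n. (wave l n * cmod (S.coef w n))\<^sup>2)"
  shows "zero_trace l w"
proof -
  define a where "a = S.coef w"
  define B where "B = sqrt (2 / l)"
  have B0: "B \<ge> 0" using l_pos by (simp add: B_def)
  have sb: "cmod (sinf l n x) \<le> B" for n x
    using B0 by (simp add: sinf_def norm_mult B_def[symmetric] mult_left_le abs_of_nonneg)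
  have suma: "summable (\<lambda>n. cmod (a n))"
  proof (rule summable_comparison_test')
    show "summable (\<lambda>n. (wave l n * cmod (a n))\<^sup>2 + (1 / wave l n)\<^sup>2)"
      unfolding a_def by (intro summable_add s summable_inverse_wave)
    fix n
    have "cmod (a n) = (wave l n * cmod (a n)) * (1 / wave l n)" using wave_gt0[of n] by simp
    moreover have "2 * ((wave l n * cmod (a n)) * (1 / wave l n)) \<le> (wave l n * cmod (a n))\<^sup>2 + (1 / wave l n)\<^sup>2"
      using sum_squares_bound[of "wave l n * cmod (a n)" "1 / wave l n"] by (simp only: mult.assoc)
    ultimately show "norm (cmod (a n)) \<le> (wave l n * cmod (a n))\<^sup>2 + (1 / wave l n)\<^sup>2"
      using norm_ge_zero[of "a n"] by (simp only: real_norm_def abs_norm_cancel)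
  qed
  define F where "F N x = (\<Sum>n<N. a n * sinf l n x)" for N x
  define f where "f x = (\<Sum>n. a n * sinf l n x)" for x
  have bnd: "norm (a n * sinf l n x) \<le> cmod (a n) * B" for n x
    unfolding norm_mult by (intro mult_left_mono sb) auto
  have ul: "uniform_limit UNIV F f sequentially"
    unfolding F_def[abs_def] f_def[abs_def]
    by (rule Weierstrass_m_test[OF bnd summable_mult2[OF suma]])
  have cF: "continuous_on UNIV (F N)" for N
    unfolding F_def[abs_def] by (intro continuous_intros continuous_sinf)
  have cf: "continuous_on UNIV f"
    by (rule uniform_limit_theorem[OF always_eventually ul]) (auto simp: cF)
  have "(\<lambda>N. L2of l (F N)) \<longlonglongrightarrow> L2of l f"
  proof (rule L2of_tendsto[where C="(\<Sum>n. cmod (a n) * B)"])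
    show "F N \<in> borel_measurable borel" "f \<in> borel_measurable borel" for N
      by (intro borel_measurable_continuous_onI cF cf)+
    show "(\<lambda>N. F N x) \<longlonglongrightarrow> f x" for x by (rule tendsto_uniform_limitI[OF ul]) simp
    fix N x
    have "cmod (F N x) \<le> (\<Sum>n<N. cmod (a n) * B)"
      unfolding F_def by (rule order_trans[OF norm_sum sum_mono[OF bnd]])
    also have "\<dots> \<le> (\<Sum>n. cmod (a n) * B)"
      by (rule sum_le_suminf[OF summable_mult2[OF suma]]) (use B0 in auto)
    finally show "cmod (F N x) \<le> (\<Sum>n. cmod (a n) * B)" .
  qed
  moreover have "L2of l (F N) = (\<Sum>n<N. cscale (a n) (sL l n))" for N
  proof (induction N)
    case 0
    show ?case by (simp add: F_def[abs_def] L2of_zero)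
  next
    case (Suc N)
    have "F (Suc N) = (\<lambda>x. F N x + a N * sinf l N x)" by (simp add: F_def fun_eq_iff)
    then have "L2of l (F (Suc N)) = L2of l (F N) + L2of l (\<lambda>x. a N * sinf l N x)"
      by (simp only:) (intro L2of_add sq_int_restr cF continuous_intros continuous_sinf)
    then show ?case using Suc by (simp add: L2of_cscale sq_int_sinf sL_def)
  qed
  ultimately have "L2of l f = w"
    using S.expansion_tendsto[OF w] LIMSEQ_unique unfolding a_def by simp
  then have "AE x in lborel. rep_L2 w x = restr l f x"
    using rep_abs_L2[OF sq_int_restr[OF cf]] unfolding L2of_def by blast
  then have "AE x in lborel. x \<in> {0<..<l} \<longrightarrow> rep_L2 w x = f x"
    by eventually_elim (simp add: restr_def)
  moreover have "f 0 = 0" "f l = 0" by (simp_all add: f_def sinf_0 sinf_l l_pos)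
  moreover have "continuous_on {0..l} f" by (rule continuous_on_subset[OF cf]) simp
  ultimately show ?thesis unfolding zero_trace_def by blast
qed

subsection \<open>The operators \<open>A\<close> and \<open>A\<^sub>*\<close>\<close>

definition lam :: "nat \<Rightarrow> real" where "lam n = (wave l n)\<^sup>2"

lemma lam_gt0: "lam n > 0"
  using wave_gt0[of n] by (simp add: lam_def)

lemma wave_mono: "wave l 0 \<le> wave l n"
  using l_pos by (simp add: wave_def divide_right_mono)

lemma wave_summable_if_lam_summable:
  assumes "summable (\<lambda>n. (lam n * cmod (a n))\<^sup>2)"
  shows "summable (\<lambda>n. (wave l n * cmod (a n))\<^sup>2)"
proof (rule summable_comparison_test'[where N=0])
  show "summable (\<lambda>n. (1 / wave l 0)\<^sup>2 * (lam n * cmod (a n))\<^sup>2)" by (rule summable_mult[OF assms])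
  fix n
  have "wave l 0 * (wave l n * cmod (a n)) \<le> lam n * cmod (a n)"
    using mult_right_mono[OF wave_mono[of n], of "wave l n * cmod (a n)"] wave_gt0[of n]
    by (simp add: lam_def power2_eq_square mult.assoc)
  then have "wave l n * cmod (a n) \<le> 1 / wave l 0 * (lam n * cmod (a n))"
    using wave_gt0[of 0] by (simp add: field_simps)
  then have "(wave l n * cmod (a n))\<^sup>2 \<le> (1 / wave l 0 * (lam n * cmod (a n)))\<^sup>2"
    using wave_gt0[of n] by (intro power_mono) auto
  then show "norm ((wave l n * cmod (a n))\<^sup>2) \<le> (1 / wave l 0)\<^sup>2 * (lam n * cmod (a n))\<^sup>2"
    by (simp only: power_mult_distrib[of "1 / wave l 0"] real_norm_def abs_power2)
qed

lemma dom_A_imp: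
  assumes "x \<in> dom_A l"
  shows "x \<in> L2_on l" "neg_dxx l x \<in> L2_on l" "S.coef (neg_dxx l x) n = of_real (lam n) * S.coef x n"
proof -
  have x: "x \<in> H1 l" "wderiv l x \<in> H1 l" "x \<in> H10 l" using assms by (auto simp: dom_A_def H2_def)
  note w1 = H1_wderiv[OF l_pos x(1)] and w2 = H1_wderiv[OF l_pos x(2)]
  show "x \<in> L2_on l" using w1 by (simp add: is_wderiv_iff)
  show "neg_dxx l x \<in> L2_on l" unfolding neg_dxx_def using w2 by (intro S.uminus_in) (simp add: is_wderiv_iff)
  show "S.coef (neg_dxx l x) n = of_real (lam n) * S.coef x n"
    unfolding neg_dxx_def S.coef_minus wderiv_sine_coef[OF w2] H10_coef(2)[OF x(3)]
    by (simp add: lam_def power2_eq_square)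
qed

text \<open>One direction is Bessel for \<open>neg_dxx l x\<close>. In the other the series is
  differentiated twice: the weight \<open>lam n\<close> on \<open>x\<close> is the first-order
  weight on the cosine series of \<open>wderiv l x\<close>.\<close>

lemma dom_A_iff: "x \<in> dom_A l \<longleftrightarrow> x \<in> L2_on l \<and> summable (\<lambda>n. (lam n * cmod (S.coef x n))\<^sup>2)"
proof
  assume x: "x \<in> dom_A l"
  show "x \<in> L2_on l \<and> summable (\<lambda>n. (lam n * cmod (S.coef x n))\<^sup>2)"
    using S.coef_sq_summable[of "neg_dxx l x"] dom_A_imp[OF x] lam_gt0
    by (simp add: norm_mult abs_of_pos)
next
  assume x: "x \<in> L2_on l \<and> summable (\<lambda>n. (lam n * cmod (S.coef x n))\<^sup>2)"
  then have s: "summable (\<lambda>n. (wave l n * cmod (S.coef x n))\<^sup>2)" using wave_summable_if_lam_summable by blast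
  have h: "x \<in> H10 l" by (rule sine_series_H10) (use x s in auto)
  then have "x \<in> H1 l" by (simp add: H10_iff)
  have "wderiv l x \<in> H1 l"
  proof -
    have "summable (\<lambda>n. (wave l n * cmod (C.coef (wderiv l x) n))\<^sup>2)"
      using x wave_gt0 by (simp add: H10_coef(2)[OF h] norm_mult abs_of_pos lam_def power2_eq_square mult.assoc)
    from cosine_series_wderiv[OF H10_coef(1)[OF h] this] show ?thesis unfolding H1_def by blast
  qed
  with h \<open>x \<in> H1 l\<close> show "x \<in> dom_A l" by (simp add: dom_A_def H2_def)
qed

lemma dom_As_imp:
  assumes "x \<in> dom_As l"
  shows "x \<in> L2_mean0 l" "neg_dxx l x \<in> L2_mean0 l" "C.coef (neg_dxx l x) n = of_real (lam n) * C.coef x n"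
proof -
  have x: "x \<in> H1 l" "wderiv l x \<in> H1 l" "x \<in> L2_mean0 l" "zero_trace l (wderiv l x)"
    using assms by (auto simp: dom_As_def H2_def)
  note w1 = H1_wderiv[OF l_pos x(1)] and w2 = H1_wderiv[OF l_pos x(2)]
  show "x \<in> L2_mean0 l" by (rule x)
  show "neg_dxx l x \<in> L2_mean0 l" unfolding neg_dxx_def by (intro C.uminus_in zero_trace_coef(1)[OF w2 x(4)])
  show "C.coef (neg_dxx l x) n = of_real (lam n) * C.coef x n"
    unfolding neg_dxx_def C.coef_minus zero_trace_coef(2)[OF w2 x(4)] wderiv_sine_coef[OF w1]
    by (simp add: lam_def power2_eq_square)
qed

lemma cosine_wderiv:
  assumes "v \<in> L2_mean0 l" "summable (\<lambda>n. (wave l n * cmod (C.coef v n))\<^sup>2)"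
  shows "is_wderiv l v (wderiv l v)" "wderiv l v \<in> L2_on l" "S.coef (wderiv l v) n = - of_real (wave l n) * C.coef v n"
proof -
  show w: "is_wderiv l v (wderiv l v)"
    using cosine_series_wderiv[OF assms] wderiv_eq[OF l_pos cosine_series_wderiv[OF assms]] by simp
  then show "wderiv l v \<in> L2_on l" by (simp add: is_wderiv_iff)
  show "S.coef (wderiv l v) n = - of_real (wave l n) * C.coef v n" by (rule wderiv_sine_coef[OF w])
qed

text \<open>The Neumann condition comes out of the series: the derivative is a sine series regular
  enough to have a continuous representative vanishing at the end points.\<close>

lemma dom_As_iff: "x \<in> dom_As l \<longleftrightarrow> x \<in> L2_mean0 l \<and> summable (\<lambda>n. (lam n * cmod (C.coef x n))\<^sup>2)"
proof
  assume x: "x \<in> dom_As l"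
  show "x \<in> L2_mean0 l \<and> summable (\<lambda>n. (lam n * cmod (C.coef x n))\<^sup>2)"
    using C.coef_sq_summable[of "neg_dxx l x"] dom_As_imp[OF x] lam_gt0
    by (simp add: norm_mult abs_of_pos)
next
  assume x: "x \<in> L2_mean0 l \<and> summable (\<lambda>n. (lam n * cmod (C.coef x n))\<^sup>2)"
  then have s: "summable (\<lambda>n. (wave l n * cmod (C.coef x n))\<^sup>2)" using wave_summable_if_lam_summable by blast
  note w = cosine_wderiv[OF conjunct1[OF x] s]
  have s2: "summable (\<lambda>n. (wave l n * cmod (S.coef (wderiv l x) n))\<^sup>2)"
    using x wave_gt0 by (simp add: w(3) norm_mult abs_of_pos lam_def power2_eq_square mult.assoc)
  have "x \<in> H1 l" using w(1) by (auto simp: H1_def)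
  moreover have "wderiv l x \<in> H1 l" using sine_series_wderiv[OF w(2) s2] by (auto simp: H1_def)
  moreover have "zero_trace l (wderiv l x)" by (rule sine_series_zero_trace[OF w(2) s2])
  ultimately show "x \<in> dom_As l" using x by (simp add: dom_As_def H2_def)
qed

lemma inj_lam: "inj lam"
proof (rule injI)
  fix m n assume "lam m = lam n"
  then have "wave l m = wave l n"
    using wave_gt0[of m] wave_gt0[of n] by (simp add: lam_def)
  then show "m = n" using l_pos by (simp add: wave_def)
qed

text \<open>This instance and the next turn the fractional powers, defined through eigenvalues and
  eigenprojections, into multiplication of the coefficients by powers of \<open>lam\<close>.\<close>

sublocale A: diagonal_operator "L2_on l" "sL l" "dom_A l" "neg_dxx l" lam
proof
  show e: "cscale c (sL l n) \<in> dom_A l" for c n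
  proof -
    have "summable (\<lambda>i. (lam i * cmod (S.coef (cscale c (sL l n)) i))\<^sup>2)"
      by (rule summable_finite[of "{n}"]) (auto simp: S.coef_cscale_basis)
    then show ?thesis by (simp add: dom_A_iff S.cscale_in S.basis_in)
  qed
  show "neg_dxx l (cscale c (sL l n)) = lam n *\<^sub>R cscale c (sL l n)" for c n
    by (rule S.coef_ext)
      (auto simp: dom_A_imp[OF e] S.scaleR_in S.cscale_in S.basis_in S.coef_scaleR S.coef_cscale_basis scaleR_conv_of_real)
qed (auto simp: lam_gt0 inj_lam dom_A_imp)

sublocale As: diagonal_operator "L2_mean0 l" "cL l" "dom_As l" "neg_dxx l" lam
proof
  show e: "cscale c (cL l n) \<in> dom_As l" for c n
  proof -
    have "summable (\<lambda>i. (lam i * cmod (C.coef (cscale c (cL l n)) i))\<^sup>2)"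
      by (rule summable_finite[of "{n}"]) (auto simp: C.coef_cscale_basis)
    then show ?thesis by (simp add: dom_As_iff C.cscale_in C.basis_in)
  qed
  show "neg_dxx l (cscale c (cL l n)) = lam n *\<^sub>R cscale c (cL l n)" for c n
    by (rule C.coef_ext)
      (auto simp: dom_As_imp[OF e] C.scaleR_in C.cscale_in C.basis_in C.coef_scaleR C.coef_cscale_basis scaleR_conv_of_real)
qed (auto simp: lam_gt0 inj_lam dom_As_imp)

lemma lam_powr_half: "lam n powr (1/2) = wave l n"
  using wave_gt0[of n] by (simp add: lam_def powr_half_sqrt)

lemma dom_A_pow_zero: "dom_A_pow l 0 = L2_on l"
  unfolding dom_A_pow_def by (rule A.pow_dom_zero)

lemma dom_As_pow_zero: "dom_As_pow l 0 = L2_mean0 l"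
  unfolding dom_As_pow_def by (rule As.pow_dom_zero)

lemma dom_A_pow_half: "u \<in> dom_A_pow l (1/2) \<longleftrightarrow> u \<in> L2_on l \<and> summable (\<lambda>n. (wave l n * cmod (S.coef u n))\<^sup>2)"
  unfolding dom_A_pow_def A.pow_dom_eq lam_powr_half by simp

lemma dom_As_pow_half: "v \<in> dom_As_pow l (1/2) \<longleftrightarrow> v \<in> L2_mean0 l \<and> summable (\<lambda>n. (wave l n * cmod (C.coef v n))\<^sup>2)"
  unfolding dom_As_pow_def As.pow_dom_eq lam_powr_half by simp

lemma sine_wderiv:
  assumes "u \<in> L2_on l" "summable (\<lambda>n. (wave l n * cmod (S.coef u n))\<^sup>2)"
  shows "wderiv l u \<in> L2_mean0 l" "C.coef (wderiv l u) n = of_real (wave l n) * S.coef u n"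
  using H10_coef[OF sine_series_H10[OF assms]] by auto

lemma As_pow_half:
  assumes "summable (\<lambda>n. (wave l n * cmod (C.coef v n))\<^sup>2)"
  shows "As_pow l (1/2) v \<in> L2_mean0 l" "C.coef (As_pow l (1/2) v) n = of_real (wave l n) * C.coef v n"
  using As.pow_op(1)[of "1/2" v] As.pow_op(2)[of "1/2" v n] assms unfolding As_pow_def lam_powr_half by auto

text \<open>Powers with nonpositive exponent are bounded because \<open>lam\<close> is bounded below
  by \<open>lam 0\<close>. The exponents that occur are \<open>alpha P - 1\<close> and
  \<open>beta P - 1\<close>; here the upper bound on the damping orders enters.\<close>

lemma As_pow_nonpos:
  assumes "\<sigma> \<le> 0"
  shows "As_pow l \<sigma> v \<in> L2_mean0 l" "C.coef (As_pow l \<sigma> v) n = of_real (lam n powr \<sigma>) * C.coef v n"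
proof -
  have "summable (\<lambda>n. (lam n powr \<sigma> * cmod (C.coef v n))\<^sup>2)"
  proof (rule summable_comparison_test'[where N=0])
    show "summable (\<lambda>n. (lam 0 powr \<sigma>)\<^sup>2 * (cmod (C.coef v n))\<^sup>2)"
      by (intro summable_mult C.coef_sq_summable)
    fix n
    have "lam 0 \<le> lam n" using wave_mono[of n] wave_gt0[of 0] by (simp add: lam_def power_mono)
    then have "lam n powr \<sigma> \<le> lam 0 powr \<sigma>"
      using lam_gt0[of 0] assms by (intro powr_mono2') auto
    then have "(lam n powr \<sigma> * cmod (C.coef v n))\<^sup>2 \<le> (lam 0 powr \<sigma> * cmod (C.coef v n))\<^sup>2"
      by (intro power_mono mult_right_mono) auto
    then show "norm ((lam n powr \<sigma> * cmod (C.coef v n))\<^sup>2) \<le> (lam 0 powr \<sigma>)\<^sup>2 * (cmod (C.coef v n))\<^sup>2"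
      by (simp add: power_mult_distrib)
  qed
  then show "As_pow l \<sigma> v \<in> L2_mean0 l" "C.coef (As_pow l \<sigma> v) n = of_real (lam n powr \<sigma>) * C.coef v n"
    using As.pow_op(1)[of \<sigma> v] As.pow_op(2)[of \<sigma> v n] unfolding As_pow_def by auto
qed

end

subsection \<open>Dissipative linear systems\<close>

text \<open>The solution is the exponential series of \<open>t\<close> times \<open>M\<close>
  applied to \<open>w\<close>, differentiated term by term on bounded intervals.\<close>

lemma linear_ode_solution_ex:
  fixes M :: "'a::banach \<Rightarrow> 'a"
  assumes M: "bounded_linear M"
  shows "\<exists>X. X 0 = w \<and> (\<forall>t. (X has_vector_derivative M (X t)) (at t))"
proof -
  interpret M: bounded_linear M by (rule M)
  obtain K where K: "K > 0" "\<And>x. norm (M x) \<le> norm x * K" using M.pos_bounded by blast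
  define a where "a k = (1 / fact k) *\<^sub>R (M ^^ k) w" for k :: nat
  define f where "f k t = t ^ k *\<^sub>R a k" for k and t :: real
  define X where "X t = (\<Sum>k. f k t)" for t
  have pow: "norm ((M ^^ k) w) \<le> K ^ k * norm w" for k
  proof (induction k)
    case (Suc k)
    have "norm ((M ^^ Suc k) w) \<le> norm ((M ^^ k) w) * K" using K(2) by simp
    also have "\<dots> \<le> K ^ k * norm w * K" using Suc K(1) by (intro mult_right_mono) auto
    finally show ?case by (simp add: mult_ac)
  qed simp
  have bnd: "norm (f k t) \<le> norm w * ((R * K) ^ k / fact k)" if "\<bar>t\<bar> \<le> R" for k t R
  proof -
    have "norm (f k t) = \<bar>t\<bar> ^ k * (norm ((M ^^ k) w) / fact k)"
      by (simp add: f_def a_def power_abs)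
    also have "\<dots> \<le> R ^ k * (K ^ k * norm w / fact k)"
      using that K(1) pow[of k] by (intro mult_mono divide_right_mono power_mono) auto
    finally show ?thesis by (simp add: power_mult_distrib mult_ac)
  qed
  have summ: "summable (\<lambda>k. norm w * ((R * K) ^ k / fact k))" for R
    using summable_exp[of "R * K"] by (intro summable_mult) (simp add: field_simps)
  have rec: "M (f k t) = (real (Suc k) * t ^ k) *\<^sub>R a (Suc k)" for k t
  proof -
    have "1 / fact k = real (Suc k) * (1 / fact (Suc k))" by (simp del: of_nat_Suc)
    then show ?thesis by (simp only: f_def a_def M.scaleR scaleR_scaleR funpow.simps o_apply mult_ac)
  qed
  have der: "(X has_vector_derivative M (X t)) (at t)" for t
  proof -
    define R where "R = \<bar>t\<bar> + 1"
    \<comment> \<open>A bounded interval around \<open>0\<close> and \<open>t\<close>, on which the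
      exponential series has a uniform majorant.\<close>
    define S where "S = {- R<..<R}"
    have S: "open S" "convex S" "t \<in> S" "0 \<in> S" by (auto simp: S_def R_def)
    have sb: "norm (f k x) \<le> norm w * ((R * K) ^ k / fact k)" if "x \<in> S" for k x
      by (rule bnd) (use that in \<open>auto simp: S_def\<close>)
    have ul: "uniform_limit S (\<lambda>n x. \<Sum>k<n. f k x) X sequentially"
      unfolding X_def[abs_def] by (rule Weierstrass_m_test[OF sb summ])
    have "\<exists>g. \<forall>x\<in>S. (\<lambda>n. f n x) sums (g x) \<and> (g has_derivative (\<lambda>h. h *\<^sub>R M (X x))) (at x within S)"
    proof (rule has_derivative_series[OF S(2), where f'="\<lambda>n x h. h *\<^sub>R ((real n * x ^ (n - 1)) *\<^sub>R a n)"])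
      show "(f n has_derivative (\<lambda>h. h *\<^sub>R ((real n * x ^ (n - 1)) *\<^sub>R a n))) (at x within S)" for n x
        unfolding f_def[abs_def] by (auto intro!: derivative_eq_intros simp: mult_ac)
      show "0 \<in> S" by (rule S)
      show "(\<lambda>n. f n 0) sums X 0"
        unfolding X_def by (rule summable_sums[OF summable_norm_cancel[OF summable_comparison_test'[OF summ[of R]]]]) (use sb[OF S(4)] in simp)
      fix e :: real assume "e > 0"
      then have "\<forall>\<^sub>F n in sequentially. \<forall>x\<in>S. dist (\<Sum>k<n. f k x) (X x) < e / K"
        using K(1) by (intro uniform_limitD[OF ul]) simp
      \<comment> \<open>The derivative of the constant term vanishes, so \<open>Suc n\<close>
        differentiated terms make \<open>M\<close> applied to the first \<open>n\<close> terms;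
        hence the shift of the index.\<close>
      then have "\<forall>\<^sub>F n in sequentially. \<forall>x\<in>S. \<forall>h. norm ((\<Sum>i<Suc n. h *\<^sub>R ((real i * x ^ (i - 1)) *\<^sub>R a i)) - h *\<^sub>R M (X x)) \<le> e * norm h"
      proof eventually_elim
        fix n assume n: "\<forall>x\<in>S. dist (\<Sum>k<n. f k x) (X x) < e / K"
        show "\<forall>x\<in>S. \<forall>h. norm ((\<Sum>i<Suc n. h *\<^sub>R ((real i * x ^ (i - 1)) *\<^sub>R a i)) - h *\<^sub>R M (X x)) \<le> e * norm h"
        proof (intro ballI allI)
          fix x h assume "x \<in> S"
          then have d: "norm ((\<Sum>k<n. f k x) - X x) \<le> e / K" using n by (force simp: dist_norm)
          have "(\<Sum>i<Suc n. h *\<^sub>R ((real i * x ^ (i - 1)) *\<^sub>R a i)) = h *\<^sub>R M (\<Sum>k<n. f k x)"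
            unfolding sum.lessThan_Suc_shift by (simp add: M.sum rec scaleR_sum_right)
          then have "norm ((\<Sum>i<Suc n. h *\<^sub>R ((real i * x ^ (i - 1)) *\<^sub>R a i)) - h *\<^sub>R M (X x)) = \<bar>h\<bar> * norm (M ((\<Sum>k<n. f k x) - X x))"
            by (simp add: M.diff flip: scaleR_diff_right)
          also have "\<dots> \<le> \<bar>h\<bar> * (e / K * K)"
            by (intro mult_left_mono order_trans[OF K(2)] mult_right_mono d) (use K(1) in auto)
          finally show "norm ((\<Sum>i<Suc n. h *\<^sub>R ((real i * x ^ (i - 1)) *\<^sub>R a i)) - h *\<^sub>R M (X x)) \<le> e * norm h"
            using K(1) by (simp add: mult.commute)
        qed
      qed
      then show "\<forall>\<^sub>F n in sequentially. \<forall>x\<in>S. \<forall>h. norm ((\<Sum>i<n. h *\<^sub>R ((real i * x ^ (i - 1)) *\<^sub>R a i)) - h *\<^sub>R M (X x)) \<le> e * norm h"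
        by (subst (asm) eventually_sequentially_Suc)
    qed
    then obtain g where g: "\<And>x. x \<in> S \<Longrightarrow> (\<lambda>n. f n x) sums (g x)" "\<And>x. x \<in> S \<Longrightarrow> (g has_derivative (\<lambda>h. h *\<^sub>R M (X x))) (at x within S)"
      by blast
    have gX: "g x = X x" if "x \<in> S" for x using sums_unique[OF g(1)[OF that]] by (simp add: X_def)
    have "(g has_vector_derivative M (X t)) (at t)"
      using g(2)[OF S(3)] at_within_open[OF S(3,1)] by (simp add: has_vector_derivative_def)
    then show ?thesis by (rule has_vector_derivative_transform_within_open[OF _ S(1,3) gX])
  qed
  have "X 0 = (\<Sum>k. if k = 0 then w else 0)"
    unfolding X_def by (intro arg_cong[of _ _ suminf] ext) (simp add: f_def a_def)
  then have "X 0 = w" using sums_unique[OF sums_If_finite[of "\<lambda>k. k = 0" "\<lambda>_. w"]] by simp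
  with der show ?thesis by blast
qed

text \<open>A choice among solutions; for nonnegative times it is unique in the dissipative setting,
  by \<open>lin_flow_unique\<close>.\<close>

definition lin_flow :: "('a::banach \<Rightarrow> 'a) \<Rightarrow> real \<Rightarrow> 'a \<Rightarrow> 'a" where
  "lin_flow M t w = (SOME X. X 0 = w \<and> (\<forall>t. (X has_vector_derivative M (X t)) (at t))) t"

text \<open>The map \<open>T\<close> carries the energy: \<open>norm (T x)\<close> is the energy
  norm, which on the blocks differs from the product norm of the type. Injectivity of
  \<open>T\<close> makes it definite and thereby gives uniqueness.\<close>

locale dissipative =
  fixes M :: "'a::banach \<Rightarrow> 'a" and T :: "'a \<Rightarrow> 'b::real_inner"
  assumes lin_M: "bounded_linear M" and lin_T: "bounded_linear T"
    and diss: "inner (T (M x)) (T x) \<le> 0" and inj_T: "T x = 0 \<Longrightarrow> x = 0"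
begin

sublocale M: bounded_linear M by (rule lin_M)
sublocale T: bounded_linear T by (rule lin_T)

lemma lin_flow_0: "lin_flow M 0 w = w"
  and lin_flow_deriv: "((\<lambda>t. lin_flow M t w) has_vector_derivative M (lin_flow M t w)) (at t)"
proof -
  have "(\<lambda>t. lin_flow M t w) = (SOME X. X 0 = w \<and> (\<forall>t. (X has_vector_derivative M (X t)) (at t)))"
    by (simp add: lin_flow_def fun_eq_iff)
  with someI_ex[OF linear_ode_solution_ex[OF lin_M, of w]]
  show "lin_flow M 0 w = w" "((\<lambda>t. lin_flow M t w) has_vector_derivative M (lin_flow M t w)) (at t)"
    by (auto simp: fun_eq_iff lin_flow_def)
qed

text \<open>The derivative of the squared energy norm is twice the quantity that \<open>diss\<close>
  declares nonpositive. Derivatives are taken within \<open>{0..t}\<close> because the modes of a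
  mild solution are differentiated there.\<close>

lemma norm_T_decreasing:
  assumes "0 \<le> t" and X: "\<And>s. s \<in> {0..t} \<Longrightarrow> (X has_vector_derivative M (X s)) (at s within {0..t})"
  shows "norm (T (X t)) \<le> norm (T (X 0))"
proof -
  define \<phi> where "\<phi> s = inner (T (X s)) (T (X s))" for s
  have der: "(\<phi> has_real_derivative 2 * inner (T (M (X s))) (T (X s))) (at s within {0..t})" if "s \<in> {0..t}" for s
  proof -
    have "((\<lambda>s. T (X s)) has_vector_derivative T (M (X s))) (at s within {0..t})"
      by (rule T.has_vector_derivative[OF X[OF that]])
    then have "(\<phi> has_derivative (\<lambda>h. inner (T (X s)) (h *\<^sub>R T (M (X s))) + inner (h *\<^sub>R T (M (X s))) (T (X s)))) (at s within {0..t})"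
      unfolding \<phi>_def[abs_def] has_vector_derivative_def by (intro has_derivative_inner)
    then show ?thesis
      unfolding has_field_derivative_def by (rule has_derivative_eq_rhs) (auto simp: inner_commute fun_eq_iff)
  qed
  have "\<phi> t \<le> \<phi> 0"
  proof (rule DERIV_nonpos_imp_decreasing_open[OF assms(1)])
    show "continuous_on {0..t} \<phi>"
      using der by (intro DERIV_continuous_on)
    fix s assume s: "0 < s" "s < t"
    then have "(\<phi> has_real_derivative 2 * inner (T (M (X s))) (T (X s))) (at s)"
      using der[of s] by (simp add: at_within_Icc_at)
    then show "\<exists>y. (\<phi> has_real_derivative y) (at s) \<and> y \<le> 0"
      using diss[of "X s"] by (intro exI[of _ "2 * inner (T (M (X s))) (T (X s))"] conjI) auto
  qed
  then show ?thesis by (simp add: \<phi>_def norm_le)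
qed

lemma lin_flow_unique:
  assumes "0 \<le> t" and Y: "\<And>s. s \<in> {0..t} \<Longrightarrow> (Y has_vector_derivative M (Y s)) (at s within {0..t})"
  shows "Y t = lin_flow M t (Y 0)"
proof -
  let ?D = "\<lambda>s. Y s - lin_flow M s (Y 0)"
  have "norm (T (?D t)) \<le> norm (T (?D 0))"
  proof (rule norm_T_decreasing[OF assms(1)])
    fix s assume "s \<in> {0..t}"
    then show "(?D has_vector_derivative M (?D s)) (at s within {0..t})"
      unfolding M.diff by (intro has_vector_derivative_diff Y has_vector_derivative_at_within[OF lin_flow_deriv])
  qed
  then have "T (?D t) = 0" by (simp add: lin_flow_0 T.zero)
  then show ?thesis using inj_T by fastforce
qed

text \<open>The image of the flow under \<open>M\<close> solves the same equation with initial value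
  \<open>M w\<close>.\<close>

lemma lin_flow_M: "0 \<le> t \<Longrightarrow> M (lin_flow M t w) = lin_flow M t (M w)"
  using lin_flow_unique[of t "\<lambda>s. M (lin_flow M s w)"]
  by (simp add: lin_flow_0 M.has_vector_derivative[OF has_vector_derivative_at_within[OF lin_flow_deriv]])

lemma lin_flow_contraction: "0 \<le> t \<Longrightarrow> norm (T (lin_flow M t w)) \<le> norm (T w)"
  using norm_T_decreasing[of t "\<lambda>s. lin_flow M s w"] by (simp add: lin_flow_0 has_vector_derivative_at_within[OF lin_flow_deriv])

end

section \<open>Continuity and differentiability of series of curves in the energy norm\<close>

lemma has_vector_derivative_iff_quotient:
  "(f has_vector_derivative D) (at t within S)
     \<longleftrightarrow> ((\<lambda>s. norm ((1 / (s - t)) *\<^sub>R (f s - f t) - D)) \<longlongrightarrow> 0) (at t within S)"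
proof -
  have "norm (f s - f t - (s - t) *\<^sub>R D) / norm (s - t) = norm ((1 / (s - t)) *\<^sub>R (f s - f t) - D)"
    if "s \<noteq> t" for s
  proof -
    have "(1 / (s - t)) *\<^sub>R (f s - f t) - D = (1 / (s - t)) *\<^sub>R (f s - f t - (s - t) *\<^sub>R D)"
      using that by (simp add: scaleR_diff_right)
    then show ?thesis by simp
  qed
  \<comment> \<open>At \<open>s = t\<close> the quotients are default values; the punctured
    neighbourhood filter ignores them.\<close>
  then have "\<forall>\<^sub>F s in at t within S. norm (f s - f t - (s - t) *\<^sub>R D) / norm (s - t)
      = norm ((1 / (s - t)) *\<^sub>R (f s - f t) - D)"
    unfolding eventually_at_filter by (intro always_eventually) simp
  from tendsto_cong[OF this] show ?thesis
    by (simp add: has_vector_derivative_def has_derivative_iff_norm bounded_linear_scaleR_left)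
qed

text \<open>Mean value inequality measured through \<open>T\<close>; it supplies majorants of
  difference quotients that do not involve the norm of a block.\<close>

lemma norm_T_increment:
  fixes T :: "'a::real_normed_vector \<Rightarrow> 'b::real_normed_vector"
  assumes T: "bounded_linear T" and X: "\<And>s. 0 \<le> s \<Longrightarrow> (X has_vector_derivative X' s) (at s within {0..})"
    and b: "\<And>s. 0 \<le> s \<Longrightarrow> norm (T (X' s)) \<le> c" and "0 \<le> s" "0 \<le> t"
  shows "norm (T (X s - X t)) \<le> c * \<bar>s - t\<bar>"
proof -
  interpret T: bounded_linear T by (rule T)
  have "norm (T (X s) - T (X t)) \<le> c * norm (s - t)"
  proof (rule differentiable_bound[of "{0..}"])
    fix r :: real assume r: "r \<in> {0..}"
    show "((\<lambda>s. T (X s)) has_derivative (\<lambda>h. h *\<^sub>R T (X' r))) (at r within {0..})"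
      using T.has_vector_derivative[OF X, of r] r by (simp add: has_vector_derivative_def)
    show "onorm (\<lambda>h. h *\<^sub>R T (X' r)) \<le> c"
    proof (rule onorm_le)
      fix h show "norm (h *\<^sub>R T (X' r)) \<le> c * norm h"
        using mult_right_mono[OF b[of r], of "\<bar>h\<bar>"] r by (simp add: mult.commute)
    qed
  qed (use assms in auto)
  then show ?thesis by (simp add: T.diff)
qed

text \<open>Dominated convergence for series, that is, Tannery's theorem; the majorant must hold for
  all indices at once along the filter.\<close>

lemma tendsto_suminf_sq:
  fixes a :: "nat \<Rightarrow> real \<Rightarrow> 'b::real_normed_vector"
  assumes lim: "\<And>k. ((\<lambda>s. a k s) \<longlongrightarrow> 0) F" and bnd: "\<forall>\<^sub>F s in F. \<forall>k. norm (a k s) \<le> c k"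
    and c: "summable (\<lambda>k. (c k)\<^sup>2)"
  shows "((\<lambda>s. \<Sum>k. (norm (a k s))\<^sup>2) \<longlongrightarrow> 0) F"
proof (cases "F = bot")
  case False
  have "\<forall>\<^sub>F (k, s) in sequentially \<times>\<^sub>F F. \<forall>k. norm (a k s) \<le> c k"
    using bnd by (subst eventually_prod2) auto
  then have b: "\<forall>\<^sub>F (k, s) in sequentially \<times>\<^sub>F F. norm ((norm (a k s))\<^sup>2) \<le> (c k)\<^sup>2"
    by (rule eventually_mono) (auto intro: power_mono)
  have l: "((\<lambda>s. (norm (a k s))\<^sup>2) \<longlongrightarrow> 0) F" for k
    using tendsto_power[OF tendsto_norm_zero[OF lim[of k]], of 2] by simp
  from tannerys_theorem[OF l b c False] show ?thesis by simp
qed simp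

lemma summable_sq_increment:
  fixes T :: "nat \<Rightarrow> 'a::real_normed_vector \<Rightarrow> 'b::real_normed_vector"
  assumes T: "\<And>n. bounded_linear (T n)"
    and X: "\<And>n s. 0 \<le> s \<Longrightarrow> (X n has_vector_derivative X' n s) (at s within {0..})"
    and b: "\<And>n s. 0 \<le> s \<Longrightarrow> norm (T n (X' n s)) \<le> c n" and c: "summable (\<lambda>n. (c n)\<^sup>2)" and "0 \<le> s" "0 \<le> t"
  shows "summable (\<lambda>n. (norm (T n (X n s - X n t)))\<^sup>2)"
proof (rule summable_comparison_test'[where N=0])
  show "summable (\<lambda>n. (c n)\<^sup>2 * \<bar>s - t\<bar>\<^sup>2)" by (rule summable_mult2[OF c])
  fix n
  have "norm (T n (X n s - X n t)) \<le> c n * \<bar>s - t\<bar>"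
    by (rule norm_T_increment[OF T X b]) (use assms in auto)
  then show "norm ((norm (T n (X n s - X n t)))\<^sup>2) \<le> (c n)\<^sup>2 * \<bar>s - t\<bar>\<^sup>2"
    by (simp only: real_norm_def abs_power2 power_mult_distrib[symmetric]) (intro power_mono norm_ge_zero)
qed

text \<open>Each difference quotient is at most \<open>c n\<close> by the mean value inequality and
  so is the derivative, whence the majorant \<open>2 * c n\<close>.\<close>

lemma series_differentiable:
  fixes T :: "nat \<Rightarrow> 'a::real_normed_vector \<Rightarrow> 'b::real_normed_vector"
  assumes T: "\<And>n. bounded_linear (T n)"
    and X: "\<And>n s. 0 \<le> s \<Longrightarrow> (X n has_vector_derivative X' n s) (at s within {0..})"
    and b: "\<And>n s. 0 \<le> s \<Longrightarrow> norm (T n (X' n s)) \<le> c n" and c: "summable (\<lambda>n. (c n)\<^sup>2)" and t: "0 \<le> t"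
  shows "((\<lambda>s. \<Sum>n. (norm (T n ((1 / (s - t)) *\<^sub>R (X n s - X n t) - X' n t)))\<^sup>2) \<longlongrightarrow> 0) (at t within {0..})"
proof (rule tendsto_suminf_sq)
  show "summable (\<lambda>n. (2 * c n)\<^sup>2)" using summable_mult[OF c, of 4] by (simp add: power_mult_distrib)
  fix n
  interpret T: bounded_linear "T n" by (rule T)
  have "((\<lambda>s. norm ((1 / (s - t)) *\<^sub>R (X n s - X n t) - X' n t)) \<longlongrightarrow> 0) (at t within {0..})"
    using X[OF t, of n] by (simp add: has_vector_derivative_iff_quotient)
  then have "((\<lambda>s. (1 / (s - t)) *\<^sub>R (X n s - X n t) - X' n t) \<longlongrightarrow> 0) (at t within {0..})"
    by (rule tendsto_norm_zero_cancel)
  from T.tendsto[OF this]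
  show "((\<lambda>s. T n ((1 / (s - t)) *\<^sub>R (X n s - X n t) - X' n t)) \<longlongrightarrow> 0) (at t within {0..})"
    by (simp add: T.zero)
next
  show "\<forall>\<^sub>F s in at t within {0..}. \<forall>n. norm (T n ((1 / (s - t)) *\<^sub>R (X n s - X n t) - X' n t)) \<le> 2 * c n"
    unfolding eventually_at_filter
  proof (intro always_eventually allI impI)
    fix s n assume s: "s \<noteq> t" "s \<in> {0..}"
    interpret T: bounded_linear "T n" by (rule T)
    have "norm (T n (X n s - X n t)) \<le> c n * \<bar>s - t\<bar>"
      by (rule norm_T_increment[OF T X b]) (use s t in auto)
    then have "norm ((1 / (s - t)) *\<^sub>R T n (X n s - X n t)) \<le> c n"
      using s by (simp add: field_simps)
    with b[OF t, of n] have "norm ((1 / (s - t)) *\<^sub>R T n (X n s - X n t) - T n (X' n t)) \<le> 2 * c n"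
      using norm_triangle_ineq4[of "(1 / (s - t)) *\<^sub>R T n (X n s - X n t)" "T n (X' n t)"] by linarith
    then show "norm (T n ((1 / (s - t)) *\<^sub>R (X n s - X n t) - X' n t)) \<le> 2 * c n"
      by (simp add: T.diff T.scaleR)
  qed
qed

lemma series_continuous:
  fixes T :: "nat \<Rightarrow> 'a::real_normed_vector \<Rightarrow> 'b::real_normed_vector" and X :: "nat \<Rightarrow> real \<Rightarrow> 'a"
  assumes T: "\<And>n. bounded_linear (T n)"
    and X: "\<And>n. continuous_on {0..} (X n)"
    and b: "\<And>n s. 0 \<le> s \<Longrightarrow> norm (T n (X n s)) \<le> c n" and c: "summable (\<lambda>n. (c n)\<^sup>2)" and t: "0 \<le> t"
  shows "((\<lambda>s. \<Sum>n. (norm (T n (X n s - X n t)))\<^sup>2) \<longlongrightarrow> 0) (at t within {0..})"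
proof (rule tendsto_suminf_sq)
  show "summable (\<lambda>n. (2 * c n)\<^sup>2)" using summable_mult[OF c, of 4] by (simp add: power_mult_distrib)
  fix n
  interpret T: bounded_linear "T n" by (rule T)
  have "(X n \<longlongrightarrow> X n t) (at t within {0..})" using X[of n] t by (simp add: continuous_on)
  then have "((\<lambda>s. T n (X n s - X n t)) \<longlongrightarrow> T n (X n t - X n t)) (at t within {0..})"
    by (intro T.tendsto tendsto_intros)
  then show "((\<lambda>s. T n (X n s - X n t)) \<longlongrightarrow> 0) (at t within {0..})" by (simp add: T.zero)
next
  show "\<forall>\<^sub>F s in at t within {0..}. \<forall>n. norm (T n (X n s - X n t)) \<le> 2 * c n"
    unfolding eventually_at_filter
  proof (intro always_eventually allI impI)
    fix s n assume s: "s \<noteq> t" "s \<in> {0..}"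
    interpret T: bounded_linear "T n" by (rule T)
    show "norm (T n (X n s - X n t)) \<le> 2 * c n"
      using norm_triangle_ineq4[of "T n (X n s)" "T n (X n t)"] b[of s n] b[OF t, of n] s by (simp add: T.diff)
  qed
qed

subsection \<open>Square-summable sequences\<close>

definition l2 :: "(nat \<Rightarrow> 'a::real_normed_vector) \<Rightarrow> bool" where
  "l2 a \<longleftrightarrow> summable (\<lambda>n. (norm (a n))\<^sup>2)"

lemma l2_bound:
  assumes "l2 b" "\<And>n. norm (a n) \<le> c * norm (b n)" shows "l2 a"
  unfolding l2_def
proof (rule summable_comparison_test'[where N=0])
  show "summable (\<lambda>n. c\<^sup>2 * (norm (b n))\<^sup>2)" using assms(1) by (auto simp: l2_def intro: summable_mult)
  show "norm ((norm (a n))\<^sup>2) \<le> c\<^sup>2 * (norm (b n))\<^sup>2" for n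
    by (simp only: real_norm_def abs_power2 power_mult_distrib[symmetric]) (intro power_mono norm_ge_zero assms)
qed

lemma l2_Pair: "l2 (\<lambda>n. (a n, b n)) \<longleftrightarrow> l2 a \<and> l2 b"
proof (intro iffI conjI)
  assume "l2 (\<lambda>n. (a n, b n))"
  then show "l2 a" "l2 b"
    by (rule l2_bound[where c=1]; simp add: norm_fst_le norm_snd_le)+
next
  assume "l2 a \<and> l2 b"
  then show "l2 (\<lambda>n. (a n, b n))"
    by (auto simp: l2_def norm_Pair intro: summable_add)
qed

lemma l2_scaleR: "l2 a \<Longrightarrow> l2 (\<lambda>n. c *\<^sub>R a n)"
  by (rule l2_bound[where c="\<bar>c\<bar>"]) auto

lemma l2_scaleR_iff: "c \<noteq> 0 \<Longrightarrow> l2 (\<lambda>n. c *\<^sub>R a n) \<longleftrightarrow> l2 a"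
  using l2_scaleR[of a c] l2_scaleR[of "\<lambda>n. c *\<^sub>R a n" "1 / c"] by auto

lemma l2_add:
  assumes "l2 a" "l2 b" shows "l2 (\<lambda>n. a n + b n)"
proof (rule l2_bound[where c=2])
  show "l2 (\<lambda>n. (a n, b n))" using assms by (simp add: l2_Pair)
  fix n show "norm (a n + b n) \<le> 2 * norm (a n, b n)"
    using norm_triangle_ineq[of "a n" "b n"] norm_fst_le[of "a n" "b n"] norm_snd_le[of "b n" "a n"] by simp
qed

lemma l2_diff: "l2 a \<Longrightarrow> l2 b \<Longrightarrow> l2 (\<lambda>n. a n - b n)"
  using l2_add[of a "\<lambda>n. (-1) *\<^sub>R b n"] l2_scaleR[of b "-1"] by simp

subsection \<open>The Fourier modes of the system\<close>

type_synonym cmode = "complex \<times> complex \<times> complex \<times> complex \<times> complex \<times> complex \<times> complex \<times> complex"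

text \<open>Symbol of the shear force without the coupling of the walls: \<open>A\<close> becomes
  \<open>k\<^sup>2\<close>, and since the derivative of a cosine is \<open>-k\<close> times a sine,
  the derivatives of \<open>v\<close> and \<open>v'\<close> enter with a plus sign.\<close>

definition shear :: "real \<Rightarrow> real \<Rightarrow> real \<Rightarrow> complex \<Rightarrow> complex \<Rightarrow> complex \<Rightarrow> complex \<Rightarrow> complex" where
  "shear k \<kappa> \<gamma> u u' v v' = - (k\<^sup>2 *\<^sub>R (\<kappa> *\<^sub>R u + \<gamma> *\<^sub>R u')) + \<kappa> *\<^sub>R (k *\<^sub>R v) + \<gamma> *\<^sub>R (k *\<^sub>R v')"

text \<open>Symbol of the right-hand side of the rotation equation, before division by the density.
  The parameter \<open>s\<close> stands for the damping coefficient times a power of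
  \<open>k\<^sup>2\<close>, and \<open>u\<close> and \<open>v\<close> combine as
  \<open>k *\<^sub>R u - v\<close> because \<open>u_x\<close> lives in the cosine basis.\<close>

definition bend :: "real \<Rightarrow> real \<Rightarrow> real \<Rightarrow> real \<Rightarrow> real \<Rightarrow> complex \<Rightarrow> complex \<Rightarrow> complex \<Rightarrow> complex \<Rightarrow> complex" where
  "bend k \<kappa> \<gamma> b s u u' v v' = - (k\<^sup>2 *\<^sub>R (b *\<^sub>R v + s *\<^sub>R v')) + \<kappa> *\<^sub>R (k *\<^sub>R u - v) + \<gamma> *\<^sub>R (k *\<^sub>R u' - v')"

definition modeM :: "nanotube \<Rightarrow> nat \<Rightarrow> cmode \<Rightarrow> cmode" where
  "modeM P n = (\<lambda>(u, u', v, v', y, y', z, z'). let k = wave (len P) n in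
     (u', (1 / \<rho>1 P) *\<^sub>R (shear k (\<kappa>1 P) (\<gamma>1 P) u u' v v' + m0 P *\<^sub>R (y - u)),
      v', (1 / \<rho>2 P) *\<^sub>R bend k (\<kappa>1 P) (\<gamma>1 P) (b1 P) (\<gamma>2 P * k\<^sup>2 powr (alpha P - 1)) u u' v v',
      y', (1 / \<rho>3 P) *\<^sub>R (shear k (\<kappa>2 P) (\<gamma>3 P) y y' z z' - m0 P *\<^sub>R (y - u)),
      z', (1 / \<rho>4 P) *\<^sub>R bend k (\<kappa>2 P) (\<gamma>3 P) (b2 P) (\<gamma>4 P * k\<^sup>2 powr (beta P - 1)) y y' z z'))"

text \<open>The squared norm of \<open>modeT P n w\<close> is the contribution of the \<open>n\<close>-th mode to the energy \<open>normH\<close>.\<close>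

definition modeT :: "nanotube \<Rightarrow> nat \<Rightarrow> cmode \<Rightarrow> complex \<times> cmode" where
  "modeT P n = (\<lambda>(u, u', v, v', y, y', z, z'). let k = wave (len P) n in
     (sqrt (\<rho>1 P) *\<^sub>R u', sqrt (\<rho>2 P) *\<^sub>R v', sqrt (\<rho>3 P) *\<^sub>R y', sqrt (\<rho>4 P) *\<^sub>R z',
      sqrt (\<kappa>1 P) *\<^sub>R (k *\<^sub>R u - v), sqrt (\<kappa>2 P) *\<^sub>R (k *\<^sub>R y - z), sqrt (m0 P) *\<^sub>R (y - u),
      sqrt (b1 P) *\<^sub>R (k *\<^sub>R v), sqrt (b2 P) *\<^sub>R (k *\<^sub>R z)))"

lemma linear_modeM: "bounded_linear (modeM P n)"
proof -
  have "linear (modeM P n)"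
    by (rule linearI)
      (simp_all add: modeM_def shear_def bend_def Let_def case_prod_unfold algebra_simps)
  then show ?thesis by (simp add: linear_conv_bounded_linear)
qed

lemma linear_modeT: "bounded_linear (modeT P n)"
proof -
  have "linear (modeT P n)"
    by (rule linearI) (simp_all add: modeT_def Let_def case_prod_unfold algebra_simps)
  then show ?thesis by (simp add: linear_conv_bounded_linear)
qed

text \<open>Energy balance of one wall under an exterior force \<open>f\<close>: the elastic terms
  cancel and the two damping terms remain. It is used twice, with opposite forces.\<close>

lemma wall_dissipation:
  "inner (shear k \<kappa> \<gamma> u u' v v' + f) u' + inner (bend k \<kappa> \<gamma> b s u u' v v') v'
     + \<kappa> * inner (k *\<^sub>R u' - v') (k *\<^sub>R u - v) + b * inner (k *\<^sub>R v') (k *\<^sub>R v)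
   = inner f u' - \<gamma> * (norm (k *\<^sub>R u' - v'))\<^sup>2 - s * (norm (k *\<^sub>R v'))\<^sup>2"
proof -
  \<comment> \<open>The shear force is \<open>- k\<close> times the stress, so that its work
    combines with that of \<open>bend\<close> into the strain rate \<open>a'\<close>.\<close>
  have 1: "shear k \<kappa> \<gamma> u u' v v' = - (k *\<^sub>R (\<kappa> *\<^sub>R (k *\<^sub>R u - v) + \<gamma> *\<^sub>R (k *\<^sub>R u' - v')))"
    by (simp add: shear_def algebra_simps power2_eq_square)
  define a a' where "a = k *\<^sub>R u - v" and "a' = k *\<^sub>R u' - v'"
  have v': "v' = k *\<^sub>R u' - a'" by (simp add: a'_def)
  have "inner (shear k \<kappa> \<gamma> u u' v v') u' = - (\<kappa> * inner a (k *\<^sub>R u')) - \<gamma> * inner a' (k *\<^sub>R u')"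
    unfolding 1 a_def[symmetric] a'_def[symmetric] by (simp add: inner_add_left algebra_simps)
  moreover have "inner (bend k \<kappa> \<gamma> b s u u' v v') v'
      = - (b * inner (k *\<^sub>R v) (k *\<^sub>R v')) - s * inner (k *\<^sub>R v') (k *\<^sub>R v') + \<kappa> * inner a v' + \<gamma> * inner a' v'"
    unfolding bend_def a_def[symmetric] a'_def[symmetric]
    by (simp add: inner_add_left inner_diff_left power2_eq_square algebra_simps)
  moreover have "\<kappa> * inner a v' = \<kappa> * inner a (k *\<^sub>R u') - \<kappa> * inner a a'" "\<gamma> * inner a' v' = \<gamma> * inner a' (k *\<^sub>R u') - \<gamma> * inner a' a'"
    unfolding v' by (simp_all only: inner_diff_right right_diff_distrib)
  moreover have "inner (k *\<^sub>R v') (k *\<^sub>R v) = inner (k *\<^sub>R v) (k *\<^sub>R v')" "inner a' a = inner a a'"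
    by (simp_all only: inner_commute)
  ultimately show ?thesis
    unfolding a_def[symmetric] a'_def[symmetric] power2_norm_eq_inner inner_add_left by simp
qed

locale tube = fixes P :: nanotube
  assumes pos: "len P > 0" "m0 P > 0" "b1 P > 0" "b2 P > 0" "\<kappa>1 P > 0" "\<kappa>2 P > 0"
    "\<rho>1 P > 0" "\<rho>2 P > 0" "\<rho>3 P > 0" "\<rho>4 P > 0"
    "\<gamma>1 P > 0" "\<gamma>2 P > 0" "\<gamma>3 P > 0" "\<gamma>4 P > 0"
    and exponents: "alpha P \<in> {0..1}" "beta P \<in> {0..1}"
begin

sublocale interval "len P" by unfold_locales (rule pos)

abbreviation k :: "nat \<Rightarrow> real" where "k n \<equiv> wave (len P) n"
abbreviation M where "M \<equiv> modeM P"
abbreviation T where "T \<equiv> modeT P"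

text \<open>The component spaces without any regularity; on them the modes determine the
  state.\<close>

definition base :: "state set" where
  "base = {(u, u', v, v', y, y', z, z'). u \<in> L2_on (len P) \<and> u' \<in> L2_on (len P) \<and>
     v \<in> L2_mean0 (len P) \<and> v' \<in> L2_mean0 (len P) \<and> y \<in> L2_on (len P) \<and> y' \<in> L2_on (len P) \<and>
     z \<in> L2_mean0 (len P) \<and> z' \<in> L2_mean0 (len P)}"

definition modes :: "state \<Rightarrow> nat \<Rightarrow> cmode" where
  "modes = (\<lambda>(u, u', v, v', y, y', z, z') n. (S.coef u n, S.coef u' n, C.coef v n, C.coef v' n,
     S.coef y n, S.coef y' n, C.coef z n, C.coef z' n))"

definition assemble :: "(nat \<Rightarrow> cmode) \<Rightarrow> state" where
  "assemble w = (S.synth (\<lambda>n. fst (w n)), S.synth (\<lambda>n. fst (snd (w n))),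
     C.synth (\<lambda>n. fst (snd (snd (w n)))), C.synth (\<lambda>n. fst (snd (snd (snd (w n))))),
     S.synth (\<lambda>n. fst (snd (snd (snd (snd (w n)))))), S.synth (\<lambda>n. fst (snd (snd (snd (snd (snd (w n))))))),
     C.synth (\<lambda>n. fst (snd (snd (snd (snd (snd (snd (w n)))))))), C.synth (\<lambda>n. snd (snd (snd (snd (snd (snd (snd (w n)))))))))"

lemma state_cases: obtains u u' v v' y y' z z' where "(U::state) = (u, u', v, v', y, y', z, z')"
  by (metis surj_pair)

lemma norm_Pair_sq: "(norm (a, b))\<^sup>2 = (norm a)\<^sup>2 + (norm b)\<^sup>2"
  by (simp add: norm_Pair)

lemma norm_modeT_sq:
  "(norm (T n (u, u', v, v', y, y', z, z')))\<^sup>2 = \<rho>1 P * (norm u')\<^sup>2 + \<rho>2 P * (norm v')\<^sup>2 + \<rho>3 P * (norm y')\<^sup>2 + \<rho>4 P * (norm z')\<^sup>2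
       + \<kappa>1 P * (norm (k n *\<^sub>R u - v))\<^sup>2 + \<kappa>2 P * (norm (k n *\<^sub>R y - z))\<^sup>2 + m0 P * (norm (y - u))\<^sup>2
       + b1 P * (norm (k n *\<^sub>R v))\<^sup>2 + b2 P * (norm (k n *\<^sub>R z))\<^sup>2"
proof -
  have sc: "(norm (sqrt r *\<^sub>R a))\<^sup>2 = r * (norm a)\<^sup>2" if "r > 0" for r and a :: complex
    using that by (simp add: power_mult_distrib)
  show ?thesis
    unfolding modeT_def Let_def prod.case norm_Pair_sq sc[OF pos(2)] sc[OF pos(3)] sc[OF pos(4)] sc[OF pos(5)] sc[OF pos(6)]
        sc[OF pos(7)] sc[OF pos(8)] sc[OF pos(9)] sc[OF pos(10)] by simp
qed

text \<open>Coercivity of the energy, uniform in the frequency because the wave numbers are bounded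
  below by \<open>k 0\<close>: the bending term controls \<open>v\<close>, and the shear term then
  controls \<open>u\<close>.\<close>

lemma modeT_bound: "\<exists>K\<ge>0. \<forall>n w. norm w \<le> K * norm (T n w)"
proof -
  define c where "c = k 0"
  have c: "c > 0" using wave_gt0 by (simp add: c_def)
  define A where "A r = 1 / sqrt r" for r
  \<comment> \<open>Sum of the constants for the eight components; \<open>A r\<close> undoes the
    factor \<open>sqrt r\<close> in \<open>modeT\<close>, and each division by \<open>c\<close>
    replaces \<open>k n\<close> by its lower bound.\<close>
  define K where "K = (A (\<kappa>1 P) + A (b1 P) / c) / c + A (\<rho>1 P) + A (b1 P) / c + A (\<rho>2 P)
     + (A (\<kappa>2 P) + A (b2 P) / c) / c + A (\<rho>3 P) + A (b2 P) / c + A (\<rho>4 P)"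
  have K0: "K \<ge> 0" using c by (simp add: K_def A_def pos less_imp_le)
  have "norm w \<le> K * norm (T n w)" for n w
  proof -
    obtain u u' v v' y y' z z' where w: "w = (u, u', v, v', y, y', z, z')" by (metis surj_pair)
    define N where "N = norm (T n w)"
    have N0: "N \<ge> 0" by (simp add: N_def)
    have kc: "c \<le> k n" unfolding c_def by (rule wave_mono)
    have N2: "N\<^sup>2 = \<rho>1 P * (norm u')\<^sup>2 + \<rho>2 P * (norm v')\<^sup>2 + \<rho>3 P * (norm y')\<^sup>2 + \<rho>4 P * (norm z')\<^sup>2
       + \<kappa>1 P * (norm (k n *\<^sub>R u - v))\<^sup>2 + \<kappa>2 P * (norm (k n *\<^sub>R y - z))\<^sup>2 + m0 P * (norm (y - u))\<^sup>2
       + b1 P * (norm (k n *\<^sub>R v))\<^sup>2 + b2 P * (norm (k n *\<^sub>R z))\<^sup>2"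
      unfolding N_def w by (rule norm_modeT_sq)
    have le: "norm x \<le> A r * N" if "r > 0" "r * (norm x)\<^sup>2 \<le> N\<^sup>2" for r :: real and x :: complex
    proof -
      have "(sqrt r * norm x)\<^sup>2 \<le> N\<^sup>2" using that by (simp add: power_mult_distrib)
      then have "sqrt r * norm x \<le> N" using N0 by (rule power2_le_imp_le)
      then show ?thesis using that(1) by (simp add: A_def field_simps)
    qed
    have nn: "0 \<le> r * (norm x)\<^sup>2" if "r > 0" for r :: real and x :: complex using that by simp
    have comp: "norm u' \<le> A (\<rho>1 P) * N" "norm v' \<le> A (\<rho>2 P) * N" "norm y' \<le> A (\<rho>3 P) * N" "norm z' \<le> A (\<rho>4 P) * N"
      "norm (k n *\<^sub>R u - v) \<le> A (\<kappa>1 P) * N" "norm (k n *\<^sub>R y - z) \<le> A (\<kappa>2 P) * N"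
      "norm (k n *\<^sub>R v) \<le> A (b1 P) * N" "norm (k n *\<^sub>R z) \<le> A (b2 P) * N"
      by (rule le; (rule pos)?; unfold N2; intro nn pos add_nonneg_nonneg add_increasing add_increasing2 order_refl)+
    have v: "norm v \<le> A (b1 P) / c * N"
    proof -
      have "c * norm v \<le> norm (k n *\<^sub>R v)" using kc by (simp add: mult_right_mono)
      then have "c * norm v \<le> A (b1 P) * N" using comp(7) by linarith
      then show ?thesis using c by (simp add: field_simps)
    qed
    have z: "norm z \<le> A (b2 P) / c * N"
    proof -
      have "c * norm z \<le> norm (k n *\<^sub>R z)" using kc by (simp add: mult_right_mono)
      then have "c * norm z \<le> A (b2 P) * N" using comp(8) by linarith
      then show ?thesis using c by (simp add: field_simps)
    qed
    have u: "norm u \<le> (A (\<kappa>1 P) + A (b1 P) / c) / c * N"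
    proof -
      have "c * norm u \<le> norm (k n *\<^sub>R u)" using kc by (simp add: mult_right_mono)
      also have "\<dots> \<le> norm (k n *\<^sub>R u - v) + norm v" using norm_triangle_sub[of "k n *\<^sub>R u" v] by linarith
      also have "\<dots> \<le> (A (\<kappa>1 P) + A (b1 P) / c) * N" using comp(5) v by (simp add: distrib_right)
      finally show ?thesis using c by (simp add: field_simps)
    qed
    have y: "norm y \<le> (A (\<kappa>2 P) + A (b2 P) / c) / c * N"
    proof -
      have "c * norm y \<le> norm (k n *\<^sub>R y)" using kc by (simp add: mult_right_mono)
      also have "\<dots> \<le> norm (k n *\<^sub>R y - z) + norm z" using norm_triangle_sub[of "k n *\<^sub>R y" z] by linarith
      also have "\<dots> \<le> (A (\<kappa>2 P) + A (b2 P) / c) * N" using comp(6) z by (simp add: distrib_right)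
      finally show ?thesis using c by (simp add: field_simps)
    qed
    have "norm w \<le> norm u + (norm u' + (norm v + (norm v' + (norm y + (norm y' + (norm z + norm z'))))))"
      unfolding w by (intro order_trans[OF norm_Pair_le] add_left_mono order_refl)
    also have "\<dots> \<le> K * N"
      unfolding K_def distrib_right using u v y z comp(1-4) by linarith
    finally show ?thesis by (simp add: N_def)
  qed
  with K0 show ?thesis by blast
qed

lemma modeT_dissipative: "dissipative (M n) (T n)"
proof (rule dissipative.intro)
  show "bounded_linear (M n)" "bounded_linear (T n)" by (rule linear_modeM linear_modeT)+
  show "w = 0" if "T n w = 0" for w
  proof -
    obtain K where "norm w \<le> K * norm (T n w)" using modeT_bound by blast
    with that show ?thesis by simp
  qed
  show "inner (T n (M n w)) (T n w) \<le> 0" for w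
  proof -
    obtain u u' v v' y y' z z' where w: "w = (u, u', v, v', y, y', z, z')" by (metis surj_pair)
    define s1 s2 where "s1 = \<gamma>2 P * (k n)\<^sup>2 powr (alpha P - 1)" and "s2 = \<gamma>4 P * (k n)\<^sup>2 powr (beta P - 1)"
    have s: "s1 \<ge> 0" "s2 \<ge> 0" using pos by (simp_all add: s1_def s2_def)
    have sc: "inner (sqrt r *\<^sub>R a) (sqrt r *\<^sub>R b) = r * inner a b" if "r > 0" for r and a b :: complex
    proof -
      have "sqrt r * (sqrt r * inner a b) = (sqrt r * sqrt r) * inner a b" by (simp only: mult.assoc)
      then show ?thesis using that by simp
    qed
    have cancel: "r * inner ((1 / r) *\<^sub>R a) b = inner a b" if "r > 0" for r and a b :: complex
      using that by simp
    define f where "f = m0 P *\<^sub>R (y - u)"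
    have "inner (T n (M n w)) (T n w) =
       (inner (shear (k n) (\<kappa>1 P) (\<gamma>1 P) u u' v v' + f) u' + inner (bend (k n) (\<kappa>1 P) (\<gamma>1 P) (b1 P) s1 u u' v v') v'
     + \<kappa>1 P * inner (k n *\<^sub>R u' - v') (k n *\<^sub>R u - v) + b1 P * inner (k n *\<^sub>R v') (k n *\<^sub>R v))
     + (inner (shear (k n) (\<kappa>2 P) (\<gamma>3 P) y y' z z' + (- f)) y' + inner (bend (k n) (\<kappa>2 P) (\<gamma>3 P) (b2 P) s2 y y' z z') z'
     + \<kappa>2 P * inner (k n *\<^sub>R y' - z') (k n *\<^sub>R y - z) + b2 P * inner (k n *\<^sub>R z') (k n *\<^sub>R z))
     + m0 P * inner (y' - u') (y - u)"
      unfolding w modeT_def modeM_def Let_def prod.case inner_Pair sc[OF pos(2)] sc[OF pos(3)] sc[OF pos(4)] sc[OF pos(5)] sc[OF pos(6)]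
        sc[OF pos(7)] sc[OF pos(8)] sc[OF pos(9)] sc[OF pos(10)]
        cancel[OF pos(7)] cancel[OF pos(8)] cancel[OF pos(9)] cancel[OF pos(10)]
        s1_def[symmetric] s2_def[symmetric] f_def[symmetric] by simp
    also have "\<dots> = inner f u' + inner (- f) y' + m0 P * inner (y' - u') (y - u)
       - \<gamma>1 P * (norm (k n *\<^sub>R u' - v'))\<^sup>2 - s1 * (norm (k n *\<^sub>R v'))\<^sup>2
       - \<gamma>3 P * (norm (k n *\<^sub>R y' - z'))\<^sup>2 - s2 * (norm (k n *\<^sub>R z'))\<^sup>2"
      unfolding wall_dissipation by simp
    \<comment> \<open>The work of the two coupling forces is exactly balanced by the change of the
      coupling energy.\<close>
    also have "inner f u' + inner (- f) y' + m0 P * inner (y' - u') (y - u) = 0"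
      by (simp add: f_def inner_diff_left inner_diff_right inner_commute algebra_simps)
    also have "0 - \<gamma>1 P * (norm (k n *\<^sub>R u' - v'))\<^sup>2 - s1 * (norm (k n *\<^sub>R v'))\<^sup>2
       - \<gamma>3 P * (norm (k n *\<^sub>R y' - z'))\<^sup>2 - s2 * (norm (k n *\<^sub>R z'))\<^sup>2 \<le> 0"
    proof -
      have "0 \<le> \<gamma>1 P * (norm (k n *\<^sub>R u' - v'))\<^sup>2" "0 \<le> s1 * (norm (k n *\<^sub>R v'))\<^sup>2"
        "0 \<le> \<gamma>3 P * (norm (k n *\<^sub>R y' - z'))\<^sup>2" "0 \<le> s2 * (norm (k n *\<^sub>R z'))\<^sup>2"
        using pos s by (auto intro!: mult_nonneg_nonneg)
      then show ?thesis by linarith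
    qed
    finally show ?thesis .
  qed
qed

section \<open>The phase space as a space of sequences with finite energy\<close>

lemma l2_modes:
  "l2 (S.coef u)" "l2 (C.coef u)"
  using S.coef_sq_summable C.coef_sq_summable by (simp_all add: l2_def)

lemma pow_half_l2:
  "u \<in> dom_A_pow (len P) (1/2) \<longleftrightarrow> u \<in> L2_on (len P) \<and> l2 (\<lambda>n. k n *\<^sub>R S.coef u n)"
  "v \<in> dom_As_pow (len P) (1/2) \<longleftrightarrow> v \<in> L2_mean0 (len P) \<and> l2 (\<lambda>n. k n *\<^sub>R C.coef v n)"
  using wave_gt0 by (simp_all add: dom_A_pow_half dom_As_pow_half l2_def abs_of_pos)

lemma dom_l2:
  "u \<in> dom_A (len P) \<longleftrightarrow> u \<in> L2_on (len P) \<and> l2 (\<lambda>n. (k n)\<^sup>2 *\<^sub>R S.coef u n)"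
  "v \<in> dom_As (len P) \<longleftrightarrow> v \<in> L2_mean0 (len P) \<and> l2 (\<lambda>n. (k n)\<^sup>2 *\<^sub>R C.coef v n)"
  by (simp_all add: dom_A_iff dom_As_iff l2_def lam_def)

lemma sqrt_ne0: "r > 0 \<Longrightarrow> sqrt r \<noteq> 0" by simp

text \<open>Since \<open>C.coef v\<close> is square summable anyway,
  \<open>k n *\<^sub>R S.coef u n - C.coef v n\<close> is so exactly if its first term is; the
  coupled energy thus imposes the separate conditions of \<open>phase\<close>.\<close>

lemma phase_iff: "U \<in> phase P \<longleftrightarrow> U \<in> base \<and> l2 (\<lambda>n. T n (modes U n))"
proof -
  obtain u u' v v' y y' z z' where U: "U = (u, u', v, v', y, y', z, z')" by (rule state_cases)
  have 1: "l2 (\<lambda>n. k n *\<^sub>R S.coef a n - C.coef b n) \<longleftrightarrow> l2 (\<lambda>n. k n *\<^sub>R S.coef a n)" for a b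
  proof
    assume "l2 (\<lambda>n. k n *\<^sub>R S.coef a n - C.coef b n)"
    from l2_add[OF this l2_modes(2)[of b]] show "l2 (\<lambda>n. k n *\<^sub>R S.coef a n)" by simp
  qed (intro l2_diff l2_modes)
  have "l2 (\<lambda>n. T n (modes U n)) \<longleftrightarrow> l2 (\<lambda>n. k n *\<^sub>R S.coef u n) \<and> l2 (\<lambda>n. k n *\<^sub>R C.coef v n)
      \<and> l2 (\<lambda>n. k n *\<^sub>R S.coef y n) \<and> l2 (\<lambda>n. k n *\<^sub>R C.coef z n)"
    unfolding U modes_def modeT_def Let_def prod.case l2_Pair
      l2_scaleR_iff[OF sqrt_ne0[OF pos(2)]] l2_scaleR_iff[OF sqrt_ne0[OF pos(3)]] l2_scaleR_iff[OF sqrt_ne0[OF pos(4)]]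
      l2_scaleR_iff[OF sqrt_ne0[OF pos(5)]] l2_scaleR_iff[OF sqrt_ne0[OF pos(6)]] l2_scaleR_iff[OF sqrt_ne0[OF pos(7)]]
      l2_scaleR_iff[OF sqrt_ne0[OF pos(8)]] l2_scaleR_iff[OF sqrt_ne0[OF pos(9)]] l2_scaleR_iff[OF sqrt_ne0[OF pos(10)]] 1
    using l2_modes l2_diff[OF l2_modes(1) l2_modes(1), of y u] by blast
  then show ?thesis
    unfolding U phase_def base_def by (auto simp: pow_half_l2 dom_A_pow_zero dom_As_pow_zero)
qed

lemma wall_sums:
  assumes "u \<in> dom_A_pow (len P) (1/2)" "v \<in> dom_As_pow (len P) (1/2)"
  shows "(\<lambda>n. (norm (k n *\<^sub>R S.coef u n - C.coef v n))\<^sup>2) sums (norm (wderiv (len P) u - v))\<^sup>2"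
    "(\<lambda>n. (norm (k n *\<^sub>R C.coef v n))\<^sup>2) sums (norm (As_pow (len P) (1/2) v))\<^sup>2"
proof -
  have u: "u \<in> L2_on (len P)" "summable (\<lambda>n. (k n * cmod (S.coef u n))\<^sup>2)"
    and v: "v \<in> L2_mean0 (len P)" "summable (\<lambda>n. (k n * cmod (C.coef v n))\<^sup>2)"
    using assms by (auto simp: dom_A_pow_half dom_As_pow_half)
  have "wderiv (len P) u - v \<in> L2_mean0 (len P)" by (intro C.diff_in sine_wderiv(1)[OF u] v)
  from C.parseval[OF this]
  show "(\<lambda>n. (norm (k n *\<^sub>R S.coef u n - C.coef v n))\<^sup>2) sums (norm (wderiv (len P) u - v))\<^sup>2"
    by (simp add: C.coef_diff sine_wderiv(2)[OF u] scaleR_conv_of_real)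
  from C.parseval[OF As_pow_half(1)[OF v(2)]]
  show "(\<lambda>n. (norm (k n *\<^sub>R C.coef v n))\<^sup>2) sums (norm (As_pow (len P) (1/2) v))\<^sup>2"
    by (simp only: As_pow_half(2)[OF v(2)] scaleR_conv_of_real)
qed

text \<open>Parseval for every term of the energy; the shear strains and the half powers are
  expanded in cosines.\<close>

lemma normH_sums:
  assumes "U \<in> phase P"
  shows "(\<lambda>n. (norm (T n (modes U n)))\<^sup>2) sums (normH P U)\<^sup>2"
proof -
  obtain u u' v v' y y' z z' where U: "U = (u, u', v, v', y, y', z, z')" by (rule state_cases)
  have i: "u \<in> dom_A_pow (len P) (1/2)" "v \<in> dom_As_pow (len P) (1/2)" "y \<in> dom_A_pow (len P) (1/2)" "z \<in> dom_As_pow (len P) (1/2)"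
    "u' \<in> L2_on (len P)" "v' \<in> L2_mean0 (len P)" "y' \<in> L2_on (len P)" "z' \<in> L2_mean0 (len P)"
    using assms by (auto simp: U phase_def dom_A_pow_zero dom_As_pow_zero)
  have "y - u \<in> L2_on (len P)" using i by (intro S.diff_in) (auto simp: pow_half_l2)
  from S.parseval[OF this] have yu: "(\<lambda>n. (norm (S.coef y n - S.coef u n))\<^sup>2) sums (norm (y - u))\<^sup>2"
    by (simp add: S.coef_diff)
  have "(\<lambda>n. \<rho>1 P * (norm (S.coef u' n))\<^sup>2 + \<rho>2 P * (norm (C.coef v' n))\<^sup>2 + \<rho>3 P * (norm (S.coef y' n))\<^sup>2
      + \<rho>4 P * (norm (C.coef z' n))\<^sup>2 + \<kappa>1 P * (norm (k n *\<^sub>R S.coef u n - C.coef v n))\<^sup>2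
      + \<kappa>2 P * (norm (k n *\<^sub>R S.coef y n - C.coef z n))\<^sup>2 + m0 P * (norm (S.coef y n - S.coef u n))\<^sup>2
      + b1 P * (norm (k n *\<^sub>R C.coef v n))\<^sup>2 + b2 P * (norm (k n *\<^sub>R C.coef z n))\<^sup>2)
    sums (\<rho>1 P * (norm u')\<^sup>2 + \<rho>2 P * (norm v')\<^sup>2 + \<rho>3 P * (norm y')\<^sup>2 + \<rho>4 P * (norm z')\<^sup>2
         + \<kappa>1 P * (norm (wderiv (len P) u - v))\<^sup>2 + \<kappa>2 P * (norm (wderiv (len P) y - z))\<^sup>2 + m0 P * (norm (y - u))\<^sup>2
         + b1 P * (norm (As_pow (len P) (1/2) v))\<^sup>2 + b2 P * (norm (As_pow (len P) (1/2) z))\<^sup>2)" (is "_ sums ?N")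
    by (intro sums_add sums_mult S.parseval C.parseval wall_sums(1) wall_sums(2)[OF i(1)] i yu)
  moreover have "?N = (normH P U)\<^sup>2"
    unfolding U normH_def Let_def prod.case
    by (subst real_sqrt_pow2) (auto intro!: add_nonneg_nonneg mult_nonneg_nonneg simp: pos less_imp_le)
  ultimately show ?thesis by (simp add: U modes_def norm_modeT_sq)
qed

lemma normH_eq: "U \<in> phase P \<Longrightarrow> normH P U = sqrt (\<Sum>n. (norm (T n (modes U n)))\<^sup>2)"
proof -
  assume "U \<in> phase P"
  from sums_unique[OF normH_sums[OF this]] have "(\<Sum>n. (norm (T n (modes U n)))\<^sup>2) = (normH P U)\<^sup>2" by simp
  moreover have "normH P U \<ge> 0"
    unfolding normH_def Let_def by (auto split: prod.split intro!: add_nonneg_nonneg mult_nonneg_nonneg simp: pos less_imp_le)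
  ultimately show ?thesis by simp
qed

lemma norm_sums: "U \<in> base \<Longrightarrow> (\<lambda>n. (norm (modes U n))\<^sup>2) sums (norm U)\<^sup>2"
  by (rule state_cases[of U]) (auto simp: base_def modes_def norm_Pair_sq intro!: sums_add S.parseval C.parseval)

text \<open>The continuous embedding of the phase space into the product of \<open>L2\<close>
  spaces; through it limits in \<open>normH\<close> yield limits, derivatives and integrals in the
  type \<open>state\<close>.\<close>

lemma norm_le_normH: "\<exists>K\<ge>0. \<forall>U\<in>phase P. norm U \<le> K * normH P U"
proof -
  obtain K where K: "K \<ge> 0" "\<And>n w. norm w \<le> K * norm (T n w)" using modeT_bound by blast
  have "norm U \<le> K * normH P U" if U: "U \<in> phase P" for U
  proof -
    have "(norm U)\<^sup>2 \<le> K\<^sup>2 * (normH P U)\<^sup>2"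
    proof (rule sums_le)
      show "(\<lambda>n. (norm (modes U n))\<^sup>2) sums (norm U)\<^sup>2" using U by (intro norm_sums) (simp add: phase_iff)
      show "(\<lambda>n. K\<^sup>2 * (norm (T n (modes U n)))\<^sup>2) sums (K\<^sup>2 * (normH P U)\<^sup>2)" by (intro sums_mult normH_sums U)
      show "(norm (modes U n))\<^sup>2 \<le> K\<^sup>2 * (norm (T n (modes U n)))\<^sup>2" for n
        unfolding power_mult_distrib[symmetric] by (intro power_mono K norm_ge_zero)
    qed
    then have "(norm U)\<^sup>2 \<le> (K * normH P U)\<^sup>2" by (simp only: power_mult_distrib)
    moreover have "0 \<le> K * normH P U" using K(1) by (simp add: normH_eq[OF U] suminf_nonneg sums_summable[OF normH_sums[OF U]])
    ultimately show ?thesis by (rule power2_le_imp_le)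
  qed
  with K(1) show ?thesis by blast
qed

lemma assemble:
  assumes "l2 (\<lambda>n. T n (w n))"
  shows "assemble w \<in> phase P" "modes (assemble w) n = w n"
proof -
  obtain K where K: "K \<ge> 0" "\<And>n w. norm w \<le> K * norm (T n w)" using modeT_bound by blast
  have "l2 w" by (rule l2_bound[OF assms, of _ K]) (rule K(2))
  \<comment> \<open>The block is written out as a tuple so that \<open>l2_Pair\<close> can split
    it.\<close>
  then have "l2 (\<lambda>n. (fst (w n), fst (snd (w n)), fst (snd (snd (w n))), fst (snd (snd (snd (w n)))),
     fst (snd (snd (snd (snd (w n))))), fst (snd (snd (snd (snd (snd (w n)))))),
     fst (snd (snd (snd (snd (snd (snd (w n))))))), snd (snd (snd (snd (snd (snd (snd (w n)))))))))"
    by simp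
  then have l: "summable (\<lambda>n. (cmod (fst (w n)))\<^sup>2)" "summable (\<lambda>n. (cmod (fst (snd (w n))))\<^sup>2)"
     "summable (\<lambda>n. (cmod (fst (snd (snd (w n)))))\<^sup>2)" "summable (\<lambda>n. (cmod (fst (snd (snd (snd (w n))))))\<^sup>2)"
     "summable (\<lambda>n. (cmod (fst (snd (snd (snd (snd (w n)))))))\<^sup>2)" "summable (\<lambda>n. (cmod (fst (snd (snd (snd (snd (snd (w n))))))))\<^sup>2)"
     "summable (\<lambda>n. (cmod (fst (snd (snd (snd (snd (snd (snd (w n)))))))))\<^sup>2)" "summable (\<lambda>n. (cmod (snd (snd (snd (snd (snd (snd (snd (w n)))))))))\<^sup>2)"
    unfolding l2_Pair l2_def by blast+
  show m: "modes (assemble w) n = w n" for n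
    by (simp add: assemble_def modes_def S.synth(3) C.synth(3) l)
  have "assemble w \<in> base" by (simp add: assemble_def base_def S.synth(2) C.synth(2) l)
  then show "assemble w \<in> phase P" using assms by (simp add: phase_iff m)
qed

lemma modes_ext: "U \<in> base \<Longrightarrow> V \<in> base \<Longrightarrow> (\<And>n. modes U n = modes V n) \<Longrightarrow> U = V"
  by (rule state_cases[of U]; rule state_cases[of V])
    (auto simp: base_def modes_def intro: S.coef_ext C.coef_ext)

lemma base_diff: "U \<in> base \<Longrightarrow> V \<in> base \<Longrightarrow> U - V \<in> base"
  and base_add: "U \<in> base \<Longrightarrow> V \<in> base \<Longrightarrow> U + V \<in> base"
  and base_scaleR: "U \<in> base \<Longrightarrow> r *\<^sub>R U \<in> base"
  by (auto simp: base_def S.diff_in C.diff_in S.add_in C.add_in S.scaleR_in C.scaleR_in)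

lemma modes_diff: "modes (U - V) n = modes U n - modes V n"
  and modes_add: "modes (U + V) n = modes U n + modes V n"
  and modes_scaleR: "modes (r *\<^sub>R U) n = r *\<^sub>R modes U n"
  by (rule state_cases[of U]; rule state_cases[of V];
      simp add: modes_def S.coef_diff C.coef_diff S.coef_add C.coef_add S.coef_scaleR C.coef_scaleR)+

sublocale D: dissipative "modeM P n" "modeT P n" for n by (rule modeT_dissipative)

lemma phase_base: "U \<in> phase P \<Longrightarrow> U \<in> base" and phase_l2: "U \<in> phase P \<Longrightarrow> l2 (\<lambda>n. T n (modes U n))"
  by (simp_all add: phase_iff)

lemma base_zero: "0 \<in> base"
  by (simp add: base_def zero_prod_def S.zero_in C.zero_in)

lemma modes_zero: "modes 0 n = 0"
  using modes_scaleR[of 0 0 n] by simp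

lemma phase_diff: "U \<in> phase P \<Longrightarrow> V \<in> phase P \<Longrightarrow> U - V \<in> phase P"
  by (simp add: phase_iff base_diff modes_diff D.T.diff l2_diff)

lemma phase_scaleR: "U \<in> phase P \<Longrightarrow> r *\<^sub>R U \<in> phase P"
  by (simp add: phase_iff base_scaleR modes_scaleR D.T.scaleR l2_scaleR)

subsection \<open>The operator in Fourier modes\<close>

text \<open>On the domain every \<open>wderiv\<close> and \<open>neg_dxx\<close> in
  \<open>opB\<close> is applied to something of the required regularity, so each has the expected
  coefficients.\<close>

lemma opB_modes:
  assumes "U \<in> domB P" shows "opB P U \<in> base" "modes (opB P U) n = M n (modes U n)"
proof -
  obtain u u' v v' y y' z z' where U: "U = (u, u', v, v', y, y', z, z')" by (rule state_cases)
  have d: "u \<in> dom_A_pow (len P) (1/2)" "u' \<in> dom_A_pow (len P) (1/2)" "v \<in> dom_As_pow (len P) (1/2)" "v' \<in> dom_As_pow (len P) (1/2)"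
    "y \<in> dom_A_pow (len P) (1/2)" "y' \<in> dom_A_pow (len P) (1/2)" "z \<in> dom_As_pow (len P) (1/2)" "z' \<in> dom_As_pow (len P) (1/2)"
    and A: "\<kappa>1 P *\<^sub>R u + \<gamma>1 P *\<^sub>R u' \<in> dom_A (len P)" "\<kappa>2 P *\<^sub>R y + \<gamma>3 P *\<^sub>R y' \<in> dom_A (len P)"
    and B: "b1 P *\<^sub>R v + \<gamma>2 P *\<^sub>R As_pow (len P) (alpha P - 1) v' \<in> dom_As (len P)" "b2 P *\<^sub>R z + \<gamma>4 P *\<^sub>R As_pow (len P) (beta P - 1) z' \<in> dom_As (len P)"
    using assms unfolding U domB_def phase_def by auto
  note sw = sine_wderiv and cw = cosine_wderiv(2,3)
  have i: "u \<in> L2_on (len P)" "u' \<in> L2_on (len P)" "v \<in> L2_mean0 (len P)" "v' \<in> L2_mean0 (len P)" "y \<in> L2_on (len P)" "y' \<in> L2_on (len P)" "z \<in> L2_mean0 (len P)" "z' \<in> L2_mean0 (len P)"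
    and s: "summable (\<lambda>n. (k n * cmod (S.coef u n))\<^sup>2)" "summable (\<lambda>n. (k n * cmod (S.coef u' n))\<^sup>2)"
    "summable (\<lambda>n. (k n * cmod (C.coef v n))\<^sup>2)" "summable (\<lambda>n. (k n * cmod (C.coef v' n))\<^sup>2)"
    "summable (\<lambda>n. (k n * cmod (S.coef y n))\<^sup>2)" "summable (\<lambda>n. (k n * cmod (S.coef y' n))\<^sup>2)"
    "summable (\<lambda>n. (k n * cmod (C.coef z n))\<^sup>2)" "summable (\<lambda>n. (k n * cmod (C.coef z' n))\<^sup>2)"
    using d unfolding dom_A_pow_half dom_As_pow_half by auto
  note Ai = dom_A_imp(2,3) and Bi = dom_As_imp(2,3)
  have ex: "alpha P - 1 \<le> 0" "beta P - 1 \<le> 0" using exponents by auto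
  note ap = As_pow_nonpos(2)[OF ex(1)] As_pow_nonpos(2)[OF ex(2)]
  note cl = S.scaleR_in S.add_in S.diff_in S.uminus_in
    C.scaleR_in C.add_in C.diff_in C.uminus_in
  note W = sw(1)[OF i(1) s(1)] sw(1)[OF i(2) s(2)] sw(1)[OF i(5) s(5)] sw(1)[OF i(6) s(6)]
    cw(1)[OF i(3) s(3)] cw(1)[OF i(4) s(4)] cw(1)[OF i(7) s(7)] cw(1)[OF i(8) s(8)]
  note V = sw(2)[OF i(1) s(1)] sw(2)[OF i(2) s(2)] sw(2)[OF i(5) s(5)] sw(2)[OF i(6) s(6)]
    cw(2)[OF i(3) s(3)] cw(2)[OF i(4) s(4)] cw(2)[OF i(7) s(7)] cw(2)[OF i(8) s(8)]
  show "opB P U \<in> base"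
    unfolding U opB_def base_def Let_def prod.case mem_Collect_eq
    by (intro conjI cl i W Ai(1) Bi(1) A B)
  note S_simps = S.coef_scaleR S.coef_add S.coef_diff S.coef_minus
    C.coef_scaleR C.coef_add C.coef_diff C.coef_minus
  show "modes (opB P U) n = M n (modes U n)"
    unfolding U opB_def modes_def modeM_def shear_def bend_def Let_def prod.case prod.inject
    by (simp add: S_simps Ai(2)[OF A(1)] Ai(2)[OF A(2)] Bi(2)[OF B(1)] Bi(2)[OF B(2)] V ap)
      (simp add: lam_def scaleR_conv_of_real algebra_simps)
qed

text \<open>Solves the force for its leading term; the rotation terms are of lower order. Only the
  combination of displacement and velocity is controlled, which matches the form of
  \<open>domB\<close>.\<close>

lemma shear_l2:
  assumes "l2 (\<lambda>n. shear (k n) \<kappa> \<gamma> (a n) (a' n) (b n) (b' n))" "l2 (\<lambda>n. k n *\<^sub>R b n)" "l2 (\<lambda>n. k n *\<^sub>R b' n)"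
  shows "l2 (\<lambda>n. (k n)\<^sup>2 *\<^sub>R (\<kappa> *\<^sub>R a n + \<gamma> *\<^sub>R a' n))"
  using l2_diff[OF l2_add[OF l2_scaleR[OF assms(2), of \<kappa>] l2_scaleR[OF assms(3), of \<gamma>]] assms(1)]
  by (simp add: shear_def)

lemma bend_l2:
  assumes "l2 (\<lambda>n. bend (k n) \<kappa> \<gamma> c (s n) (a n) (a' n) (b n) (b' n))"
    "l2 (\<lambda>n. k n *\<^sub>R a n)" "l2 (\<lambda>n. k n *\<^sub>R a' n)" "l2 b" "l2 b'"
  shows "l2 (\<lambda>n. (k n)\<^sup>2 *\<^sub>R (c *\<^sub>R b n + s n *\<^sub>R b' n))"
  using l2_diff[OF l2_add[OF l2_scaleR[OF l2_diff[OF assms(2,4)], of \<kappa>] l2_scaleR[OF l2_diff[OF assms(3,5)], of \<gamma>]] assms(1)]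
  by (simp add: bend_def)

text \<open>The domain is the maximal one. For the reverse direction the assembled image is read
  componentwise: its displacement entries are the velocities, which therefore have half-power
  regularity, and its velocity entries are square summable, which bounds the leading terms of the
  forces.\<close>

lemma domB_iff: "U \<in> domB P \<longleftrightarrow> U \<in> phase P \<and> l2 (\<lambda>n. T n (M n (modes U n)))"
proof
  assume U: "U \<in> domB P"
  then have "U \<in> phase P" by (simp add: domB_def)
  obtain u u' v v' y y' z z' where UU: "U = (u, u', v, v', y, y', z, z')" by (rule state_cases)
  have "opB P U \<in> phase P"
    using opB_modes(1)[OF U] U unfolding UU opB_def Let_def prod.case phase_def base_def domB_def
    by (simp add: dom_A_pow_zero dom_As_pow_zero)
  from phase_l2[OF this] \<open>U \<in> phase P\<close>
  show "U \<in> phase P \<and> l2 (\<lambda>n. T n (M n (modes U n)))" by (simp add: opB_modes(2)[OF U])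
next
  assume U: "U \<in> phase P \<and> l2 (\<lambda>n. T n (M n (modes U n)))"
  obtain u u' v v' y y' z z' where UU: "U = (u, u', v, v', y, y', z, z')" by (rule state_cases)
  obtain p q r s p' q' r' s' where V: "assemble (\<lambda>n. M n (modes U n)) = (p, q, r, s, p', q', r', s')" by (rule state_cases)
  have ph: "(p, q, r, s, p', q', r', s') \<in> phase P" and md: "modes (p, q, r, s, p', q', r', s') n = M n (modes U n)" for n
    using assemble[of "\<lambda>n. M n (modes U n)"] U by (simp_all add: V)
  have b: "u \<in> dom_A_pow (len P) (1/2)" "u' \<in> L2_on (len P)" "v \<in> dom_As_pow (len P) (1/2)" "v' \<in> L2_mean0 (len P)"
    "y \<in> dom_A_pow (len P) (1/2)" "y' \<in> L2_on (len P)" "z \<in> dom_As_pow (len P) (1/2)" "z' \<in> L2_mean0 (len P)"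
    using conjunct1[OF U] by (auto simp: UU phase_def dom_A_pow_zero dom_As_pow_zero)
  have bp: "p \<in> dom_A_pow (len P) (1/2)" "r \<in> dom_As_pow (len P) (1/2)" "p' \<in> dom_A_pow (len P) (1/2)" "r' \<in> dom_As_pow (len P) (1/2)"
    using ph by (auto simp: phase_def)
  have c: "S.coef p n = S.coef u' n" "C.coef r n = C.coef v' n" "S.coef p' n = S.coef y' n" "C.coef r' n = C.coef z' n"
    "S.coef q n = (1 / \<rho>1 P) *\<^sub>R (shear (k n) (\<kappa>1 P) (\<gamma>1 P) (S.coef u n) (S.coef u' n) (C.coef v n) (C.coef v' n) + m0 P *\<^sub>R (S.coef y n - S.coef u n))"
    "C.coef s n = (1 / \<rho>2 P) *\<^sub>R bend (k n) (\<kappa>1 P) (\<gamma>1 P) (b1 P) (\<gamma>2 P * (k n)\<^sup>2 powr (alpha P - 1)) (S.coef u n) (S.coef u' n) (C.coef v n) (C.coef v' n)"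
    "S.coef q' n = (1 / \<rho>3 P) *\<^sub>R (shear (k n) (\<kappa>2 P) (\<gamma>3 P) (S.coef y n) (S.coef y' n) (C.coef z n) (C.coef z' n) - m0 P *\<^sub>R (S.coef y n - S.coef u n))"
    "C.coef s' n = (1 / \<rho>4 P) *\<^sub>R bend (k n) (\<kappa>2 P) (\<gamma>3 P) (b2 P) (\<gamma>4 P * (k n)\<^sup>2 powr (beta P - 1)) (S.coef y n) (S.coef y' n) (C.coef z n) (C.coef z' n)" for n
    using md[of n] unfolding UU modes_def modeM_def Let_def prod.case prod.inject by blast+
  have eq: "p = u'" "r = v'" "p' = y'" "r' = z'"
    using S.coef_ext[of p u'] S.coef_ext[of p' y'] C.coef_ext[of r v'] C.coef_ext[of r' z'] b bp c(1-4)
    by (auto simp: pow_half_l2)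
  note h = b(1,3,5,7)[unfolded pow_half_l2, THEN conjunct2] bp[unfolded eq pow_half_l2, THEN conjunct2]
  have sh: "l2 (\<lambda>n. shear (k n) (\<kappa>1 P) (\<gamma>1 P) (S.coef u n) (S.coef u' n) (C.coef v n) (C.coef v' n))"
    "l2 (\<lambda>n. shear (k n) (\<kappa>2 P) (\<gamma>3 P) (S.coef y n) (S.coef y' n) (C.coef z n) (C.coef z' n))"
  proof -
    have f: "l2 (\<lambda>n. m0 P *\<^sub>R (S.coef y n - S.coef u n))" by (intro l2_scaleR l2_diff l2_modes)
    from l2_diff[OF l2_scaleR[OF l2_modes(1)[of q], of "\<rho>1 P"] f] pos(7)
    show "l2 (\<lambda>n. shear (k n) (\<kappa>1 P) (\<gamma>1 P) (S.coef u n) (S.coef u' n) (C.coef v n) (C.coef v' n))" by (simp add: c(5))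
    from l2_add[OF l2_scaleR[OF l2_modes(1)[of q'], of "\<rho>3 P"] f] pos(9)
    show "l2 (\<lambda>n. shear (k n) (\<kappa>2 P) (\<gamma>3 P) (S.coef y n) (S.coef y' n) (C.coef z n) (C.coef z' n))" by (simp add: c(7))
  qed
  have be: "l2 (\<lambda>n. bend (k n) (\<kappa>1 P) (\<gamma>1 P) (b1 P) (\<gamma>2 P * (k n)\<^sup>2 powr (alpha P - 1)) (S.coef u n) (S.coef u' n) (C.coef v n) (C.coef v' n))"
    "l2 (\<lambda>n. bend (k n) (\<kappa>2 P) (\<gamma>3 P) (b2 P) (\<gamma>4 P * (k n)\<^sup>2 powr (beta P - 1)) (S.coef y n) (S.coef y' n) (C.coef z n) (C.coef z' n))"
    using l2_scaleR[OF l2_modes(2)[of s], of "\<rho>2 P"] l2_scaleR[OF l2_modes(2)[of s'], of "\<rho>4 P"] pos(8,10)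
    by (simp_all add: c(6,8))
  have ex: "alpha P - 1 \<le> 0" "beta P - 1 \<le> 0" using exponents by auto
  have A: "\<kappa>1 P *\<^sub>R u + \<gamma>1 P *\<^sub>R u' \<in> dom_A (len P)" "\<kappa>2 P *\<^sub>R y + \<gamma>3 P *\<^sub>R y' \<in> dom_A (len P)"
    using shear_l2[OF sh(1) h(2,6)] shear_l2[OF sh(2) h(4,8)] b
    by (simp_all add: dom_l2 pow_half_l2 S.coef_add S.coef_scaleR S.add_in S.scaleR_in)
  have B: "b1 P *\<^sub>R v + \<gamma>2 P *\<^sub>R As_pow (len P) (alpha P - 1) v' \<in> dom_As (len P)"
    "b2 P *\<^sub>R z + \<gamma>4 P *\<^sub>R As_pow (len P) (beta P - 1) z' \<in> dom_As (len P)"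
    using bend_l2[OF be(1) h(1,5) l2_modes(2,2)] bend_l2[OF be(2) h(3,7) l2_modes(2,2)] b
    by (simp_all add: dom_l2 pow_half_l2 C.coef_add C.coef_scaleR C.add_in C.scaleR_in As_pow_nonpos[OF ex(1)] As_pow_nonpos[OF ex(2)]
        lam_def scaleR_conv_of_real mult.assoc)
  show "U \<in> domB P"
    using conjunct1[OF U] bp A B unfolding domB_def UU eq by simp
qed

lemma opB_phase: "U \<in> domB P \<Longrightarrow> opB P U \<in> phase P"
  using domB_iff[of U] by (simp add: phase_iff opB_modes)

lemma domB_phase: "U \<in> domB P \<Longrightarrow> U \<in> phase P" by (simp add: domB_def)

lemma domB_diff:
  assumes "U \<in> domB P" "V \<in> domB P" shows "U - V \<in> domB P" "opB P (U - V) = opB P U - opB P V"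
proof -
  show d: "U - V \<in> domB P"
    using assms by (simp add: domB_iff phase_diff modes_diff D.M.diff D.T.diff l2_diff)
  show "opB P (U - V) = opB P U - opB P V"
    by (rule modes_ext) (simp_all add: opB_modes d assms base_diff modes_diff D.M.diff)
qed

lemma domB_scaleR:
  assumes "U \<in> domB P" shows "r *\<^sub>R U \<in> domB P" "opB P (r *\<^sub>R U) = r *\<^sub>R opB P U"
proof -
  show d: "r *\<^sub>R U \<in> domB P"
    using assms by (simp add: domB_iff phase_scaleR modes_scaleR D.M.scaleR D.T.scaleR l2_scaleR)
  show "opB P (r *\<^sub>R U) = r *\<^sub>R opB P U"
    by (rule modes_ext) (simp_all add: opB_modes d assms base_scaleR modes_scaleR D.M.scaleR)
qed

subsection \<open>The semigroup\<close>

definition sol :: "state \<Rightarrow> real \<Rightarrow> state" where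
  "sol U t = assemble (\<lambda>n. lin_flow (M n) t (modes U n))"

lemma sol:
  assumes "U \<in> phase P" "0 \<le> t"
  shows "sol U t \<in> phase P" "modes (sol U t) n = lin_flow (M n) t (modes U n)"
proof -
  have "l2 (\<lambda>n. T n (lin_flow (M n) t (modes U n)))"
    by (rule l2_bound[OF phase_l2[OF assms(1)], where c=1]) (simp add: D.lin_flow_contraction[OF assms(2)])
  from assemble[OF this] show "sol U t \<in> phase P" "modes (sol U t) n = lin_flow (M n) t (modes U n)"
    by (simp_all add: sol_def)
qed

text \<open>The blocks commute with their flows, so applying them to the solution gives the modes of
  the solution started at \<open>opB P U\<close>, which has finite energy.\<close>

lemma sol_domB:
  assumes "U \<in> domB P" "0 \<le> t"
  shows "sol U t \<in> domB P" "opB P (sol U t) = sol (opB P U) t"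
proof -
  note ph = domB_phase[OF assms(1)] opB_phase[OF assms(1)]
  have e: "M n (lin_flow (M n) t (modes U n)) = modes (sol (opB P U) t) n" for n
    by (simp add: sol[OF ph(2) assms(2)] opB_modes(2)[OF assms(1)] D.lin_flow_M[OF assms(2)])
  show d: "sol U t \<in> domB P"
    unfolding domB_iff sol[OF ph(1) assms(2)] e by (intro conjI sol(1) phase_l2 ph assms)
  show "opB P (sol U t) = sol (opB P U) t"
    by (rule modes_ext) (simp_all add: opB_modes[OF d] phase_base sol[OF ph(1) assms(2)] sol(1)[OF ph(2) assms(2)] e)
qed

lemma normH_tendsto:
  assumes "\<And>s. 0 \<le> s \<Longrightarrow> W s \<in> phase P"
    and "((\<lambda>s. \<Sum>n. (norm (T n (modes (W s) n)))\<^sup>2) \<longlongrightarrow> 0) (at t within {0..})"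
  shows "((\<lambda>s. normH P (W s)) \<longlongrightarrow> 0) (at t within {0..})"
proof -
  have "((\<lambda>s. sqrt (\<Sum>n. (norm (T n (modes (W s) n)))\<^sup>2)) \<longlongrightarrow> sqrt 0) (at t within {0..})"
    by (intro tendsto_real_sqrt assms)
  moreover have "\<forall>\<^sub>F s in at t within {0..}. sqrt (\<Sum>n. (norm (T n (modes (W s) n)))\<^sup>2) = normH P (W s)"
    unfolding eventually_at_filter by (intro always_eventually) (simp add: normH_eq assms)
  ultimately show ?thesis by (simp add: Lim_transform_eventually)
qed

lemma flow_deriv_within: "((\<lambda>t. lin_flow (M n) t w) has_vector_derivative M n (lin_flow (M n) s w)) (at s within A)"
  by (rule has_vector_derivative_at_within[OF D.lin_flow_deriv])

lemma flow_continuous: "continuous_on A (\<lambda>t. lin_flow (M n) t w)"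
  by (rule continuous_on_vector_derivative[OF D.lin_flow_deriv])

text \<open>Contraction bounds every mode, for all times, by its initial energy; this is the
  summable majorant.\<close>

lemma sol_continuous:
  assumes U: "U \<in> phase P" and t: "0 \<le> t"
  shows "((\<lambda>s. normH P (sol U s - sol U t)) \<longlongrightarrow> 0) (at t within {0..})"
proof (rule normH_tendsto)
  show "sol U s - sol U t \<in> phase P" if "0 \<le> s" for s by (intro phase_diff sol(1) U t that)
  have "((\<lambda>s. \<Sum>n. (norm (T n (lin_flow (M n) s (modes U n) - lin_flow (M n) t (modes U n))))\<^sup>2) \<longlongrightarrow> 0) (at t within {0..})"
    by (rule series_continuous[where c="\<lambda>n. norm (T n (modes U n))"])
      (use t phase_l2[OF U] in \<open>auto simp: linear_modeT flow_continuous D.lin_flow_contraction l2_def\<close>)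
  moreover have "\<forall>\<^sub>F s in at t within {0..}. (\<Sum>n. (norm (T n (lin_flow (M n) s (modes U n) - lin_flow (M n) t (modes U n))))\<^sup>2)
      = (\<Sum>n. (norm (T n (modes (sol U s - sol U t) n)))\<^sup>2)"
    unfolding eventually_at_filter by (intro always_eventually) (simp add: modes_diff sol U t)
  ultimately show "((\<lambda>s. \<Sum>n. (norm (T n (modes (sol U s - sol U t) n)))\<^sup>2) \<longlongrightarrow> 0) (at t within {0..})"
    by (rule Lim_transform_eventually)
qed

text \<open>Shared by the solution and its primitive. The energy of the derivative is majorised by
  the modes of a fixed state: the image of the initial state under \<open>opB P\<close> for the
  solution, the initial state itself for the primitive.\<close>

lemma curve_differentiable:
  assumes W: "\<And>s. 0 \<le> s \<Longrightarrow> W s \<in> phase P" "\<And>s. 0 \<le> s \<Longrightarrow> W' s \<in> phase P"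
    and X: "\<And>s n. 0 \<le> s \<Longrightarrow> modes (W s) n = X n s" "\<And>s n. 0 \<le> s \<Longrightarrow> modes (W' s) n = X' n s"
    and der: "\<And>s n. 0 \<le> s \<Longrightarrow> (X n has_vector_derivative X' n s) (at s within {0..})"
    and b: "\<And>s n. 0 \<le> s \<Longrightarrow> norm (T n (X' n s)) \<le> norm (T n (modes U n))" and U: "U \<in> phase P" and t: "0 \<le> t"
  shows "((\<lambda>s. normH P ((1 / (s - t)) *\<^sub>R (W s - W t) - W' t)) \<longlongrightarrow> 0) (at t within {0..})"
proof (rule normH_tendsto)
  show "(1 / (s - t)) *\<^sub>R (W s - W t) - W' t \<in> phase P" if "0 \<le> s" for s
    by (intro phase_diff phase_scaleR W t that)
  have "((\<lambda>s. \<Sum>n. (norm (T n ((1 / (s - t)) *\<^sub>R (X n s - X n t) - X' n t)))\<^sup>2) \<longlongrightarrow> 0) (at t within {0..})"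
    by (rule series_differentiable[where c="\<lambda>n. norm (T n (modes U n))"])
      (use t phase_l2[OF U] der b in \<open>auto simp: linear_modeT l2_def\<close>)
  moreover have "\<forall>\<^sub>F s in at t within {0..}. (\<Sum>n. (norm (T n ((1 / (s - t)) *\<^sub>R (X n s - X n t) - X' n t)))\<^sup>2)
      = (\<Sum>n. (norm (T n (modes ((1 / (s - t)) *\<^sub>R (W s - W t) - W' t) n)))\<^sup>2)"
    unfolding eventually_at_filter by (intro always_eventually) (simp add: modes_diff modes_scaleR X t)
  ultimately show "((\<lambda>s. \<Sum>n. (norm (T n (modes ((1 / (s - t)) *\<^sub>R (W s - W t) - W' t) n)))\<^sup>2) \<longlongrightarrow> 0) (at t within {0..})"
    by (rule Lim_transform_eventually)
qed

lemma sol_differentiable: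
  assumes U: "U \<in> domB P" and t: "0 \<le> t"
  shows "((\<lambda>s. normH P ((1 / (s - t)) *\<^sub>R (sol U s - sol U t) - sol (opB P U) t)) \<longlongrightarrow> 0) (at t within {0..})"
proof (rule curve_differentiable[where U="opB P U"])
  note ph = domB_phase[OF U] opB_phase[OF U]
  show "sol U s \<in> phase P" "sol (opB P U) s \<in> phase P" "modes (sol U s) n = lin_flow (M n) s (modes U n)"
    "modes (sol (opB P U) s) n = lin_flow (M n) s (modes (opB P U) n)" if "0 \<le> s" for s n
    by (simp_all add: sol ph that)
  show "((\<lambda>s. lin_flow (M n) s (modes U n)) has_vector_derivative lin_flow (M n) s (modes (opB P U) n)) (at s within {0..})"
    if "0 \<le> s" for s n
    using flow_deriv_within[of n "modes U n" s "{0..}"] by (simp add: opB_modes[OF U] D.lin_flow_M[OF that])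
  show "norm (T n (lin_flow (M n) s (modes (opB P U) n))) \<le> norm (T n (modes (opB P U) n))" if "0 \<le> s" for s n
    by (rule D.lin_flow_contraction[OF that])
qed (use opB_phase[OF U] t in auto)

text \<open>The primitive of the solution is again assembled from its modes; this identifies the integral
  occurring in the definition of a mild solution.\<close>

definition prim :: "state \<Rightarrow> real \<Rightarrow> state" where
  "prim U t = assemble (\<lambda>n. integral {0..t} (\<lambda>s. lin_flow (M n) s (modes U n)))"

lemma flow_integral_deriv:
  assumes "0 \<le> s"
  shows "((\<lambda>t. integral {0..t} (\<lambda>s. lin_flow (M n) s w)) has_vector_derivative lin_flow (M n) s w) (at s within {0..})"
proof -
  \<comment> \<open>The interval is extended to \<open>s + 1\<close> so that \<open>s\<close> is not
    its right end point; near \<open>s\<close> it then agrees with \<open>{0..}\<close>.\<close>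
  have "((\<lambda>t. integral {0..t} (\<lambda>s. lin_flow (M n) s w)) has_vector_derivative lin_flow (M n) s w) (at s within {0..s + 1})"
    by (rule integral_has_vector_derivative[OF flow_continuous]) (use assms in auto)
  moreover have "at s within {0..s + 1} = at s within {0..}"
    by (rule at_within_nhd[of _ "{..<s + 1}"]) auto
  ultimately show ?thesis by simp
qed

lemma prim:
  assumes U: "U \<in> phase P" and t: "0 \<le> t"
  shows "prim U t \<in> phase P" "modes (prim U t) n = integral {0..t} (\<lambda>s. lin_flow (M n) s (modes U n))"
proof -
  let ?X = "\<lambda>n t. integral {0..t} (\<lambda>s. lin_flow (M n) s (modes U n))"
  \<comment> \<open>The primitive vanishes at \<open>0\<close>, so its value is an increment and the
    mean value bound applies.\<close>
  have "summable (\<lambda>n. (norm (T n (?X n t - ?X n 0)))\<^sup>2)"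
    by (rule summable_sq_increment[where c="\<lambda>n. norm (T n (modes U n))", OF linear_modeT flow_integral_deriv])
      (use t phase_l2[OF U] in \<open>auto simp: D.lin_flow_contraction l2_def\<close>)
  then have "l2 (\<lambda>n. T n (?X n t))" by (simp add: l2_def)
  from assemble[OF this] show "prim U t \<in> phase P" "modes (prim U t) n = ?X n t"
    by (simp_all add: prim_def)
qed

text \<open>Differentiability in the energy norm, weakened to the ambient norm in which the integral
  of \<open>mild_solution\<close> is taken.\<close>

lemma prim_deriv:
  assumes U: "U \<in> phase P" and t: "0 \<le> t"
  shows "(prim U has_vector_derivative sol U t) (at t within {0..})"
proof -
  have d: "((\<lambda>s. normH P ((1 / (s - t)) *\<^sub>R (prim U s - prim U t) - sol U t)) \<longlongrightarrow> 0) (at t within {0..})"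
    by (rule curve_differentiable[where U=U, OF prim(1)[OF U] sol(1)[OF U] prim(2)[OF U] sol(2)[OF U] flow_integral_deriv D.lin_flow_contraction U t])
  obtain K where K: "K \<ge> 0" "\<And>U. U \<in> phase P \<Longrightarrow> norm U \<le> K * normH P U" using norm_le_normH by blast
  have "((\<lambda>s. K * normH P ((1 / (s - t)) *\<^sub>R (prim U s - prim U t) - sol U t)) \<longlongrightarrow> 0) (at t within {0..})"
    using tendsto_mult_right_zero[OF d] .
  moreover have "\<forall>\<^sub>F s in at t within {0..}. norm (norm ((1 / (s - t)) *\<^sub>R (prim U s - prim U t) - sol U t))
      \<le> K * normH P ((1 / (s - t)) *\<^sub>R (prim U s - prim U t) - sol U t)"
    unfolding eventually_at_filter
    by (intro always_eventually) (auto intro!: K phase_diff phase_scaleR prim sol U t)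
  ultimately show ?thesis
    unfolding has_vector_derivative_iff_quotient by (rule Lim_null_comparison[rotated])
qed

lemma sol_has_integral:
  assumes U: "U \<in> phase P" and t: "0 \<le> t"
  shows "(sol U has_integral prim U t) {0..t}"
proof -
  have "(sol U has_integral prim U t - prim U 0) {0..t}"
    by (rule fundamental_theorem_of_calculus[OF t])
      (rule has_vector_derivative_within_subset[OF prim_deriv[OF U]]; simp)
  moreover have "prim U 0 = 0"
    by (rule modes_ext) (simp_all add: base_zero modes_zero phase_base prim U)
  ultimately show ?thesis by simp
qed

text \<open>Integrating the block equation expresses \<open>M n\<close> of the primitive as the flow
  minus the initial value, a difference of sequences of finite energy. So the primitive lies in the
  domain for every initial state in the phase space.\<close>

lemma prim_domB:
  assumes U: "U \<in> phase P" and t: "0 \<le> t"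
  shows "prim U t \<in> domB P" "sol U t = U + opB P (prim U t)"
proof -
  have e: "M n (modes (prim U t) n) = lin_flow (M n) t (modes U n) - modes U n" for n
  proof -
    have "M n (modes (prim U t) n) = integral {0..t} (M n \<circ> (\<lambda>s. lin_flow (M n) s (modes U n)))"
      unfolding prim(2)[OF U t]
      by (rule integral_linear[OF integrable_continuous_real[OF flow_continuous] linear_modeM, symmetric])
    moreover have "((M n \<circ> (\<lambda>s. lin_flow (M n) s (modes U n))) has_integral
        lin_flow (M n) t (modes U n) - lin_flow (M n) 0 (modes U n)) {0..t}"
      unfolding o_def by (rule fundamental_theorem_of_calculus[OF t flow_deriv_within])
    ultimately show ?thesis by (simp add: integral_unique D.lin_flow_0)
  qed
  have "l2 (\<lambda>n. T n (M n (modes (prim U t) n)))"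
    using l2_diff[OF phase_l2[OF sol(1)[OF U t]] phase_l2[OF U]] by (simp add: e D.T.diff sol[OF U t])
  then show d: "prim U t \<in> domB P" by (simp add: domB_iff prim[OF U t])
  show "sol U t = U + opB P (prim U t)"
    by (rule modes_ext) (simp_all add: sol[OF U t] phase_base base_add opB_modes[OF d] U e modes_add)
qed

lemma sol_C_in: "U \<in> phase P \<Longrightarrow> C_in (phase P) (normH P) (sol U)"
  unfolding C_in_def by (simp add: sol sol_continuous)

lemma sol_mild: "U \<in> phase P \<Longrightarrow> mild_solution P U (sol U)"
  unfolding mild_solution_def
proof (intro conjI allI impI)
  assume U: "U \<in> phase P"
  show "C_in (phase P) (normH P) (sol U)" by (rule sol_C_in[OF U])
  fix t :: real assume t: "0 \<le> t"
  note i = sol_has_integral[OF U t]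
  show "sol U integrable_on {0..t}" by (rule has_integral_integrable[OF i])
  show "integral {0..t} (sol U) \<in> domB P" "sol U t = U + opB P (integral {0..t} (sol U))"
    unfolding integral_unique[OF i] by (rule prim_domB[OF U t])+
qed

section \<open>Uniqueness of mild solutions\<close>

lemma bounded_linear_modes: "bounded_linear (\<lambda>U. modes U n)"
proof -
  have e: "(\<lambda>U. modes U n) = (\<lambda>U. (S.coef (fst U) n, S.coef (fst (snd U)) n, C.coef (fst (snd (snd U))) n,
     C.coef (fst (snd (snd (snd U)))) n, S.coef (fst (snd (snd (snd (snd U))))) n, S.coef (fst (snd (snd (snd (snd (snd U)))))) n,
     C.coef (fst (snd (snd (snd (snd (snd (snd U))))))) n, C.coef (snd (snd (snd (snd (snd (snd (snd U))))))) n))"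
    by (simp add: modes_def case_prod_unfold fun_eq_iff)
  have s: "bounded_linear (\<lambda>x. snd (f x))" if "bounded_linear f" for f :: "state \<Rightarrow> 'x::real_normed_vector \<times> 'y::real_normed_vector"
    by (rule bounded_linear_compose[OF bounded_linear_snd that])
  have f: "bounded_linear (\<lambda>x. fst (f x))" if "bounded_linear f" for f :: "state \<Rightarrow> 'x::real_normed_vector \<times> 'y::real_normed_vector"
    by (rule bounded_linear_compose[OF bounded_linear_fst that])
  note c = bounded_linear_compose[OF S.bounded_linear_coef] bounded_linear_compose[OF C.bounded_linear_coef]
  note s1 = bounded_linear_snd note s2 = s[OF s1] note s3 = s[OF s2] note s4 = s[OF s3] note s5 = s[OF s4] note s6 = s[OF s5]
  show ?thesis
    unfolding e by (intro bounded_linear_Pair c(1)[OF bounded_linear_fst] c(1)[OF f[OF s1]] c(2)[OF f[OF s2]] c(2)[OF f[OF s3]]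
        c(1)[OF f[OF s4]] c(1)[OF f[OF s5]] c(2)[OF f[OF s6]] c(2)[OF s[OF s6]])
qed

text \<open>Taking modes of the integral equation gives a differentiable curve in each block,
  because the generator is bounded there; it solves the block equation, whose forward solution is
  unique.\<close>

lemma mild_unique:
  assumes U: "U \<in> phase P" and V: "mild_solution P U V" and t: "0 \<le> t"
  shows "V t = sol U t"
proof -
  have Vp: "V s \<in> phase P" if "0 \<le> s" for s using V that unfolding mild_solution_def C_in_def by blast
  obtain K where K: "K \<ge> 0" "\<And>U. U \<in> phase P \<Longrightarrow> norm U \<le> K * normH P U" using norm_le_normH by blast
  \<comment> \<open>Continuity in \<open>normH\<close> is transferred to the ambient norm, so that
    the integral of \<open>V\<close> is differentiable.\<close>
  have "continuous_on {0..} V"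
    unfolding continuous_on
  proof
    fix s :: real assume s: "s \<in> {0..}"
    have "((\<lambda>r. normH P (V r - V s)) \<longlongrightarrow> 0) (at s within {0..})"
      using V s unfolding mild_solution_def C_in_def by blast
    from tendsto_mult_right_zero[OF this, of K]
    have "((\<lambda>r. V r - V s) \<longlongrightarrow> 0) (at s within {0..})"
    proof (rule Lim_null_comparison[rotated])
      show "\<forall>\<^sub>F r in at s within {0..}. norm (V r - V s) \<le> K * normH P (V r - V s)"
        unfolding eventually_at_filter by (intro always_eventually) (use s in \<open>auto intro!: K phase_diff Vp\<close>)
    qed
    then show "(V \<longlongrightarrow> V s) (at s within {0..})" by (rule LIM_zero_cancel)
  qed
  then have cont: "continuous_on {0..t} V" by (rule continuous_on_subset) simp
  have "modes (V t) n = modes (sol U t) n" for n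
  proof -
    let ?I = "\<lambda>s. integral {0..s} V"
    have eq: "modes (V s) n = modes U n + M n (modes (?I s) n)" if "s \<in> {0..t}" for s
    proof -
      have "?I s \<in> domB P" "V s = U + opB P (?I s)" using V that by (auto simp: mild_solution_def)
      then show ?thesis by (simp add: modes_add opB_modes)
    qed
    have der: "((\<lambda>s. modes (V s) n) has_vector_derivative M n (modes (V s) n)) (at s within {0..t})" if s: "s \<in> {0..t}" for s
    proof (rule has_vector_derivative_transform[OF s])
      show "modes (V r) n = modes U n + M n (modes (?I r) n)" if "r \<in> {0..t}" for r by (rule eq[OF that])
      have "((\<lambda>r. M n (modes (?I r) n)) has_vector_derivative M n (modes (V s) n)) (at s within {0..t})"
        by (intro D.M.has_vector_derivative bounded_linear.has_vector_derivative[OF bounded_linear_modes]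
            integral_has_vector_derivative[OF cont s])
      from has_vector_derivative_add[OF has_vector_derivative_const this]
      show "((\<lambda>r. modes U n + M n (modes (?I r) n)) has_vector_derivative M n (modes (V s) n)) (at s within {0..t})" by simp
    qed
    have "modes (?I 0) n = 0" by (simp add: modes_zero)
    then have "modes (V 0) n = modes U n" using eq[of 0] t by (simp add: D.M.zero)
    with D.lin_flow_unique[OF t der] show ?thesis by (simp add: sol[OF U t])
  qed
  then show ?thesis by (intro modes_ext phase_base Vp sol(1) U t)
qed

subsection \<open>Regularity\<close>

lemma domB_pow_phase: "U \<in> domB_pow P j \<Longrightarrow> U \<in> phase P"
  by (cases j) (auto simp: domB_phase)

text \<open>Additivity of \<open>opB\<close> is available on its domain, since \<open>wderiv\<close>
  is a definite description without meaning off \<open>H1\<close>; powers are therefore handled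
  within \<open>domB_pow\<close>.\<close>

lemma domB_pow_diff:
  "U \<in> domB_pow P j \<Longrightarrow> V \<in> domB_pow P j \<Longrightarrow>
     U - V \<in> domB_pow P j \<and> (opB P ^^ j) (U - V) = (opB P ^^ j) U - (opB P ^^ j) V"
proof (induction j arbitrary: U V)
  case (Suc j)
  then show ?case using Suc.IH[of "opB P U" "opB P V"]
    by (auto simp: domB_diff funpow_swap1)
qed (simp add: phase_diff)

lemma domB_pow_scaleR:
  "U \<in> domB_pow P j \<Longrightarrow> r *\<^sub>R U \<in> domB_pow P j \<and> (opB P ^^ j) (r *\<^sub>R U) = r *\<^sub>R (opB P ^^ j) U"
proof (induction j arbitrary: U)
  case (Suc j)
  then show ?case using Suc.IH[of "opB P U"] by (auto simp: domB_scaleR funpow_swap1)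
qed (simp add: phase_scaleR)

lemma domB_pow_sol:
  "U \<in> domB_pow P j \<Longrightarrow> 0 \<le> t \<Longrightarrow> sol U t \<in> domB_pow P j \<and> (opB P ^^ j) (sol U t) = sol ((opB P ^^ j) U) t"
proof (induction j arbitrary: U)
  case (Suc j)
  then show ?case using Suc.IH[of "opB P U"] by (auto simp: sol_domB funpow_swap1)
qed (simp add: sol)

lemma domB_pow_Suc: "U \<in> domB_pow P (Suc j) \<Longrightarrow> U \<in> domB_pow P j"
proof (induction j arbitrary: U)
  case 0 then show ?case by (auto simp: domB_phase)
next
  case (Suc j)
  then show ?case using Suc.IH[of "opB P U"] by auto
qed

lemma domB_pow_add: "U \<in> domB_pow P (j + d) \<Longrightarrow> U \<in> domB_pow P j"
proof (induction d)
  case (Suc d)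
  then show ?case using domB_pow_Suc[of U "j + d"] by (simp del: domB_pow.simps)
qed simp

lemma domB_pow_funpow: "U \<in> domB_pow P (j + d) \<Longrightarrow> (opB P ^^ j) U \<in> domB_pow P d"
proof (induction j arbitrary: U)
  case (Suc j)
  then show ?case using Suc.IH[of "opB P U"] by (simp add: funpow_swap1)
qed simp

lemma graph_norm_tendsto:
  assumes "((\<lambda>s. normH P (W s)) \<longlongrightarrow> 0) F" "((\<lambda>s. normH P ((opB P ^^ j) (W s))) \<longlongrightarrow> 0) F"
  shows "((\<lambda>s. graph_norm P j (W s)) \<longlongrightarrow> 0) F"
  using tendsto_add[OF assms] assms(1) by (cases "j = 0") (simp_all add: graph_norm_def)

text \<open>The derivative of the solution is the solution started at \<open>opB P U\<close>, so
  induction on \<open>d\<close> trades one power of the generator for one derivative. The second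
  part of the graph norm is the same statement for the initial state \<open>(opB P ^^ j) U\<close>,
  since the power commutes with the flow.\<close>

lemma sol_Ck: "U \<in> domB_pow P (j + d) \<Longrightarrow> Ck_in d (domB_pow P j) (graph_norm P j) (sol U)"
proof (induction d arbitrary: U)
  case 0
  then have U: "U \<in> domB_pow P j" by simp
  note W = domB_pow_sol[OF U]
  have "((\<lambda>s. graph_norm P j (sol U s - sol U t)) \<longlongrightarrow> 0) (at t within {0..})" if t: "0 \<le> t" for t
  proof (rule graph_norm_tendsto)
    show "((\<lambda>s. normH P (sol U s - sol U t)) \<longlongrightarrow> 0) (at t within {0..})"
      by (rule sol_continuous[OF domB_pow_phase[OF U] t])
    have "(opB P ^^ j) U \<in> phase P" using domB_pow_funpow[of U j 0] U by simp
    from sol_continuous[OF this t]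
    show "((\<lambda>s. normH P ((opB P ^^ j) (sol U s - sol U t))) \<longlongrightarrow> 0) (at t within {0..})"
    proof (rule Lim_transform_eventually)
      show "\<forall>\<^sub>F s in at t within {0..}. normH P (sol ((opB P ^^ j) U) s - sol ((opB P ^^ j) U) t) = normH P ((opB P ^^ j) (sol U s - sol U t))"
        unfolding eventually_at_filter by (intro always_eventually) (use W t domB_pow_diff in auto)
    qed
  qed
  then show ?case using W by (simp add: C_in_def)
next
  case (Suc d)
  then have B: "U \<in> domB P" and BU: "opB P U \<in> domB_pow P (j + d)" by simp_all
  have U: "U \<in> domB_pow P j" by (rule domB_pow_add[OF Suc.prems])
  note W = domB_pow_sol[OF U] and W' = domB_pow_sol[OF domB_pow_add[OF BU]]
  have "((\<lambda>s. graph_norm P j ((1 / (s - t)) *\<^sub>R (sol U s - sol U t) - sol (opB P U) t)) \<longlongrightarrow> 0) (at t within {0..})" if t: "0 \<le> t" for t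
  proof (rule graph_norm_tendsto)
    show "((\<lambda>s. normH P ((1 / (s - t)) *\<^sub>R (sol U s - sol U t) - sol (opB P U) t)) \<longlongrightarrow> 0) (at t within {0..})"
      by (rule sol_differentiable[OF B t])
    have "(opB P ^^ j) U \<in> domB_pow P (Suc d)" by (rule domB_pow_funpow[OF Suc.prems])
    then have "(opB P ^^ j) U \<in> domB P" by simp
    from sol_differentiable[OF this t]
    show "((\<lambda>s. normH P ((opB P ^^ j) ((1 / (s - t)) *\<^sub>R (sol U s - sol U t) - sol (opB P U) t))) \<longlongrightarrow> 0) (at t within {0..})"
    proof (rule Lim_transform_eventually)
      \<comment> \<open>The power of \<open>opB P\<close> is moved through the quotient and the
        flow, which is legitimate because all three states lie in
        \<open>domB_pow P j\<close>.\<close>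
      have "(opB P ^^ j) ((1 / (s - t)) *\<^sub>R (sol U s - sol U t) - sol (opB P U) t)
        = (1 / (s - t)) *\<^sub>R (sol ((opB P ^^ j) U) s - sol ((opB P ^^ j) U) t) - sol (opB P ((opB P ^^ j) U)) t" if s: "0 \<le> s" for s
        using W[OF s] W[OF t] W'[OF t] domB_pow_diff domB_pow_scaleR by (simp add: funpow_swap1)
      then show "\<forall>\<^sub>F s in at t within {0..}. normH P ((1 / (s - t)) *\<^sub>R (sol ((opB P ^^ j) U) s - sol ((opB P ^^ j) U) t) - sol (opB P ((opB P ^^ j) U)) t)
         = normH P ((opB P ^^ j) ((1 / (s - t)) *\<^sub>R (sol U s - sol U t) - sol (opB P U) t))"
        unfolding eventually_at_filter by (intro always_eventually) simp
    qed
  qed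
  then have "has_deriv_in (domB_pow P j) (graph_norm P j) (sol U) (sol (opB P U))"
    using W W' by (simp add: has_deriv_in_def)
  with Suc.IH[OF BU] show ?case by auto
qed

end

theorem theorem4:
  fixes P :: nanotube and U0 :: state
  assumes "len P > 0" "m0 P > 0" "b1 P > 0" "b2 P > 0" "\<kappa>1 P > 0" "\<kappa>2 P > 0"
    and "\<rho>1 P > 0" "\<rho>2 P > 0" "\<rho>3 P > 0" "\<rho>4 P > 0"
    and "\<gamma>1 P > 0" "\<gamma>2 P > 0" "\<gamma>3 P > 0" "\<gamma>4 P > 0"
    and "alpha P \<in> {0..1}" "beta P \<in> {0..1}"
    and "U0 \<in> phase P"
  shows "\<exists>U. mild_solution P U0 U \<and>
             (\<forall>V. mild_solution P U0 V \<longrightarrow> (\<forall>t\<ge>0. V t = U t)) \<and>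
             C_in (phase P) (normH P) U \<and>
             (\<forall>k. U0 \<in> domB_pow P k \<longrightarrow>
                (\<forall>j\<le>k. Ck_in (k - j) (domB_pow P j) (graph_norm P j) U))"
proof -
  interpret tube P by unfold_locales (fact assms)+
  \<comment> \<open>The hypothesis \<open>j \<le> k\<close> makes \<open>j + (k - j)\<close> equal
    to \<open>k\<close>, the form that \<open>sol_Ck\<close> requires, as subtraction does not
    truncate.\<close>
  have "Ck_in (k - j) (domB_pow P j) (graph_norm P j) (sol U0)" if "U0 \<in> domB_pow P k" "j \<le> k" for k j
    by (rule sol_Ck) (use that in simp)
  then show ?thesis
    using sol_mild[OF assms(17)] sol_C_in[OF assms(17)] mild_unique[OF assms(17)]
    by (intro exI[of _ "sol U0"]) blast
qed

end
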